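(* Let $(\mathfrak g,\tau)$ be a compactly causal symmetric Lie algebra. Let $\lambda\in\mathfrak a^*\subseteq i\mathfrak t^*$ be dominant integral for $\hat\Delta_k^+$ and assume that $\langle\lambda+\rho,\alpha\rangle<0$ for all $\alpha\in\Delta_n^+$. Then $\lambda$ is regular, i.e. $L(\lambda)=N(\lambda)$.
   Context: $\mathfrak g$ is a simple real Lie algebra with Cartan involution $\theta$, $\mathfrak g=\mathfrak k\oplus\mathfrak p$, and $\mathfrak g$ is hermitian: $\mathfrak z(\mathfrak k)\ne\{0\}$. Then $\mathfrak z(\mathfrak k)=\mathbb RiZ_0$ with $Z_0\in i\mathfrak z(\mathfrak k)$ normalized so that $\mathrm{ad}\,Z_0$ has spectrum $\{1,0,-1\}$; $\mathfrak p^\pm$ is the $\pm1$-eigenspace of $\mathrm{ad}\,Z_0$ in $\mathfrak g_{\mathbb C}$. $\tau$ is an involutive automorphism of $\mathfrak g$ commuting with $\theta$, with eigenspaces $\mathfrak h$ ($+1$) and $\mathfrak q$ ($-1$); $(\mathfrak g,\tau)$ is compactly causal if $\mathfrak z(\mathfrak k)\subseteq\mathfrak q$. Let $\mathfrak g^c=\mathfrak h+i\mathfrak q\subseteq\mathfrak g_{\mathbb C}$, $\mathfrak a\subseteq i(\mathfrak q\cap\mathfrak k)$ maximal abelian, $\Delta=\Delta(\mathfrak g^c,\mathfrak a)$ the restricted root system of $\mathfrak g^c$ with respect to $\mathfrak a$, $m_\alpha=\dim(\mathfrak g^c)^\alpha$. Let $\mathfrak t\subseteq\mathfrak k$ be a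 Cartan subalgebra with $\mathfrak t=(\mathfrak t\cap\mathfrak h)\oplus i\mathfrak a$, $\hat\Delta$ the roots of $(\mathfrak g_{\mathbb C},\mathfrak t_{\mathbb C})$, $\hat\Delta_k$ those vanishing on $Z_0$, and $\hat\Delta^+$ a positive system such that the positive non-compact roots are those taking the value $1$ on $Z_0$ and such that $-\tau\hat\Delta^+\subseteq\hat\Delta^+\cup\mathfrak a^\perp$ (where $\mathfrak a^\perp$ denotes the functionals vanishing on $\mathfrak a$); then $\Delta^+:=\hat\Delta^+|_{\mathfrak a}\setminus\{0\}$ is a positive system of $\Delta$. $\hat\Delta_k^+=\hat\Delta_k\cap\hat\Delta^+$; $\Delta_n^+$ is the set of $\alpha\in\Delta^+$ with $\alpha(Z_0)\neq0$ (note $Z_0\in\mathfrak a$). $\rho=\frac12\sum_{\alpha\in\Delta^+}m_\alpha\alpha\in\mathfrak a^*$. $\langle\cdot,\cdot\rangle$ is the inner product induced by the Cartan–Killing form, and $\mathfrak a^*$ is identified with a subspace of $i\mathfrak t^*$ through the orthogonal projection $\mathfrak t_{\mathbb C}\to\mathfrak a_{\mathbb C}$ (extension by $0$ on $\mathfrak t\cap\mathfrak h$). $F(\lambda)$ is the irreducible finite-dimensional $\mathfrak k_{\mathbb C}$-module with highest weight $\lambda$, regarded as a $\mathfrak k_{\mathbb C}+\mathfrak p^+$-module with $\mathfrak p^+$ acting by $0$; $N(\lambda)=\mathcal U(\mathfrak g_{\mathbb C})\otimes_{\mathcal U(\mathfrak k_{\mathbb C}+\mathfrak p^+)}F(\lambda)$,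 and $L(\lambda)$ is its unique simple quotient. (The inequality in the hypothesis is the condition for $L(\lambda)$ to belong to the relative holomorphic discrete series of $G/H$ when $F(\lambda)$ is $H\cap K$-spherical.) *)

theory Defs
  imports "HOL-Algebra.Free_Abelian_Groups" "HOL-Algebra.Generated_Groups" "HOL-Algebra.QuotRing"
    "HOL-Analysis.Product_Vector"
begin

section \<open>Lie algebras over a field\<close>

locale lie_algebra = vector_space sc
  for sc :: "'k::field \<Rightarrow> 'v::ab_group_add \<Rightarrow> 'v" +
  fixes br :: "'v \<Rightarrow> 'v \<Rightarrow> 'v"
  assumes linear_right: "Vector_Spaces.linear sc sc (br x)"
    and linear_left: "Vector_Spaces.linear sc sc (\<lambda>x. br x y)"
    and alternating: "br x x = 0"
    and jacobi: "br x (br y z) + br y (br z x) + br z (br x y) = 0"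

definition lie_ideal :: "('k::field \<Rightarrow> 'v::ab_group_add \<Rightarrow> 'v) \<Rightarrow> ('v \<Rightarrow> 'v \<Rightarrow> 'v) \<Rightarrow> 'v set \<Rightarrow> bool"
  where "lie_ideal sc br I \<longleftrightarrow>
    Modules.module.subspace sc I \<and> (\<forall>x. \<forall>y\<in>I. br x y \<in> I)"

definition simple_lie :: "('k::field \<Rightarrow> 'v::ab_group_add \<Rightarrow> 'v) \<Rightarrow> ('v \<Rightarrow> 'v \<Rightarrow> 'v) \<Rightarrow> bool"
  where "simple_lie sc br \<longleftrightarrow>
    (\<exists>x y. br x y \<noteq> 0) \<and> (\<forall>I. lie_ideal sc br I \<longrightarrow> I = {0} \<or> I = UNIV)"

definition lie_centre :: "('v \<Rightarrow> 'v \<Rightarrow> 'v::ab_group_add) \<Rightarrow> 'v set \<Rightarrow> 'v set"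
  where "lie_centre br S = {x \<in> S. \<forall>y\<in>S. br x y = 0}"

text \<open>The trace of an endomorphism of a finite-dimensional space, computed in an arbitrary basis.\<close>

definition lin_trace :: "('k::field \<Rightarrow> 'v::ab_group_add \<Rightarrow> 'v) \<Rightarrow> ('v \<Rightarrow> 'v) \<Rightarrow> 'k"
  where "lin_trace sc f =
    (let B = (SOME B. \<not> Modules.module.dependent sc B \<and> Modules.module.span sc B = UNIV)
     in \<Sum>b\<in>B. Modules.module.representation sc B (f b) b)"

definition killing_form :: "('k::field \<Rightarrow> 'v::ab_group_add \<Rightarrow> 'v) \<Rightarrow> ('v \<Rightarrow> 'v \<Rightarrow> 'v) \<Rightarrow> 'v \<Rightarrow> 'v \<Rightarrow> 'k"
  where "killing_form sc br x y = lin_trace sc (\<lambda>z. br x (br y z))"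

text \<open>A functional on a subspace \<open>S\<close> is represented by the function that agrees with it on \<open>S\<close> and
  is \<open>0\<close> off \<open>S\<close>, so that sums and multiples of functionals are pointwise.\<close>

definition dual_space :: "('k::field \<Rightarrow> 'v::ab_group_add \<Rightarrow> 'v) \<Rightarrow> 'v set \<Rightarrow> ('v \<Rightarrow> 'k) set"
  where "dual_space sc S =
    {f. (\<forall>x\<in>S. \<forall>y\<in>S. f (x + y) = f x + f y) \<and> (\<forall>c. \<forall>x\<in>S. f (sc c x) = c * f x) \<and>
        (\<forall>x. x \<notin> S \<longrightarrow> f x = 0)}"

text \<open>The form on the dual of \<open>S\<close> induced by a bilinear form whose restriction to \<open>S\<close> is nondegenerate.\<close>

definition riesz :: "('v \<Rightarrow> 'v \<Rightarrow> 'k) \<Rightarrow> 'v set \<Rightarrow> ('v \<Rightarrow> 'k) \<Rightarrow> 'v"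
  where "riesz B S f = (THE x. x \<in> S \<and> (\<forall>y\<in>S. B x y = f y))"

definition dual_form :: "('v \<Rightarrow> 'v \<Rightarrow> 'k) \<Rightarrow> 'v set \<Rightarrow> ('v \<Rightarrow> 'k) \<Rightarrow> ('v \<Rightarrow> 'k) \<Rightarrow> 'k"
  where "dual_form B S f g = B (riesz B S f) (riesz B S g)"


section \<open>Real Lie algebras and their complexification\<close>

definition plus_space :: "('g::real_vector \<Rightarrow> 'g) \<Rightarrow> 'g set"
  where "plus_space \<phi> = {x. \<phi> x = x}"

definition minus_space :: "('g::real_vector \<Rightarrow> 'g) \<Rightarrow> 'g set"
  where "minus_space \<phi> = {x. \<phi> x = - x}"

definition lie_automorphism :: "('g::real_vector \<Rightarrow> 'g \<Rightarrow> 'g) \<Rightarrow> ('g \<Rightarrow> 'g) \<Rightarrow> bool"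
  where "lie_automorphism br \<phi> \<longleftrightarrow>
    linear \<phi> \<and> bij \<phi> \<and> (\<forall>x y. \<phi> (br x y) = br (\<phi> x) (\<phi> y))"

definition cartan_involution :: "('g::real_vector \<Rightarrow> 'g \<Rightarrow> 'g) \<Rightarrow> ('g \<Rightarrow> 'g) \<Rightarrow> bool"
  where "cartan_involution br \<theta> \<longleftrightarrow>
    lie_automorphism br \<theta> \<and> \<theta> \<circ> \<theta> = id \<and>
    (\<forall>x. x \<noteq> 0 \<longrightarrow> - killing_form (*\<^sub>R) br x (\<theta> x) > 0)"

definition hermitian_lie_algebra :: "('g::real_vector \<Rightarrow> 'g \<Rightarrow> 'g) \<Rightarrow> ('g \<Rightarrow> 'g) \<Rightarrow> bool"
  where "hermitian_lie_algebra br \<theta> \<longleftrightarrow>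
    lie_algebra (*\<^sub>R) br \<and> (\<exists>B::'g set. finite B \<and> span B = UNIV) \<and> simple_lie (*\<^sub>R) br \<and>
    cartan_involution br \<theta> \<and> lie_centre br (plus_space \<theta>) \<noteq> {0}"

definition compactly_causal ::
    "('g::real_vector \<Rightarrow> 'g \<Rightarrow> 'g) \<Rightarrow> ('g \<Rightarrow> 'g) \<Rightarrow> ('g \<Rightarrow> 'g) \<Rightarrow> bool"
  where "compactly_causal br \<theta> \<tau> \<longleftrightarrow>
    hermitian_lie_algebra br \<theta> \<and> lie_automorphism br \<tau> \<and> \<tau> \<circ> \<tau> = id \<and> \<tau> \<circ> \<theta> = \<theta> \<circ> \<tau> \<and>
    lie_centre br (plus_space \<theta>) \<subseteq> minus_space \<tau>"

primrec lower_central_series :: "('g::real_vector \<Rightarrow> 'g \<Rightarrow> 'g) \<Rightarrow> 'g set \<Rightarrow> nat \<Rightarrow> 'g set"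
  where
    "lower_central_series br S 0 = S"
  | "lower_central_series br S (Suc n) =
      span {br x y | x y. x \<in> S \<and> y \<in> lower_central_series br S n}"

definition cartan_subalgebra :: "('g::real_vector \<Rightarrow> 'g \<Rightarrow> 'g) \<Rightarrow> 'g set \<Rightarrow> bool"
  where "cartan_subalgebra br t \<longleftrightarrow>
    subspace t \<and> (\<forall>x\<in>t. \<forall>y\<in>t. br x y \<in> t) \<and>
    (\<exists>n. lower_central_series br t n = {0}) \<and>
    (\<forall>x. (\<forall>y\<in>t. br x y \<in> t) \<longrightarrow> x \<in> t)"

definition maximal_abelian_in :: "('g::real_vector \<Rightarrow> 'g \<Rightarrow> 'g) \<Rightarrow> 'g set \<Rightarrow> 'g set \<Rightarrow> bool"
  where "maximal_abelian_in br V a \<longleftrightarrow>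
    (let ab = (\<lambda>b. subspace b \<and> b \<subseteq> V \<and> (\<forall>x\<in>b. \<forall>y\<in>b. br x y = 0))
     in ab a \<and> (\<forall>b. ab b \<and> a \<subseteq> b \<longrightarrow> b = a))"

text \<open>The pair \<open>(x, y)\<close> stands for \<open>x + i y\<close> in the complexification. Hence \<open>V \<times> V\<close> is the complex span
  of a real subspace \<open>V\<close>, \<open>{0} \<times> V\<close> is \<open>i V\<close>, and \<open>V \<times> W\<close> is \<open>V + i W\<close>.\<close>

type_synonym 'g cplx = "'g \<times> 'g"

definition cscale :: "complex \<Rightarrow> 'g::real_vector cplx \<Rightarrow> 'g cplx"
  where "cscale c X =
    (Re c *\<^sub>R fst X - Im c *\<^sub>R snd X, Re c *\<^sub>R snd X + Im c *\<^sub>R fst X)"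

definition cbr :: "('g::real_vector \<Rightarrow> 'g \<Rightarrow> 'g) \<Rightarrow> 'g cplx \<Rightarrow> 'g cplx \<Rightarrow> 'g cplx"
  where "cbr br X Y =
    (br (fst X) (fst Y) - br (snd X) (snd Y), br (fst X) (snd Y) + br (snd X) (fst Y))"

definition cmap :: "('g \<Rightarrow> 'g) \<Rightarrow> 'g cplx \<Rightarrow> 'g cplx"
  where "cmap \<phi> X = (\<phi> (fst X), \<phi> (snd X))"

definition normalized_central_element ::
    "('g::real_vector \<Rightarrow> 'g \<Rightarrow> 'g) \<Rightarrow> ('g \<Rightarrow> 'g) \<Rightarrow> 'g cplx \<Rightarrow> bool"
  where "normalized_central_element br \<theta> Z0 \<longleftrightarrow>
    Z0 \<in> {0} \<times> lie_centre br (plus_space \<theta>) \<and>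
    {c. \<exists>X. X \<noteq> 0 \<and> cbr br Z0 X = cscale c X} = {1, 0, -1}"

definition p_plus :: "('g::real_vector \<Rightarrow> 'g \<Rightarrow> 'g) \<Rightarrow> 'g cplx \<Rightarrow> 'g cplx set"
  where "p_plus br Z0 = {X. cbr br Z0 X = X}"

definition k_complex :: "('g::real_vector \<Rightarrow> 'g) \<Rightarrow> 'g cplx set"
  where "k_complex \<theta> = plus_space \<theta> \<times> plus_space \<theta>"

definition k_p_plus ::
    "('g::real_vector \<Rightarrow> 'g \<Rightarrow> 'g) \<Rightarrow> ('g \<Rightarrow> 'g) \<Rightarrow> 'g cplx \<Rightarrow> 'g cplx set"
  where "k_p_plus br \<theta> Z0 = {X + Y | X Y. X \<in> k_complex \<theta> \<and> Y \<in> p_plus br Z0}"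


section \<open>Roots and restricted roots\<close>

definition root_space ::
    "('g::real_vector \<Rightarrow> 'g \<Rightarrow> 'g) \<Rightarrow> 'g set \<Rightarrow> ('g cplx \<Rightarrow> complex) \<Rightarrow> 'g cplx set"
  where "root_space br t \<beta> = {X. \<forall>H \<in> t \<times> t. cbr br H X = cscale (\<beta> H) X}"

definition lie_roots :: "('g::real_vector \<Rightarrow> 'g \<Rightarrow> 'g) \<Rightarrow> 'g set \<Rightarrow> ('g cplx \<Rightarrow> complex) set"
  where "lie_roots br t =
    {\<beta> \<in> dual_space cscale (t \<times> t). \<beta> \<noteq> (\<lambda>_. 0) \<and> root_space br t \<beta> \<noteq> {0}}"

text \<open>The roots are real on \<open>i t\<close>; a positive system consists of the roots that are positive on some
  regular element of \<open>i t\<close>.\<close>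

definition positive_system ::
    "('g::real_vector \<Rightarrow> 'g \<Rightarrow> 'g) \<Rightarrow> 'g set \<Rightarrow> ('g cplx \<Rightarrow> complex) set \<Rightarrow> bool"
  where "positive_system br t P \<longleftrightarrow>
    (\<exists>X \<in> {0} \<times> t. (\<forall>\<beta> \<in> lie_roots br t. Re (\<beta> X) \<noteq> 0) \<and> P = {\<beta> \<in> lie_roots br t. Re (\<beta> X) > 0})"

definition compact_part :: "'g cplx \<Rightarrow> ('g cplx \<Rightarrow> complex) set \<Rightarrow> ('g cplx \<Rightarrow> complex) set"
  where "compact_part Z0 R = {\<beta> \<in> R. \<beta> Z0 = 0}"

definition restricted_root_space ::
    "('g::real_vector \<Rightarrow> 'g \<Rightarrow> 'g) \<Rightarrow> ('g \<Rightarrow> 'g) \<Rightarrow> 'g cplx set \<Rightarrow> ('g cplx \<Rightarrow> real) \<Rightarrow> 'g cplx set"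
  where "restricted_root_space br \<tau> a \<alpha> =
    {X \<in> plus_space \<tau> \<times> minus_space \<tau>. \<forall>H\<in>a. cbr br H X = \<alpha> H *\<^sub>R X}"

text \<open>Roots are real on \<open>i t\<close>, hence on \<open>a\<close>; taking the real part only changes the type.\<close>

definition restrict_functional :: "'g cplx set \<Rightarrow> ('g cplx \<Rightarrow> complex) \<Rightarrow> 'g cplx \<Rightarrow> real"
  where "restrict_functional a \<beta> = (\<lambda>H. if H \<in> a then Re (\<beta> H) else 0)"

definition restricted_positive ::
    "'g cplx set \<Rightarrow> ('g cplx \<Rightarrow> complex) set \<Rightarrow> ('g cplx \<Rightarrow> real) set"
  where "restricted_positive a P = restrict_functional a ` P - {\<lambda>_. 0}"

definition restricted_noncompact_positive ::
    "'g cplx \<Rightarrow> 'g cplx set \<Rightarrow> ('g cplx \<Rightarrow> complex) set \<Rightarrow> ('g cplx \<Rightarrow> real) set"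
  where "restricted_noncompact_positive Z0 a P = {\<alpha> \<in> restricted_positive a P. \<alpha> Z0 \<noteq> 0}"

definition rho ::
    "('g::real_vector \<Rightarrow> 'g \<Rightarrow> 'g) \<Rightarrow> ('g \<Rightarrow> 'g) \<Rightarrow> 'g cplx set \<Rightarrow> ('g cplx \<Rightarrow> complex) set \<Rightarrow>
      'g cplx \<Rightarrow> real"
  where "rho br \<tau> a P =
    (\<lambda>H. 1/2 * (\<Sum>\<alpha> \<in> restricted_positive a P. real (dim (restricted_root_space br \<tau> a \<alpha>)) * \<alpha> H))"

text \<open>The form on the dual of the complexification of \<open>t\<close> induced by the Cartan-Killing form; it is real
  and positive definite on the functionals that are real on \<open>i t\<close>.\<close>

definition weight_form ::
    "('g::real_vector \<Rightarrow> 'g \<Rightarrow> 'g) \<Rightarrow> 'g set \<Rightarrow> ('g cplx \<Rightarrow> complex) \<Rightarrow> ('g cplx \<Rightarrow> complex) \<Rightarrow> complex"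
  where "weight_form br t = dual_form (killing_form cscale (cbr br)) (t \<times> t)"

text \<open>The embedding of the dual of \<open>a\<close> into that of the complexification of \<open>t\<close>, by extension by \<open>0\<close> on
  the \<open>\<tau>\<close>-fixed elements of \<open>t\<close>.\<close>

definition extend_functional ::
    "('g::real_vector \<Rightarrow> 'g) \<Rightarrow> 'g set \<Rightarrow> 'g cplx set \<Rightarrow> ('g cplx \<Rightarrow> real) \<Rightarrow> 'g cplx \<Rightarrow> complex"
  where "extend_functional \<tau> t a \<alpha> =
    (THE \<mu>. \<mu> \<in> dual_space cscale (t \<times> t) \<and> (\<forall>H\<in>a. \<mu> H = complex_of_real (\<alpha> H)) \<and>
       (\<forall>H \<in> (t \<inter> plus_space \<tau>) \<times> {0}. \<mu> H = 0))"

definition a_inner ::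
    "('g::real_vector \<Rightarrow> 'g \<Rightarrow> 'g) \<Rightarrow> ('g \<Rightarrow> 'g) \<Rightarrow> 'g set \<Rightarrow> 'g cplx set \<Rightarrow>
      ('g cplx \<Rightarrow> real) \<Rightarrow> ('g cplx \<Rightarrow> real) \<Rightarrow> real"
  where "a_inner br \<tau> t a \<alpha> \<beta> =
    Re (weight_form br t (extend_functional \<tau> t a \<alpha>) (extend_functional \<tau> t a \<beta>))"

definition dominant_integral ::
    "('g::real_vector \<Rightarrow> 'g \<Rightarrow> 'g) \<Rightarrow> 'g set \<Rightarrow> ('g cplx \<Rightarrow> complex) set \<Rightarrow> ('g cplx \<Rightarrow> complex) \<Rightarrow> bool"
  where "dominant_integral br t R \<mu> \<longleftrightarrow>
    (\<forall>\<beta>\<in>R. \<exists>n::nat. 2 * weight_form br t \<mu> \<beta> / weight_form br t \<beta> \<beta> = of_nat n)"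


section \<open>Modules of the complexified maximal compact subalgebra\<close>

text \<open>The action is constrained only on the complexification of \<open>k\<close>.\<close>

definition k_module ::
    "('g::real_vector \<Rightarrow> 'g \<Rightarrow> 'g) \<Rightarrow> ('g \<Rightarrow> 'g) \<Rightarrow> (complex \<Rightarrow> 'f::ab_group_add \<Rightarrow> 'f) \<Rightarrow>
      ('g cplx \<Rightarrow> 'f \<Rightarrow> 'f) \<Rightarrow> bool"
  where "k_module br \<theta> sF act \<longleftrightarrow>
    vector_space sF \<and> (\<exists>B. finite B \<and> Modules.module.span sF B = UNIV) \<and>
    (\<forall>X \<in> k_complex \<theta>. Vector_Spaces.linear sF sF (act X)) \<and>
    (\<forall>X \<in> k_complex \<theta>. \<forall>Y \<in> k_complex \<theta>. \<forall>v. act (X + Y) v = act X v + act Y v) \<and>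
    (\<forall>X \<in> k_complex \<theta>. \<forall>c v. act (cscale c X) v = sF c (act X v)) \<and>
    (\<forall>X \<in> k_complex \<theta>. \<forall>Y \<in> k_complex \<theta>. \<forall>v.
       act (cbr br X Y) v = act X (act Y v) - act Y (act X v))"

definition irreducible_k_module ::
    "('g::real_vector \<Rightarrow> 'g \<Rightarrow> 'g) \<Rightarrow> ('g \<Rightarrow> 'g) \<Rightarrow> (complex \<Rightarrow> 'f::ab_group_add \<Rightarrow> 'f) \<Rightarrow>
      ('g cplx \<Rightarrow> 'f \<Rightarrow> 'f) \<Rightarrow> bool"
  where "irreducible_k_module br \<theta> sF act \<longleftrightarrow>
    k_module br \<theta> sF act \<and> (\<exists>v::'f. v \<noteq> 0) \<and>
    (\<forall>W. Modules.module.subspace sF W \<and> (\<forall>X \<in> k_complex \<theta>. act X ` W \<subseteq> W) \<longrightarrow> W = {0} \<or> W = UNIV)"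

definition has_highest_weight ::
    "('g::real_vector \<Rightarrow> 'g \<Rightarrow> 'g) \<Rightarrow> 'g set \<Rightarrow> ('g cplx \<Rightarrow> complex) set \<Rightarrow>
      (complex \<Rightarrow> 'f::ab_group_add \<Rightarrow> 'f) \<Rightarrow> ('g cplx \<Rightarrow> 'f \<Rightarrow> 'f) \<Rightarrow> ('g cplx \<Rightarrow> complex) \<Rightarrow> bool"
  where "has_highest_weight br t R sF act \<mu> \<longleftrightarrow>
    (\<exists>v. v \<noteq> 0 \<and> (\<forall>H \<in> t \<times> t. act H v = sF (\<mu> H) v) \<and>
         (\<forall>\<beta>\<in>R. \<forall>X \<in> root_space br t \<beta>. act X v = 0))"

text \<open>An action of \<open>k\<close> is extended to the parabolic subalgebra by letting \<open>p_plus\<close> act by \<open>0\<close>.\<close>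

definition extend_action ::
    "('g::real_vector \<Rightarrow> 'g \<Rightarrow> 'g) \<Rightarrow> ('g \<Rightarrow> 'g) \<Rightarrow> 'g cplx \<Rightarrow> ('g cplx \<Rightarrow> 'f \<Rightarrow> 'f) \<Rightarrow>
      'g cplx \<Rightarrow> 'f \<Rightarrow> 'f"
  where "extend_action br \<theta> Z0 act X =
    act (THE Y. Y \<in> k_complex \<theta> \<and> X - Y \<in> p_plus br Z0)"


section \<open>Enveloping algebras\<close>

text \<open>The free associative algebra on the set \<open>S\<close>: finite formal linear combinations of words in \<open>S\<close>.\<close>

definition free_algebra :: "'v set \<Rightarrow> ('v list \<Rightarrow>\<^sub>0 'k::field) ring"
  where "free_algebra S =
    \<lparr>carrier = {a. Poly_Mapping.keys a \<subseteq> lists S},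
     mult = (\<lambda>a b. \<Sum>u \<in> Poly_Mapping.keys a. \<Sum>v \<in> Poly_Mapping.keys b.
               Poly_Mapping.single (u @ v) (Poly_Mapping.lookup a u * Poly_Mapping.lookup b v)),
     one = Poly_Mapping.single [] 1, zero = 0, add = (+)\<rparr>"

text \<open>For a subalgebra \<open>S\<close>, the first two families of relations turn the free algebra into the tensor
  algebra of the vector space \<open>S\<close>.\<close>

definition enveloping_ideal ::
    "('k::field \<Rightarrow> 'v::ab_group_add \<Rightarrow> 'v) \<Rightarrow> ('v \<Rightarrow> 'v \<Rightarrow> 'v) \<Rightarrow> 'v set \<Rightarrow> ('v list \<Rightarrow>\<^sub>0 'k) set"
  where "enveloping_ideal sc br S = genideal (free_algebra S)
    ({Poly_Mapping.single [x + y] 1 - Poly_Mapping.single [x] 1 - Poly_Mapping.single [y] 1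
        | x y. x \<in> S \<and> y \<in> S} \<union>
     {Poly_Mapping.single [sc c x] 1 - Poly_Mapping.single [x] c | c x. x \<in> S} \<union>
     {Poly_Mapping.single [x, y] 1 - Poly_Mapping.single [y, x] 1 - Poly_Mapping.single [br x y] 1
        | x y. x \<in> S \<and> y \<in> S})"

definition enveloping_algebra ::
    "('k::field \<Rightarrow> 'v::ab_group_add \<Rightarrow> 'v) \<Rightarrow> ('v \<Rightarrow> 'v \<Rightarrow> 'v) \<Rightarrow> 'v set \<Rightarrow> ('v list \<Rightarrow>\<^sub>0 'k) set ring"
  where "enveloping_algebra sc br S = free_algebra S Quot enveloping_ideal sc br S"

text \<open>The canonical homomorphism from the enveloping algebra of a subalgebra to that of the whole Lie
  algebra. Here and below, a map induced on a quotient is given by \<^const>\<open>the_elem\<close> of the image of a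
  coset: all representatives have the same image.\<close>

definition enveloping_inclusion ::
    "('k::field \<Rightarrow> 'v::ab_group_add \<Rightarrow> 'v) \<Rightarrow> ('v \<Rightarrow> 'v \<Rightarrow> 'v) \<Rightarrow>
      ('v list \<Rightarrow>\<^sub>0 'k) set \<Rightarrow> ('v list \<Rightarrow>\<^sub>0 'k) set"
  where "enveloping_inclusion sc br C =
    the_elem ((\<lambda>x. enveloping_ideal sc br UNIV +>\<^bsub>free_algebra UNIV\<^esub> x) ` C)"

definition enveloping_action ::
    "('k::field \<Rightarrow> 'f::ab_group_add \<Rightarrow> 'f) \<Rightarrow> ('v \<Rightarrow> 'f \<Rightarrow> 'f) \<Rightarrow> ('v list \<Rightarrow>\<^sub>0 'k) set \<Rightarrow> 'f \<Rightarrow> 'f"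
  where "enveloping_action sF act C f =
    the_elem ((\<lambda>x. \<Sum>w \<in> Poly_Mapping.keys x. sF (Poly_Mapping.lookup x w) (foldr act w f)) ` C)"


section \<open>Tensor products and quotients of modules\<close>

text \<open>Modules over a possibly noncommutative ring. As for \<^const>\<open>free_Abelian_group\<close>, the underlying
  abelian group is a multiplicative group record.\<close>

record ('r, 'm) lmodule = "'m monoid" +
  lact :: "'r \<Rightarrow> 'm \<Rightarrow> 'm"

text \<open>\<open>tensor_kernel R M rmul lmul\<close> is the subgroup of the free abelian group on \<open>M \<times> F\<close> that is
  divided out to form the tensor product over \<open>R\<close> of the right module \<open>M\<close> and the left module \<open>F\<close>,
  where \<open>F\<close> is the whole type \<open>'f\<close>.\<close>

definition tensor_kernel ::
    "'r set \<Rightarrow> ('m, 'z) ring_scheme \<Rightarrow> ('m \<Rightarrow> 'r \<Rightarrow> 'm) \<Rightarrow> ('r \<Rightarrow> 'f \<Rightarrow> 'f::ab_group_add) \<Rightarrow>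
      ('m \<times> 'f \<Rightarrow>\<^sub>0 int) set"
  where "tensor_kernel R M rmul lmul = generate (free_Abelian_group (carrier M \<times> UNIV))
    ({frag_of (m \<oplus>\<^bsub>M\<^esub> m', f) - frag_of (m, f) - frag_of (m', f)
        | m m' f. m \<in> carrier M \<and> m' \<in> carrier M} \<union>
     {frag_of (m, f + f') - frag_of (m, f) - frag_of (m, f') | m f f'. m \<in> carrier M} \<union>
     {frag_of (rmul m r, f) - frag_of (m, lmul r f) | m r f. m \<in> carrier M \<and> r \<in> R})"

text \<open>If \<open>M\<close> is itself a ring acting on itself by left multiplication, the tensor product is a left
  module over \<open>M\<close> with \<open>u (m \<otimes> f) = (u m) \<otimes> f\<close>.\<close>

definition tensor_module ::
    "'r set \<Rightarrow> ('m, 'z) ring_scheme \<Rightarrow> ('m \<Rightarrow> 'r \<Rightarrow> 'm) \<Rightarrow> ('r \<Rightarrow> 'f \<Rightarrow> 'f::ab_group_add) \<Rightarrow>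
      ('m, ('m \<times> 'f \<Rightarrow>\<^sub>0 int) set) lmodule"
  where "tensor_module R M rmul lmul =
    (let G = free_Abelian_group (carrier M \<times> UNIV); K = tensor_kernel R M rmul lmul
     in \<lparr>carrier = carrier (G Mod K), monoid.mult = monoid.mult (G Mod K), one = one (G Mod K),
         lact = (\<lambda>u C. the_elem
           ((\<lambda>x. K #>\<^bsub>G\<^esub> frag_extend (\<lambda>(m, f). frag_of (u \<otimes>\<^bsub>M\<^esub> m, f)) x) ` C))\<rparr>)"

definition lsubmodule :: "'r set \<Rightarrow> ('r, 'm) lmodule \<Rightarrow> 'm set \<Rightarrow> bool"
  where "lsubmodule R N J \<longleftrightarrow> subgroup J N \<and> (\<forall>u\<in>R. \<forall>x\<in>J. lact N u x \<in> J)"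

definition maximal_lsubmodule :: "'r set \<Rightarrow> ('r, 'm) lmodule \<Rightarrow> 'm set \<Rightarrow> bool"
  where "maximal_lsubmodule R N J \<longleftrightarrow>
    lsubmodule R N J \<and> J \<noteq> carrier N \<and>
    (\<forall>J'. lsubmodule R N J' \<and> J \<subseteq> J' \<longrightarrow> J' = J \<or> J' = carrier N)"

definition quotient_lmodule :: "('r, 'm) lmodule \<Rightarrow> 'm set \<Rightarrow> ('r, 'm set) lmodule"
  where "quotient_lmodule N J =
    \<lparr>carrier = carrier (N Mod J), monoid.mult = monoid.mult (N Mod J), one = one (N Mod J),
     lact = (\<lambda>u C. the_elem ((\<lambda>x. J #>\<^bsub>N\<^esub> lact N u x) ` C))\<rparr>"

definition lmodule_iso :: "'r set \<Rightarrow> ('r, 'm) lmodule \<Rightarrow> ('r, 'n) lmodule \<Rightarrow> ('m \<Rightarrow> 'n) set"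
  where "lmodule_iso R N L =
    {h \<in> iso N L. \<forall>u\<in>R. \<forall>x \<in> carrier N. h (lact N u x) = lact L u (h x)}"

text \<open>Meaningful for a module with exactly one maximal submodule, that is, exactly one simple quotient.\<close>

definition the_maximal_lsubmodule :: "'r set \<Rightarrow> ('r, 'm) lmodule \<Rightarrow> 'm set"
  where "the_maximal_lsubmodule R N = (THE J. maximal_lsubmodule R N J)"


section \<open>The modules \<open>N(\<lambda>)\<close> and \<open>L(\<lambda>)\<close>\<close>

abbreviation U_alg :: "('g::real_vector \<Rightarrow> 'g \<Rightarrow> 'g) \<Rightarrow> 'g cplx set \<Rightarrow> ('g cplx list \<Rightarrow>\<^sub>0 complex) set ring"
  where "U_alg br S \<equiv> enveloping_algebra cscale (cbr br) S"

definition N_module ::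
    "('g::real_vector \<Rightarrow> 'g \<Rightarrow> 'g) \<Rightarrow> ('g \<Rightarrow> 'g) \<Rightarrow> 'g cplx \<Rightarrow>
      (complex \<Rightarrow> 'f::ab_group_add \<Rightarrow> 'f) \<Rightarrow> ('g cplx \<Rightarrow> 'f \<Rightarrow> 'f) \<Rightarrow>
      (('g cplx list \<Rightarrow>\<^sub>0 complex) set, (('g cplx list \<Rightarrow>\<^sub>0 complex) set \<times> 'f \<Rightarrow>\<^sub>0 int) set) lmodule"
  where "N_module br \<theta> Z0 sF act =
    tensor_module (carrier (U_alg br (k_p_plus br \<theta> Z0))) (U_alg br UNIV)
      (\<lambda>u r. u \<otimes>\<^bsub>U_alg br UNIV\<^esub> enveloping_inclusion cscale (cbr br) r)
      (enveloping_action sF (extend_action br \<theta> Z0 act))"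

definition L_kernel ::
    "('g::real_vector \<Rightarrow> 'g \<Rightarrow> 'g) \<Rightarrow> ('g \<Rightarrow> 'g) \<Rightarrow> 'g cplx \<Rightarrow>
      (complex \<Rightarrow> 'f::ab_group_add \<Rightarrow> 'f) \<Rightarrow> ('g cplx \<Rightarrow> 'f \<Rightarrow> 'f) \<Rightarrow>
      (('g cplx list \<Rightarrow>\<^sub>0 complex) set \<times> 'f \<Rightarrow>\<^sub>0 int) set set"
  where "L_kernel br \<theta> Z0 sF act =
    the_maximal_lsubmodule (carrier (U_alg br UNIV)) (N_module br \<theta> Z0 sF act)"

definition L_module ::
    "('g::real_vector \<Rightarrow> 'g \<Rightarrow> 'g) \<Rightarrow> ('g \<Rightarrow> 'g) \<Rightarrow> 'g cplx \<Rightarrow>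
      (complex \<Rightarrow> 'f::ab_group_add \<Rightarrow> 'f) \<Rightarrow> ('g cplx \<Rightarrow> 'f \<Rightarrow> 'f) \<Rightarrow>
      (('g cplx list \<Rightarrow>\<^sub>0 complex) set,
       (('g cplx list \<Rightarrow>\<^sub>0 complex) set \<times> 'f \<Rightarrow>\<^sub>0 int) set set) lmodule"
  where "L_module br \<theta> Z0 sF act =
    quotient_lmodule (N_module br \<theta> Z0 sF act) (L_kernel br \<theta> Z0 sF act)"

text \<open>\<open>L(\<lambda>) = N(\<lambda>)\<close>: the quotient map is an isomorphism of modules over the enveloping algebra.\<close>

definition regular_weight ::
    "('g::real_vector \<Rightarrow> 'g \<Rightarrow> 'g) \<Rightarrow> ('g \<Rightarrow> 'g) \<Rightarrow> 'g cplx \<Rightarrow>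
      (complex \<Rightarrow> 'f::ab_group_add \<Rightarrow> 'f) \<Rightarrow> ('g cplx \<Rightarrow> 'f \<Rightarrow> 'f) \<Rightarrow> bool"
  where "regular_weight br \<theta> Z0 sF act \<longleftrightarrow>
    (\<lambda>x. L_kernel br \<theta> Z0 sF act #>\<^bsub>N_module br \<theta> Z0 sF act\<^esub> x) \<in>
      lmodule_iso (carrier (U_alg br UNIV)) (N_module br \<theta> Z0 sF act) (L_module br \<theta> Z0 sF act)"

end

theory Submission
  imports Defs "HOL-Computational_Algebra.Fundamental_Theorem_Algebra" "HOL-Library.Function_Algebras"
begin

text \<open>Grade \<open>N(\<lambda>)\<close> by the \<open>Z\<^sub>0\<close>-eigenvalues and let \<open>c\<close> be the Casimir eigenvalue. The extremal component
  of a nonzero proper submodule, say \<open>d > 0\<close> steps below the top, is killed by \<open>p\<^sup>+\<close>. On such vectors the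
  Casimir operator agrees with an operator \<open>C\<close> that commutes with \<open>k\<close>, so \<open>C - c\<close> is not injective, hence not
  surjective, on the component \<open>N\<^sub>d\<close> of \<open>N(\<lambda>)\<close>. A highest weight \<open>\<nu>\<close> of \<open>N\<^sub>d\<close> modulo the image of \<open>C - c\<close>
  has the form \<open>\<lambda> - Q\<close> with \<open>Q\<close> a sum of \<open>d\<close> positive non-compact roots, and \<open>C\<close> acts there by \<open>c\<close>;
  passing to the quotient avoids complete reducibility. Comparing the two Casimir eigenvalues gives
  \<open>\<langle>Q, Q\<rangle> = 2\<langle>Q, \<lambda> + \<rho>\<rangle> + \<langle>Q, 2\<rho>\<^sub>0\<rangle>\<close>, where \<open>2\<rho>\<^sub>0\<close> is the sum of the positive roots vanishing on \<open>a\<close>.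
  The first term is negative by hypothesis. These roots \<open>\<beta>\<close> are compact and \<open>\<langle>\<lambda>, \<beta>\<rangle> = 0\<close>, so the dominance
  of \<open>\<nu>\<close> gives \<open>\<langle>Q, \<beta>\<rangle> = - \<langle>\<nu>, \<beta>\<rangle> \<le> 0\<close>, contradicting \<open>\<langle>Q, Q\<rangle> > 0\<close>. That \<open>N(\<lambda>) \<noteq> 0\<close> is seen without
  the PBW theorem, from a homomorphism to the coinduced module of formal power series on \<open>p\<^sup>+\<close>.\<close>

section \<open>Linear algebra\<close>

text \<open>\<open>N(\<lambda>)\<close> is a quotient of a free abelian group, to which linear
  algebra does not apply directly. It is therefore replaced by the space of finite sums of words
  with coefficients in \<open>F\<close>; the subspace of relations is split off by a linear
  projection, so that the Lie algebra acts by linear maps on a type. The structure theory is read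
  off one basis of weight vectors for \<open>t\<close> and its dual basis for the Killing form: the
  Casimir operator is a sum over this basis, and roots are counted with multiplicity by counting
  basis vectors. \<open>C\<close> is the Casimir operator without the terms whose right factor lies
  in \<open>p\<^sup>+\<close>. It still commutes with \<open>k\<close> because each graded part of
  the Casimir sum does so by itself. The term with \<open>2\<rho>\<^sub>0\<close> arises because
  Casimir eigenvalues involve the sum of all positive roots, whereas \<rho> is built from restricted
  roots. The positive roots not vanishing on \<open>a\<close> are permuted by \<beta> \<mapsto> -
  \<tau>\<beta>, so their sum lies in the dual of \<open>a\<close> and equals 2\<rho>; those
  vanishing on \<open>a\<close> remain.\<close>

context vector_space
begin

lemma linear_apply:
  assumes "Vector_Spaces.linear scale scale f"
  shows "f (x + y) = f x + f y" "f (scale c x) = scale c (f x)" "f 0 = 0" "f (x - y) = f x - f y"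
    "f (- x) = - f x" "f (sum g A) = (\<Sum>a\<in>A. f (g a))"
proof -
  interpret f: Vector_Spaces.linear scale scale f by fact
  show "f (x + y) = f x + f y" "f (scale c x) = scale c (f x)" "f 0 = 0" "f (x - y) = f x - f y"
    "f (- x) = - f x" "f (sum g A) = (\<Sum>a\<in>A. f (g a))"
    by (simp_all add: f.add f.scale f.diff f.neg f.sum)
qed

lemma linear_endoI:
  assumes "\<And>x y. f (x + y) = f x + f y" "\<And>c x. f (scale c x) = scale c (f x)"
  shows "Vector_Spaces.linear scale scale f"
  using assms vector_space_axioms by (simp add: Vector_Spaces.linear_iff)

text \<open>Applying \<open>A - c e0\<close> removes the component at \<open>e0\<close> and
  multiplies every other one by the nonzero number \<open>c e - c e0\<close>, so the induction
  hypothesis applies to the rescaled components.\<close>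

lemma eigencomponents_mem:
  assumes "finite E" "subspace S" "\<And>x. x \<in> S \<Longrightarrow> A x \<in> S" "Vector_Spaces.linear scale scale A"
    "\<And>e. e \<in> E \<Longrightarrow> A (w e) = scale (c e) (w e)" "inj_on c E" "sum w E \<in> S"
  shows "\<forall>e\<in>E. w e \<in> S"
  using assms(1,5,6,7)
proof (induction E arbitrary: w rule: finite_induct)
  case (insert e0 E)
  let ?w = "\<lambda>e. scale (c e - c e0) (w e)"
  have "A (sum w (insert e0 E)) - scale (c e0) (sum w (insert e0 E)) \<in> S"
    using insert.prems(3) assms(2,3) by (intro subspace_diff subspace_scale) auto
  also have "A (sum w (insert e0 E)) = (\<Sum>e\<in>insert e0 E. scale (c e) (w e))"
    using insert.prems(1) by (simp add: linear_apply[OF assms(4)])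
  also have "\<dots> - scale (c e0) (sum w (insert e0 E)) = (\<Sum>e\<in>insert e0 E. ?w e)"
    by (simp only: scale_sum_right sum_subtractf[symmetric] scale_left_diff_distrib)
  also have "\<dots> = sum ?w E" using insert.hyps by simp
  finally have "sum ?w E \<in> S" .
  moreover have "A (?w e) = scale (c e) (?w e)" if "e \<in> E" for e
    using insert.prems(1)[of e] that by (simp add: linear_apply[OF assms(4)] scale_left_commute)
  moreover have "inj_on c E" using insert.prems(2) by auto
  ultimately have *: "\<forall>e\<in>E. ?w e \<in> S" using insert.IH[of ?w] by blast
  have E: "w e \<in> S" if "e \<in> E" for e
  proof -
    have "c e - c e0 \<noteq> 0" using insert.prems(2) insert.hyps that by (auto simp: inj_on_def)
    then have "w e = scale (inverse (c e - c e0)) (?w e)" by simp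
    then show ?thesis using * that assms(2) by (metis subspace_scale)
  qed
  have "w e0 = sum w (insert e0 E) - sum w E" using insert.hyps by simp
  moreover have "sum w (insert e0 E) - sum w E \<in> S"
    by (rule subspace_diff[OF assms(2) insert.prems(3) subspace_sum[OF assms(2) E]])
  ultimately show ?case using E by auto
qed simp

text \<open>Extend a nonzero kernel vector \<open>x\<close> to a basis \<open>b\<close> of the span.
  Then the image is already spanned by \<open>f\<close> on \<open>b - {x}\<close>, which has too few
  elements to span an independent set of the size of \<open>b\<close>.\<close>

lemma surj_on_finite_span_imp_inj:
  assumes "finite A" "Vector_Spaces.linear scale scale f" "span A \<subseteq> f ` span A" "x \<in> span A" "f x = 0"
  shows "x = 0"
proof (rule ccontr)
  assume "x \<noteq> 0"
  then have "independent {x}" by simp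
  then obtain b where b: "{x} \<subseteq> b" "b \<subseteq> span A" "independent b" "span A \<subseteq> span b"
    using maximal_independent_subset_extend[of "{x}" "span A"] assms(4) by auto
  then have fin: "finite b" using independent_span_bound[OF assms(1)] by blast
  interpret f: Vector_Spaces.linear scale scale f by fact
  have sb: "span b = span A" using b(2,4) by (metis span_mono span_span subset_antisym)
  have "f ` span b = span (f ` b)" using f.span_image by simp
  also have "\<dots> \<subseteq> span (f ` (b - {x}))"
  proof (rule span_minimal)
    show "f ` b \<subseteq> span (f ` (b - {x}))"
    proof
      fix y assume "y \<in> f ` b"
      then obtain z where "z \<in> b" "y = f z" by blast
      then show "y \<in> span (f ` (b - {x}))"
        using assms(5) by (cases "z = x") (auto simp: span_zero intro!: span_base)
    qed
  qed simp
  finally have "b \<subseteq> span (f ` (b - {x}))" using assms(3) b(2) sb by blast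
  then have "card b \<le> card (f ` (b - {x}))"
    using independent_span_bound[of "f ` (b - {x})" b] b(3) fin by (metis finite_Diff finite_imageI)
  also have "\<dots> \<le> card (b - {x})" using fin by (intro card_image_le) auto
  also have "\<dots> < card b" using fin b(1) by (intro psubset_card_mono) auto
  finally show False by simp
qed

text \<open>Nonzero eigenvectors with distinct eigenvalues are independent, so at most
  \<open>card A\<close> of them fit into the span. This ends the strings produced by iterating a
  lowering operator.\<close>

lemma eigenvector_sequence_vanishes:
  assumes "finite A" "\<And>n::nat. v n \<in> span A" "Vector_Spaces.linear scale scale f"
    "\<And>n. f (v n) = scale (c n) (v n)" "inj c"
  shows "\<exists>n. v n = 0"
proof (rule ccontr)
  assume "\<nexists>n. v n = 0"
  then have nz: "v n \<noteq> 0" for n by simp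
  have inj: "inj v"
  proof
    fix m n assume "v m = v n"
    then have "scale (c m) (v m) = scale (c n) (v m)" using assms(4) by metis
    then show "m = n" using nz assms(5) by (auto dest: injD)
  qed
  let ?N = "{..card A}"
  have "independent (v ` ?N)"
  proof (rule independent_if_scalars_zero)
    fix u x assume *: "(\<Sum>x\<in>v ` ?N. scale (u x) x) = 0" and x: "x \<in> v ` ?N"
    have "\<forall>n\<in>?N. scale (u (v n)) (v n) \<in> {0}"
    proof (rule eigencomponents_mem[where A = f and c = c])
      show "(\<Sum>n\<in>?N. scale (u (v n)) (v n)) \<in> {0}"
        using * inj by (simp add: sum.reindex inj_on_subset)
      show "f (scale (u (v e)) (v e)) = scale (c e) (scale (u (v e)) (v e))" for e
        by (simp add: linear_apply[OF assms(3)] assms(4) scale_left_commute)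
    qed (use assms(3,5) in \<open>auto simp: linear_apply inj_on_def inj_def\<close>)
    then show "u x = 0" using x nz by auto
  qed simp
  then have "card (v ` ?N) \<le> card A" using independent_span_bound[OF assms(1)] assms(2) by blast
  moreover have "card (v ` ?N) = card ?N" using inj by (meson card_image inj_on_subset subset_UNIV)
  ultimately show False by simp
qed

end

text \<open>The iterates of \<open>f\<close> at \<open>x\<close> repeat or are dependent, which
  gives a nonzero polynomial \<open>p\<close> with \<open>p(f) x = 0\<close>. Splitting off linear
  factors, one of them must kill a nonzero vector \<open>q(f) x\<close>. Only a finitely spanned
  part of the type is involved.\<close>

lemma complex_eigenvector_exists:
  fixes sc :: "complex \<Rightarrow> 'v::ab_group_add \<Rightarrow> 'v"
  assumes "vector_space sc" "Vector_Spaces.linear sc sc f" "finite A" "Modules.module.subspace sc W"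
    "W \<subseteq> Modules.module.span sc A" "\<And>x. x \<in> W \<Longrightarrow> f x \<in> W" "x \<in> W" "x \<noteq> 0"
  shows "\<exists>a y. y \<in> W \<and> y \<noteq> 0 \<and> f y = sc a y"
proof -
  interpret vector_space sc by fact
  interpret f: Vector_Spaces.linear sc sc f by fact
  \<comment> \<open>\<open>E p\<close> is \<open>p(f)\<close> applied to \<open>x\<close>, evaluated
    by Horner's scheme.\<close>
  define E where "E p = fold_coeffs (\<lambda>a r. sc a x + f r) p 0" for p
  have E0: "E 0 = 0" by (simp add: E_def)
  have EC: "E (pCons a p) = sc a x + f (E p)" for a p
    by (cases "a = 0 \<and> p = 0") (auto simp: E_def f.zero)
  have EA: "E (p + q) = E p + E q" for p q
    by (induction p q rule: poly_induct2) (simp_all add: E0 EC f.add scale_left_distrib algebra_simps)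
  have EM: "E (smult a p) = sc a (E p)" for a p
    by (induction p) (simp_all add: E0 EC f.scale scale_right_distrib)
  have EW: "E p \<in> W" for p
    by (induction p)
      (use assms(4,6,7) in \<open>auto simp: E0 EC subspace_0 intro!: subspace_add subspace_scale\<close>)
  have Emon: "E (monom a i) = sc a ((f ^^ i) x)" for a i
    by (induction i) (simp_all add: monom_0 monom_Suc E0 EC f.scale)
  have Esum: "E (sum g I) = (\<Sum>i\<in>I. E (g i))" for g and I :: "nat set"
    by (induction I rule: infinite_finite_induct) (simp_all add: E0 EA)
  have fact: "\<exists>a y. y \<in> W \<and> y \<noteq> 0 \<and> f y = sc a y" if "p \<noteq> 0" "E p = 0" for p
    using that
  proof (induction "degree p" arbitrary: p rule: less_induct)
    case less
    show ?case
    proof (cases "degree p = 0")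
      case True
      then obtain a where "p = [:a:]" by (meson degree_eq_zeroE)
      then show ?thesis using less.prems assms(8) by (simp add: EC E0 f.zero)
    next
      case False
      then obtain a where "poly p a = 0"
        using fundamental_theorem_of_algebra constant_degree by metis
      then obtain q where q: "p = [:- a, 1:] * q" by (metis poly_eq_0_iff_dvd dvdE)
      then have q0: "q \<noteq> 0" using less.prems by auto
      \<comment> \<open>With \<open>p = (X - a) q\<close> this expresses \<open>E p\<close> as
        \<open>(f - a) (E q)\<close>.\<close>
      have "p = smult (- a) q + pCons 0 q" unfolding q by simp
      then have "E p = f (E q) - sc a (E q)" by (simp only: EA EM EC scale_minus_left scale_zero_left) simp
      then have *: "f (E q) = sc a (E q)" using less.prems by simp
      show ?thesis
      proof (cases "E q = 0")
        case True
        have "degree p = degree [:- a, 1:] + degree q" unfolding q using q0 by (intro degree_mult_eq) auto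
        then show ?thesis using less.hyps[of q] q0 True by simp
      qed (use * EW in blast)
    qed
  qed
  define v where "v i = (f ^^ i) x" for i
  have vW: "v i \<in> W" for i by (induction i) (use assms(6,7) in \<open>auto simp: v_def\<close>)
  let ?N = "{..card A}"
  show ?thesis
  proof (cases "inj_on v ?N")
    case False
    then obtain i j where ij: "i \<noteq> j" "v i = v j" by (auto simp: inj_on_def)
    \<comment> \<open>A repetition \<open>v i = v j\<close> is the relation given by the polynomial
      \<open>X^i - X^j\<close>.\<close>
    let ?p = "monom 1 i + monom (- 1) j :: complex poly"
    have "coeff ?p i = 1" using ij by simp
    then have "?p \<noteq> 0" by (metis coeff_0 zero_neq_one)
    moreover have "E ?p = 0" using ij by (simp add: EA Emon v_def)
    ultimately show ?thesis by (rule fact)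
  next
    case True
    have "\<not> independent (v ` ?N)"
    proof
      assume "independent (v ` ?N)"
      then have "card (v ` ?N) \<le> card A"
        using independent_span_bound[OF assms(3)] vW assms(5) by blast
      then show False using True by (simp add: card_image)
    qed
    then obtain u y where u: "(\<Sum>y\<in>v ` ?N. sc (u y) y) = 0" "y \<in> v ` ?N" "u y \<noteq> 0"
      using independent_if_scalars_zero[of "v ` ?N"] by auto
    let ?p = "\<Sum>i\<in>?N. monom (u (v i)) i"
    obtain k where k: "k \<in> ?N" "y = v k" using u(2) by blast
    have "coeff ?p k = u y" using k by (simp add: coeff_sum)
    then have "?p \<noteq> 0" using u(3) by auto
    moreover have "E ?p = 0" using u(1) True by (simp add: Esum Emon sum.reindex flip: v_def)
    ultimately show ?thesis by (rule fact)
  qed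
qed

text \<open>If some operator of the family is not scalar at a chosen vector, one of its eigenspaces
  in \<open>W\<close> is a proper nonzero subspace, stable under all operators that commute with it;
  the dimension drops.\<close>

lemma common_eigenvector_exists:
  fixes sc :: "complex \<Rightarrow> 'v::ab_group_add \<Rightarrow> 'v"
  assumes "finite_dimensional_vector_space sc Bas" "\<And>f. f \<in> F \<Longrightarrow> Vector_Spaces.linear sc sc f"
    "\<And>f g x. f \<in> F \<Longrightarrow> g \<in> F \<Longrightarrow> f (g x) = g (f x)"
    "Modules.module.subspace sc W" "\<And>f x. f \<in> F \<Longrightarrow> x \<in> W \<Longrightarrow> f x \<in> W" "W \<noteq> {0}"
  shows "\<exists>y\<in>W. y \<noteq> 0 \<and> (\<forall>f\<in>F. \<exists>a. f y = sc a y)"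
proof -
  interpret finite_dimensional_vector_space sc Bas by fact
  show ?thesis using assms(4,5,6)
  proof (induction "dim W" arbitrary: W rule: less_induct)
    case less
    obtain x where x: "x \<in> W" "x \<noteq> 0" using less.prems subspace_0 by blast
    show ?case
    proof (cases "\<forall>f\<in>F. \<exists>a. f x = sc a x")
      case True then show ?thesis using x by blast
    next
      case False
      then obtain f where f: "f \<in> F" "\<And>a. f x \<noteq> sc a x" by blast
      note lf = assms(2)[OF f(1)]
      have "W \<subseteq> span Bas" by (simp add: span_Basis)
      then obtain a y where y: "y \<in> W" "y \<noteq> 0" "f y = sc a y"
        using complex_eigenvector_exists[OF vector_space_axioms lf finite_Basis less.prems(1)] less.prems(2)[OF f(1)] x
        by blast
      let ?W = "{w \<in> W. f w = sc a w}"
      have sub: "subspace ?W"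
        using less.prems(1) by (auto simp: subspace_def linear_apply[OF lf] scale_right_distrib scale_left_commute)
      have "?W \<subset> W" using f(2)[of a] x by auto
      then have "dim ?W < dim W" using sub less.prems(1) by (metis dim_psubset span_eq_iff)
      moreover have "g w \<in> ?W" if "g \<in> F" "w \<in> ?W" for g w
        using that less.prems(2) assms(3)[OF f(1) that(1), of w] linear_apply(2)[OF assms(2)[OF that(1)]] by auto
      moreover have "?W \<noteq> {0}" using y by blast
      ultimately show ?thesis using less.hyps[of ?W] sub by blast
    qed
  qed
qed

text \<open>Gram-Schmidt by induction on the spanning set: the new vector \<open>b\<close> is
  replaced by its part \<open>b'\<close> orthogonal to the old span, which is found from the
  induction hypothesis for the functional \<open>s b\<close>.\<close>

lemma positive_definite_riesz:
  fixes s :: "'v::real_vector \<Rightarrow> 'v \<Rightarrow> real"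
  assumes "finite A" "\<And>x y z. s (x + y) z = s x z + s y z" "\<And>c x y. s (c *\<^sub>R x) y = c * s x y"
    "\<And>x y. s x y = s y x" "\<And>x. x \<in> span A \<Longrightarrow> x \<noteq> 0 \<Longrightarrow> s x x > 0"
    "\<And>x y. x \<in> span A \<Longrightarrow> y \<in> span A \<Longrightarrow> f (x + y) = f x + f y"
    "\<And>c x. x \<in> span A \<Longrightarrow> f (c *\<^sub>R x) = c * f x"
  shows "\<exists>y\<in>span A. \<forall>u\<in>span A. s y u = f u"
  using assms(1,5,6,7)
proof (induction A arbitrary: f rule: finite_induct)
  case empty
  have "f 0 = 0" using empty.prems(3)[of 0 0] by simp
  moreover have "s 0 0 = 0" using assms(3)[of 0 0 0] by simp
  ultimately show ?case by simp
next
  case (insert b A)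
  have sub: "span A \<subseteq> span (insert b A)" by (intro span_mono) auto
  have addr: "s x (y + z) = s x y + s x z" for x y z using assms(2,4) by metis
  have scr: "s x (c *\<^sub>R y) = c * s x y" for x y c using assms(3,4) by metis
  have neg: "s (x - y) z = s x z - s y z" for x y z
    using assms(2)[of x "(-1) *\<^sub>R y" z] by (simp only: assms(3)) simp
  have "\<exists>y\<in>span A. \<forall>u\<in>span A. s y u = s b u"
    by (rule insert.IH) (use insert.prems(1) sub addr scr in auto)
  then obtain p where p: "p \<in> span A" "\<And>u. u \<in> span A \<Longrightarrow> s p u = s b u" by blast
  have "\<exists>y\<in>span A. \<forall>u\<in>span A. s y u = f u"
    by (rule insert.IH) (use insert.prems sub in blast)+
  then obtain y where y: "y \<in> span A" "\<And>u. u \<in> span A \<Longrightarrow> s y u = f u" by blast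
  define b' where "b' = b - p"
  have b': "b' \<in> span (insert b A)" "\<And>u. u \<in> span A \<Longrightarrow> s b' u = 0"
    using p sub by (auto simp: b'_def neg intro!: span_diff intro: span_base)
  \<comment> \<open>If \<open>b' = 0\<close>, division by zero gives the coefficient 0, and
    \<open>f b' = 0\<close> as well, so the formula covers a vector \<open>b\<close> that already
    lies in the old span.\<close>
  define z where "z = y + (f b' / s b' b') *\<^sub>R b'"
  have zs: "s z (u + k *\<^sub>R b') = f (u + k *\<^sub>R b')" if "u \<in> span A" for u k
  proof -
    have "f (u + k *\<^sub>R b') = f u + k * f b'"
      using insert.prems(2,3) that sub b'(1) by (metis span_scale subsetD)
    moreover have "f b' / s b' b' * s b' b' = f b'"
    proof (cases "b' = 0")
      case True then show ?thesis using insert.prems(3)[of 0 0] by (simp add: span_zero)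
    qed (use insert.prems(1)[of b'] b' in simp)
    ultimately show ?thesis
      using b'(2)[OF that] b'(2)[OF y(1)] assms(4)[of y b'] y(2)[OF that]
      by (simp add: z_def assms(2,3) addr scr)
  qed
  have "s z u = f u" if u: "u \<in> span (insert b A)" for u
  proof -
    obtain k where "u - k *\<^sub>R b \<in> span A" using u span_breakdown_eq by blast
    then have "(u - k *\<^sub>R b + k *\<^sub>R p) \<in> span A" using p(1) by (intro span_add span_scale)
    from zs[OF this, of k] show ?thesis by (simp add: b'_def algebra_simps)
  qed
  moreover have "z \<in> span (insert b A)" unfolding z_def using y(1) sub b'(1) by (intro span_add span_scale) auto
  ultimately show ?case by blast
qed

section \<open>Traces of endomorphisms\<close>

context vector_space
begin

lemma rep_sum:
  assumes "independent B" "span B = UNIV" "finite B"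
  shows "(\<Sum>b\<in>B. scale (representation B x b) b) = x"
  using assms by (intro sum_representation_eq) auto

lemma rep_linear:
  assumes "independent B" "span B = UNIV"
  shows "representation B (x + y) b = representation B x b + representation B y b"
    "representation B (scale c x) b = c * representation B x b"
    "representation B (sum g I) b = (\<Sum>i\<in>I. representation B (g i) b)"
  using assms by (simp_all add: representation_add representation_scale representation_sum)

lemma trace_basis_change:
  assumes B: "independent B" "span B = UNIV" "finite B" and C: "independent C" "span C = UNIV" "finite C"
    and f: "Vector_Spaces.linear scale scale f"
  shows "(\<Sum>b\<in>B. representation B (f b) b) = (\<Sum>c\<in>C. representation C (f c) c)"
proof -
  have "(\<Sum>b\<in>B. representation B (f b) b)
      = (\<Sum>b\<in>B. representation B (\<Sum>c\<in>C. scale (representation C (f b) c) c) b)"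
    by (simp add: rep_sum[OF C])
  also have "\<dots> = (\<Sum>b\<in>B. \<Sum>c\<in>C. representation C (f b) c * representation B c b)"
    by (simp add: rep_linear[OF B(1,2)])
  also have "\<dots> = (\<Sum>c\<in>C. \<Sum>b\<in>B. representation C (f (scale (representation B c b) b)) c)"
    by (subst sum.swap) (simp add: linear_apply[OF f] rep_linear[OF C(1,2)] mult.commute)
  also have "\<dots> = (\<Sum>c\<in>C. representation C (f (\<Sum>b\<in>B. scale (representation B c b) b)) c)"
    by (simp add: linear_apply[OF f] rep_linear[OF C(1,2)])
  finally show ?thesis by (simp add: rep_sum[OF B])
qed

text \<open>\<open>lin_trace\<close> takes some basis by choice; independence of the basis turns it
  into the sum over any given finite basis.\<close>

lemma lin_trace_eq:
  assumes B: "independent B" "span B = UNIV" "finite B" and f: "Vector_Spaces.linear scale scale f"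
  shows "lin_trace scale f = (\<Sum>b\<in>B. representation B (f b) b)"
proof -
  define C where "C = (SOME C. independent C \<and> span C = UNIV)"
  have C: "independent C" "span C = UNIV"
    using someI[of "\<lambda>C. independent C \<and> span C = UNIV" B] B by (auto simp: C_def)
  moreover have "finite C" using independent_span_bound[OF B(3) C(1)] B(2) by auto
  ultimately have "(\<Sum>b\<in>C. representation C (f b) b) = (\<Sum>b\<in>B. representation B (f b) b)"
    using B f by (intro trace_basis_change)
  then show ?thesis by (simp add: lin_trace_def Let_def flip: C_def)
qed

lemma lin_trace_commute:
  assumes B: "independent B" "span B = UNIV" "finite B"
    and f: "Vector_Spaces.linear scale scale f" and g: "Vector_Spaces.linear scale scale g"
  shows "lin_trace scale (\<lambda>x. f (g x)) = lin_trace scale (\<lambda>x. g (f x))"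
proof -
  have *: "lin_trace scale (\<lambda>x. f (g x)) = (\<Sum>b\<in>B. \<Sum>c\<in>B. representation B (g b) c * representation B (f c) b)"
    if f: "Vector_Spaces.linear scale scale f" and g: "Vector_Spaces.linear scale scale g" for f g
  proof -
    have "lin_trace scale (\<lambda>x. f (g x)) = (\<Sum>b\<in>B. representation B (f (g b)) b)"
      by (intro lin_trace_eq B linear_endoI) (simp_all add: linear_apply[OF f] linear_apply[OF g])
    also have "\<dots> = (\<Sum>b\<in>B. representation B (f (\<Sum>c\<in>B. scale (representation B (g b) c) c)) b)"
      by (simp add: rep_sum[OF B])
    finally show ?thesis by (simp add: linear_apply[OF f] rep_linear[OF B(1,2)])
  qed
  show ?thesis
    unfolding *[OF f g] *[OF g f] by (subst sum.swap) (simp add: mult.commute)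
qed

lemma lin_trace_linear:
  assumes B: "independent B" "span B = UNIV" "finite B"
    and f: "Vector_Spaces.linear scale scale f" and g: "Vector_Spaces.linear scale scale g"
  shows "lin_trace scale (\<lambda>x. f x + g x) = lin_trace scale f + lin_trace scale g"
    and "lin_trace scale (\<lambda>x. scale c (f x)) = c * lin_trace scale f"
proof -
  have "lin_trace scale (\<lambda>x. f x + g x) = (\<Sum>b\<in>B. representation B (f b + g b) b)"
    by (intro lin_trace_eq B linear_endoI)
      (simp_all add: linear_apply[OF f] linear_apply[OF g] algebra_simps)
  then show "lin_trace scale (\<lambda>x. f x + g x) = lin_trace scale f + lin_trace scale g"
    by (simp add: lin_trace_eq[OF B f] lin_trace_eq[OF B g] rep_linear[OF B(1,2)] sum.distrib)
  have "lin_trace scale (\<lambda>x. scale c (f x)) = (\<Sum>b\<in>B. representation B (scale c (f b)) b)"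
    by (intro lin_trace_eq B linear_endoI) (simp_all add: linear_apply[OF f] algebra_simps)
  then show "lin_trace scale (\<lambda>x. scale c (f x)) = c * lin_trace scale f"
    by (simp add: lin_trace_eq[OF B f] rep_linear[OF B(1,2)] sum_distrib_left)
qed

end

section \<open>Representations generated by a lowest graded piece\<close>

context lie_algebra
begin

lemma br_simps:
  "br (x + y) z = br x z + br y z" "br x (y + z) = br x y + br x z"
  "br (sc c x) y = sc c (br x y)" "br x (sc c y) = sc c (br x y)"
  "br 0 y = 0" "br x 0 = 0" "br (x - y) z = br x z - br y z" "br x (y - z) = br x y - br x z"
  "br (- x) y = - br x y" "br x (- y) = - br x y"
  "br (sum g A) y = (\<Sum>a\<in>A. br (g a) y)" "br x (sum g A) = (\<Sum>a\<in>A. br x (g a))"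
  by (rule linear_apply[OF linear_left] linear_apply[OF linear_right])+

lemma br_skew: "br x y = - br y x"
proof -
  have "br (x + y) (x + y) = br x y + br y x"
    by (simp only: br_simps(1,2)) (simp add: alternating add.commute)
  then show ?thesis by (simp add: alternating eq_neg_iff_add_eq_0)
qed

lemma br_derivation: "br x (br y z) = br (br x y) z + br y (br x z)"
proof -
  have "br y (br z x) = - br y (br x z)" by (metis br_skew br_simps(10))
  moreover have "br z (br x y) = - br (br x y) z" by (rule br_skew)
  ultimately show ?thesis using jacobi[of x y z] by (simp add: algebra_simps add_eq_0_iff)
qed

end

text \<open>The root decomposition as it enters the representation theory: a basis \<open>BB\<close>
  of weight vectors for \<open>T\<close> with its dual basis \<open>dl\<close> for an invariant
  form, an element \<open>Z\<close> defining the three-step grading and an element \<open>X\<close>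
  deciding positivity. The axioms \<open>positive\<close> say that the grades 1 and -1 lie on the
  two sides of \<open>X\<close> and that a weight invisible to \<open>X\<close> is zero on
  \<open>T\<close>.\<close>

locale weight_basis = lie_algebra sc br
  for sc :: "complex \<Rightarrow> 'l::ab_group_add \<Rightarrow> 'l" and br +
  fixes B :: "'l \<Rightarrow> 'l \<Rightarrow> complex" and T BB :: "'l set" and dl :: "'l \<Rightarrow> 'l"
    and wt :: "'l \<Rightarrow> 'l \<Rightarrow> complex" and Z X :: 'l
  assumes finite_BB: "finite BB"
    and form_add: "B x (y + z) = B x y + B x z"
    and form_scale: "B x (sc c y) = c * B x y"
    and form_sym: "B x y = B y x"
    and form_inv: "B (br x y) z = B x (br y z)"
    and expand: "(\<Sum>b\<in>BB. sc (B (dl b) x) b) = x"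
    and dual: "b \<in> BB \<Longrightarrow> b' \<in> BB \<Longrightarrow> B (dl b) b' = (if b = b' then 1 else 0)"
    and wt: "H \<in> T \<Longrightarrow> b \<in> BB \<Longrightarrow> br H b = sc (wt b H) b"
    and in_T: "Z \<in> T" "X \<in> T"
    and T_maximal: "(\<And>H. H \<in> T \<Longrightarrow> br H x = 0) \<Longrightarrow> x \<in> T"
    and T_abelian: "H \<in> T \<Longrightarrow> H' \<in> T \<Longrightarrow> br H H' = 0"
    and grading: "b \<in> BB \<Longrightarrow> wt b Z \<in> {-1, 0, 1}"
    and positive: "b \<in> BB \<Longrightarrow> wt b Z = 1 \<Longrightarrow> Re (wt b X) > 0"
      "b \<in> BB \<Longrightarrow> wt b Z = - 1 \<Longrightarrow> Re (wt b X) < 0"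
      "b \<in> BB \<Longrightarrow> Re (wt b X) = 0 \<Longrightarrow> H \<in> T \<Longrightarrow> wt b H = 0"
begin

definition grade :: "complex \<Rightarrow> 'l set"
  where "grade i = {x. br Z x = sc i x}"

lemma form_simps:
  "B x (y + z) = B x y + B x z" "B x (sc c y) = c * B x y" "B (x + y) z = B x z + B y z"
  "B (sc c x) y = c * B x y" "B x 0 = 0" "B 0 x = 0" "B (- x) y = - B x y" "B x (- y) = - B x y"
  "B (sum h J) y = (\<Sum>i\<in>J. B (h i) y)" "B x (sum g I) = (\<Sum>i\<in>I. B x (g i))"
proof -
  have L: "Vector_Spaces.linear sc (*) (B x)" for x
    by unfold_locales (simp_all add: form_add form_scale algebra_simps)
  interpret l: Vector_Spaces.linear sc "(*)" "B x" for x by (rule L)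
  show r: "B x (y + z) = B x y + B x z" "B x (sc c y) = c * B x y" "B x 0 = 0" "B x (- y) = - B x y"
    "B x (sum g I) = (\<Sum>i\<in>I. B x (g i))" for x y z c g and I :: "'i set"
    by (rule l.add l.scale l.zero l.neg l.sum)+
  show "B (x + y) z = B x z + B y z" by (simp only: form_sym[of "x + y" z] form_sym[of x z] form_sym[of y z] r)
  show "B (sc c x) y = c * B x y" by (simp only: form_sym[of "sc c x" y] form_sym[of x y] r)
  show "B 0 x = 0" by (simp only: form_sym[of 0 x] r)
  show "B (- x) y = - B x y" by (simp only: form_sym[of "- x" y] form_sym[of x y] r)
  show "B (sum h J) y = (\<Sum>i\<in>J. B (h i) y)"
    unfolding form_sym[of "sum h J" y] r by (rule sum.cong[OF refl form_sym])
qed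

lemma form_nondegenerate: "(\<And>y. B y x = 0) \<Longrightarrow> x = 0"
  using expand[of x] by simp

lemma form_eqI: "(\<And>b. b \<in> BB \<Longrightarrow> B x b = B y b) \<Longrightarrow> x = y"
proof -
  assume *: "\<And>b. b \<in> BB \<Longrightarrow> B x b = B y b"
  have "B z (x + - y) = 0" for z
  proof -
    have "B z (x + - y) = B (x + - y) (\<Sum>b\<in>BB. sc (B (dl b) z) b)" by (metis expand form_sym)
    also have "\<dots> = (\<Sum>b\<in>BB. B (dl b) z * (B x b - B y b))"
      by (simp only: form_simps) (simp add: form_simps)
    finally show ?thesis using * by simp
  qed
  from form_nondegenerate[OF this] show "x = y" by simp
qed

lemma expand_dl: "(\<Sum>b\<in>BB. sc (B b x) (dl b)) = x"
  by (rule form_eqI) (simp add: form_simps dual form_sym[of x] finite_BB if_distrib cong: if_cong)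

lemma form_ad: "B (br x y) z = - B y (br x z)"
  by (metis form_inv br_skew form_simps(7) form_sym)

lemma wt_dl: "H \<in> T \<Longrightarrow> b \<in> BB \<Longrightarrow> br H (dl b) = sc (- wt b H) (dl b)"
  by (rule form_eqI) (simp add: form_ad wt form_simps dual)

text \<open>The weights of \<open>b\<close> and \<open>dl b\<close> are opposite, so
  \<open>T\<close> centralizes the bracket, and \<open>T\<close> is its own centralizer. For a root
  vector \<open>b\<close> this element is a multiple of the coroot.\<close>

lemma br_dl_in_T: "b \<in> BB \<Longrightarrow> br b (dl b) \<in> T"
  by (rule T_maximal) (simp add: br_derivation[of _ b] wt wt_dl br_simps)

lemma weight_zero_in_T: "b \<in> BB \<Longrightarrow> Re (wt b X) = 0 \<Longrightarrow> b \<in> T \<and> dl b \<in> T"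
  using positive(3) by (intro conjI T_maximal) (simp_all add: wt wt_dl)

text \<open>Moving \<open>H\<close> across the form computes \<open>B (dl b) (br H y)\<close> in two
  ways. Hence a weight vector has coefficients only at basis vectors of its own weight.\<close>

lemma coeff_weight:
  assumes "H \<in> T" "b \<in> BB" "br H y = sc c y" "B (dl b) y \<noteq> 0"
  shows "wt b H = c"
proof -
  have "c * B (dl b) y = B (dl b) (br H y)" by (simp add: assms(3) form_simps)
  also have "\<dots> = - B (br H (dl b)) y" by (simp add: form_ad)
  also have "\<dots> = wt b H * B (dl b) y" using assms by (simp add: wt_dl form_simps)
  finally show ?thesis using assms(4) by simp
qed

lemma br_grade: "x \<in> grade i \<Longrightarrow> y \<in> grade j \<Longrightarrow> br x y \<in> grade (i + j)"
  by (simp add: grade_def br_derivation[of Z] br_simps scale_left_distrib)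

lemma T_grade: "H \<in> T \<Longrightarrow> H \<in> grade 0"
  using T_abelian in_T by (simp add: grade_def)

lemma BB_grade: "b \<in> BB \<Longrightarrow> wt b Z = i \<Longrightarrow> b \<in> grade i" "b \<in> BB \<Longrightarrow> wt b Z = - i \<Longrightarrow> dl b \<in> grade i"
  using wt wt_dl in_T by (auto simp: grade_def)

lemma expand_grade:
  assumes "x \<in> grade i"
  shows "x = (\<Sum>b\<in>{b\<in>BB. wt b Z = i}. sc (B (dl b) x) b)"
proof -
  have "(\<Sum>b\<in>{b\<in>BB. wt b Z = i}. sc (B (dl b) x) b) = (\<Sum>b\<in>BB. sc (B (dl b) x) b)"
    using coeff_weight[OF in_T(1)] assms finite_BB
    by (intro sum.mono_neutral_left) (auto simp: grade_def)
  then show ?thesis by (simp add: expand)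
qed

end

text \<open>The map \<open>j\<close> sends \<open>f\<close> to what is \<open>1 \<otimes> f\<close>
  in \<open>N(\<lambda>)\<close>. The last clause of \<open>v0\<close> speaks of arbitrary joint
  eigenvectors of \<open>T\<close>, so that it applies to basis vectors and dual basis vectors
  alike.\<close>

locale weight_module = weight_basis sc br B T BB dl wt Z X + V: vector_space sV + F: vector_space sF
  for sc :: "complex \<Rightarrow> 'l::ab_group_add \<Rightarrow> 'l" and br B T BB dl wt Z X
    and sV :: "complex \<Rightarrow> 'v::ab_group_add \<Rightarrow> 'v" and sF :: "complex \<Rightarrow> 'f::ab_group_add \<Rightarrow> 'f" +
  fixes \<rho> :: "'l \<Rightarrow> 'v \<Rightarrow> 'v" and act :: "'l \<Rightarrow> 'f \<Rightarrow> 'f" and j :: "'f \<Rightarrow> 'v"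
    and v0 :: 'f and lam :: "'l \<Rightarrow> complex" and AF :: "'f set"
  assumes rho_linear: "Vector_Spaces.linear sV sV (\<rho> x)"
    and rho_add: "\<rho> (x + y) v = \<rho> x v + \<rho> y v"
    and rho_scale: "\<rho> (sc c x) v = sV c (\<rho> x v)"
    and rho_br: "\<rho> (br x y) v = \<rho> x (\<rho> y v) - \<rho> y (\<rho> x v)"
    and j_add: "j (f + g) = j f + j g"
    and j_scale: "j (sF c f) = sV c (j f)"
    and j_act: "x \<in> grade 0 \<Longrightarrow> \<rho> x (j f) = j (act x f)"
    and j_plus: "x \<in> grade 1 \<Longrightarrow> \<rho> x (j f) = 0"
    and F_finite: "finite AF" "F.span AF = UNIV"
    and F_irreducible: "F.subspace W \<Longrightarrow> (\<And>x w. x \<in> grade 0 \<Longrightarrow> w \<in> W \<Longrightarrow> act x w \<in> W) \<Longrightarrow>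
       W \<noteq> {0} \<Longrightarrow> W = UNIV"
    and v0: "v0 \<noteq> 0" "H \<in> T \<Longrightarrow> act H v0 = sF (lam H) v0"
      "(\<And>H. H \<in> T \<Longrightarrow> br H e = sc (\<gamma> H) e) \<Longrightarrow> \<gamma> Z = 0 \<Longrightarrow> Re (\<gamma> X) > 0 \<Longrightarrow> act e v0 = 0"
begin

lemma rho_simps:
  "\<rho> x (v + w) = \<rho> x v + \<rho> x w" "\<rho> x (sV c v) = sV c (\<rho> x v)" "\<rho> x 0 = 0"
  "\<rho> x (v - w) = \<rho> x v - \<rho> x w" "\<rho> x (- v) = - \<rho> x v" "\<rho> x (sum g I) = (\<Sum>i\<in>I. \<rho> x (g i))"
  by (rule V.linear_apply[OF rho_linear])+

lemma rho_simps':
  "\<rho> (x + y) v = \<rho> x v + \<rho> y v" "\<rho> (sc c x) v = sV c (\<rho> x v)" "\<rho> 0 v = 0" "\<rho> (- x) v = - \<rho> x v"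
  "\<rho> (sum h I) v = (\<Sum>i\<in>I. \<rho> (h i) v)"
proof -
  have L: "Vector_Spaces.linear sc sV (\<lambda>x. \<rho> x v)"
    by unfold_locales (simp_all add: rho_add rho_scale)
  interpret l: Vector_Spaces.linear sc sV "\<lambda>x. \<rho> x v" by (rule L)
  show "\<rho> (x + y) v = \<rho> x v + \<rho> y v" "\<rho> (sc c x) v = sV c (\<rho> x v)" "\<rho> 0 v = 0" "\<rho> (- x) v = - \<rho> x v"
    "\<rho> (sum h I) v = (\<Sum>i\<in>I. \<rho> (h i) v)"
    by (rule l.add l.scale l.zero l.neg l.sum)+
qed

lemma rho_swap: "\<rho> x (\<rho> y v) = \<rho> y (\<rho> x v) + \<rho> (br x y) v"
  by (simp add: rho_br)

section \<open>The graded components of the generated module\<close>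

fun N :: "nat \<Rightarrow> 'v set" where
  "N 0 = range j"
| "N (Suc d) = V.span {\<rho> y w | y w. y \<in> grade (-1) \<and> w \<in> N d}"

lemma N_subspace: "V.subspace (N d)"
proof (cases d)
  case 0
  have "V.subspace (range j)"
  proof (rule V.subspaceI)
    have "j 0 = 0" using j_add[of 0 0] by simp
    then show "0 \<in> range j" by (metis rangeI)
  qed (auto simp flip: j_add j_scale)
  then show ?thesis using 0 by simp
qed simp

lemma N_SucI: "y \<in> grade (-1) \<Longrightarrow> w \<in> N d \<Longrightarrow> \<rho> y w \<in> N (Suc d)"
  by (auto intro: V.span_base)

lemma N_Suc_induct:
  assumes "w \<in> N (Suc d)" "V.subspace W" "\<And>y w. y \<in> grade (-1) \<Longrightarrow> w \<in> N d \<Longrightarrow> \<rho> y w \<in> W"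
  shows "w \<in> W"
proof -
  have "V.span {\<rho> y w | y w. y \<in> grade (-1) \<and> w \<in> N d} \<subseteq> W"
    by (rule V.span_minimal) (use assms in auto)
  then show ?thesis using assms(1) by auto
qed

lemma rho_vimage_subspace: "V.subspace W \<Longrightarrow> V.subspace {v. \<rho> x v \<in> W}"
  by (simp add: V.subspace_def rho_simps)

lemma grade0_N: "x \<in> grade 0 \<Longrightarrow> w \<in> N d \<Longrightarrow> \<rho> x w \<in> N d"
proof (induction d arbitrary: w)
  case 0
  then show ?case by (auto simp: j_act)
next
  case (Suc d)
  show ?case
  proof (rule N_Suc_induct[of w d "{v. \<rho> x v \<in> N (Suc d)}", simplified mem_Collect_eq])
    fix y u assume yu: "y \<in> grade (-1)" "u \<in> N d"
    have "br x y \<in> grade (-1)" using br_grade[OF Suc.prems(1) yu(1)] by simp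
    then have "\<rho> y (\<rho> x u) + \<rho> (br x y) u \<in> N (Suc d)"
      using yu Suc by (intro V.subspace_add N_subspace N_SucI) auto
    then show "\<rho> x (\<rho> y u) \<in> N (Suc d)" by (simp only: rho_swap[of x y])
  qed (use Suc.prems rho_vimage_subspace N_subspace in blast)+
qed

text \<open>Commuting \<open>x\<close> past a lowering element produces a bracket of grade 0, which
  preserves every \<open>N d\<close>; at the top \<open>x\<close> acts by zero.\<close>

lemma grade1_N:
  assumes "x \<in> grade 1"
  shows "w \<in> N 0 \<Longrightarrow> \<rho> x w = 0" "w \<in> N (Suc d) \<Longrightarrow> \<rho> x w \<in> N d"
proof -
  show base: "\<rho> x w = 0" if "w \<in> N 0" for w using that j_plus[OF assms] by auto
  show "w \<in> N (Suc d) \<Longrightarrow> \<rho> x w \<in> N d"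
  proof (induction d arbitrary: w)
    case (0 w)
    show ?case
    proof (rule N_Suc_induct[of w 0 "{v. \<rho> x v \<in> N 0}", simplified mem_Collect_eq])
      fix y u assume yu: "y \<in> grade (-1)" "u \<in> N 0"
      have "br x y \<in> grade 0" using br_grade[OF assms yu(1)] by simp
      then show "\<rho> x (\<rho> y u) \<in> N 0"
        using grade0_N[OF _ yu(2)] base[OF yu(2)] by (simp only: rho_swap[of x y]) (simp add: rho_simps)
    qed (use 0 rho_vimage_subspace N_subspace in blast)+
  next
    case (Suc d w)
    show ?case
    proof (rule N_Suc_induct[of w "Suc d" "{v. \<rho> x v \<in> N (Suc d)}", simplified mem_Collect_eq])
      fix y u assume yu: "y \<in> grade (-1)" "u \<in> N (Suc d)"
      have "br x y \<in> grade 0" using br_grade[OF assms yu(1)] by simp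
      then have "\<rho> y (\<rho> x u) + \<rho> (br x y) u \<in> N (Suc d)"
        by (intro V.subspace_add[OF N_subspace] N_SucI[OF yu(1) Suc.IH[OF yu(2)]] grade0_N[OF _ yu(2)])
      then show "\<rho> x (\<rho> y u) \<in> N (Suc d)" by (simp only: rho_swap[of x y])
    qed (use Suc.prems rho_vimage_subspace N_subspace in blast)+
  qed
qed

text \<open>The preimage under \<open>j\<close> is a nonzero subspace of \<open>F\<close> stable
  under grade 0, hence all of \<open>F\<close>. It extends statements about a single vector such as
  \<open>j v0\<close> to all of \<open>range j\<close>.\<close>

lemma j_vimage_UNIV:
  assumes "V.subspace U" "\<And>x u. x \<in> grade 0 \<Longrightarrow> u \<in> U \<Longrightarrow> \<rho> x u \<in> U" "j f \<in> U" "f \<noteq> 0"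
  shows "range j \<subseteq> U"
proof -
  have "{f. j f \<in> U} = UNIV"
  proof (rule F_irreducible)
    have "j 0 = 0" using j_add[of 0 0] by simp
    then show "F.subspace {f. j f \<in> U}"
      using assms(1) by (auto simp: F.subspace_def V.subspace_def j_add j_scale)
    show "act x w \<in> {f. j f \<in> U}" if "x \<in> grade 0" "w \<in> {f. j f \<in> U}" for x w
      using assms(2) that by (auto simp flip: j_act)
  qed (use assms in auto)
  then show ?thesis by auto
qed

text \<open>\<open>Z\<close> commutes with grade 0, so its eigenvalue at \<open>j v0\<close> is
  shared by all of \<open>N 0\<close>; each element of grade -1 lowers it by one.\<close>

lemma Z_N: "w \<in> N d \<Longrightarrow> \<rho> Z w = sV (lam Z - of_nat d) w"
proof (induction d arbitrary: w)
  case 0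
  let ?U = "{v. \<rho> Z v = sV (lam Z) v}"
  have "range j \<subseteq> ?U"
  proof (rule j_vimage_UNIV)
    show "V.subspace ?U"
      by (auto simp: V.subspace_def rho_simps V.scale_right_distrib V.scale_left_commute)
    show "\<rho> x u \<in> ?U" if "x \<in> grade 0" "u \<in> ?U" for x u
      using that by (simp add: rho_swap[of Z x] grade_def rho_simps rho_simps')
    show "j v0 \<in> ?U" using v0(2)[OF in_T(1)] T_grade[OF in_T(1)] by (simp add: j_act j_scale)
  qed (rule v0(1))
  then show ?case using 0 by auto
next
  case (Suc d)
  let ?U = "{v. \<rho> Z v = sV (lam Z - of_nat (Suc d)) v}"
  have "w \<in> ?U"
  proof (rule N_Suc_induct[OF Suc.prems])
    show "V.subspace ?U"
      by (auto simp: V.subspace_def rho_simps V.scale_right_distrib V.scale_left_commute)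
    fix y u assume yu: "y \<in> grade (-1)" "u \<in> N d"
    have "\<rho> Z (\<rho> y u) = \<rho> y (sV (lam Z - of_nat d) u) + \<rho> (sc (-1) y) u"
      using yu Suc.IH by (simp add: rho_swap[of Z y] grade_def)
    then show "\<rho> y u \<in> ?U" by (simp add: rho_simps rho_simps' algebra_simps)
  qed
  then show ?case by simp
qed

abbreviation "BBm \<equiv> {b \<in> BB. wt b Z = -1}"

lemma grade_minus_vimage:
  assumes "V.subspace U" "\<And>b. b \<in> BBm \<Longrightarrow> \<rho> b w \<in> U" "y \<in> grade (-1)"
  shows "\<rho> y w \<in> U"
proof -
  have "\<rho> (\<Sum>b\<in>BBm. sc (B (dl b) y) b) w \<in> U"
    unfolding rho_simps' using assms by (intro V.subspace_sum V.subspace_scale) auto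
  then show ?thesis using expand_grade[OF assms(3)] by simp
qed

lemma N_finite: "\<exists>A. finite A \<and> N d = V.span A"
proof (induction d)
  case 0
  have L: "Vector_Spaces.linear sF sV j" by unfold_locales (simp_all add: j_add j_scale)
  interpret l: Vector_Spaces.linear sF sV j by (rule L)
  have "range j = V.span (j ` AF)" using l.span_image[of AF] F_finite by simp
  then show ?case using F_finite(1) by auto
next
  case (Suc d)
  then obtain A where A: "finite A" "N d = V.span A" by blast
  let ?A = "(\<lambda>(b, a). \<rho> b a) ` (BBm \<times> A)"
  have "N (Suc d) = V.span ?A"
  proof
    show "V.span ?A \<subseteq> N (Suc d)"
      by (intro V.span_minimal N_subspace) (use A BB_grade(1) V.span_base in \<open>auto intro!: N_SucI simp del: N.simps\<close>)
    show "N (Suc d) \<subseteq> V.span ?A"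
    proof
      fix w assume "w \<in> N (Suc d)"
      then show "w \<in> V.span ?A"
      proof (rule N_Suc_induct)
        fix y u assume yu: "y \<in> grade (-1)" "u \<in> N d"
        show "\<rho> y u \<in> V.span ?A"
        proof (rule grade_minus_vimage[OF _ _ yu(1)])
          fix b assume b: "b \<in> BBm"
          have "V.span A \<subseteq> {v. \<rho> b v \<in> V.span ?A}"
            by (intro V.span_minimal rho_vimage_subspace V.subspace_span) (use b in \<open>force intro: V.span_base\<close>)
          then show "\<rho> b u \<in> V.span ?A" using yu A by auto
        qed simp
      qed simp
    qed
  qed
  then show ?case using A(1) finite_BB by (intro exI[of _ ?A]) auto
qed

section \<open>Words of lowering letters applied to the highest weight vector\<close>

definition wd :: "'l list \<Rightarrow> 'v"
  where "wd ys = foldr \<rho> ys (j v0)"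

definition nu :: "'l list \<Rightarrow> 'l \<Rightarrow> complex"
  where "nu ys H = lam H + (\<Sum>y\<leftarrow>ys. wt y H)"

lemma wd_simps: "wd [] = j v0" "wd (y # ys) = \<rho> y (wd ys)"
  by (simp_all add: wd_def)

lemma wd_weight: "H \<in> T \<Longrightarrow> set ys \<subseteq> BB \<Longrightarrow> \<rho> H (wd ys) = sV (nu ys H) (wd ys)"
proof (induction ys)
  case Nil
  then show ?case using v0(2) T_grade by (simp add: wd_simps j_act j_scale nu_def)
next
  case (Cons y ys)
  then show ?case
    by (simp add: wd_simps rho_swap[of H y] wt rho_simps rho_simps' nu_def algebra_simps)
qed

lemma wd_N: "set ys \<subseteq> BBm \<Longrightarrow> wd ys \<in> N (length ys)"
proof (induction ys)
  case (Cons y ys)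
  then show ?case using BB_grade(1) by (auto simp: wd_simps simp del: N.simps intro!: N_SucI)
qed (simp add: wd_simps)

text \<open>For the induction on \<open>d\<close>, \<open>U\<close> is replaced by the space of
  vectors that all of grade -1 sends into \<open>U\<close>; it is again stable under grade 0,
  because brackets of grade 0 with grade -1 stay in grade -1.\<close>

lemma N_generated:
  assumes "V.subspace U" "\<And>x u. x \<in> grade 0 \<Longrightarrow> u \<in> U \<Longrightarrow> \<rho> x u \<in> U"
    "\<And>ys. set ys \<subseteq> BBm \<Longrightarrow> length ys = d \<Longrightarrow> wd ys \<in> U"
  shows "N d \<subseteq> U"
  using assms
proof (induction d arbitrary: U)
  case 0
  have "j v0 \<in> U" using 0(3)[of "[]"] by (simp add: wd_simps)
  then show ?case using j_vimage_UNIV[OF 0(1,2)] v0(1) by simp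
next
  case (Suc d)
  let ?U = "{w. \<forall>y\<in>grade (-1). \<rho> y w \<in> U}"
  have "N d \<subseteq> ?U"
  proof (rule Suc.IH)
    show "V.subspace ?U" using Suc.prems(1) by (auto simp: V.subspace_def rho_simps)
    show "\<rho> x u \<in> ?U" if "x \<in> grade 0" "u \<in> ?U" for x u
    proof clarify
      fix y assume y: "y \<in> grade (-1)"
      have "br y x \<in> grade (-1)" using br_grade[OF y that(1)] by simp
      then have "\<rho> x (\<rho> y u) + \<rho> (br y x) u \<in> U"
        using that y Suc.prems(1,2) by (intro V.subspace_add) auto
      then show "\<rho> y (\<rho> x u) \<in> U" by (simp only: rho_swap[of y x])
    qed
    show "wd ys \<in> ?U" if "set ys \<subseteq> BBm" "length ys = d" for ys
    proof clarify
      fix y assume "y \<in> grade (-1)"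
      then show "\<rho> y (wd ys) \<in> U"
      proof (rule grade_minus_vimage[OF Suc.prems(1), rotated])
        fix b assume "b \<in> BBm"
        then show "\<rho> b (wd ys) \<in> U" using Suc.prems(3)[of "b # ys"] that by (simp add: wd_simps)
      qed
    qed
  qed
  then show ?case using N_Suc_induct[OF _ Suc.prems(1)] by blast
qed

text \<open>Push \<open>e\<close> to the right through the word. Each commutator with a letter is a
  combination of letters of grade -1 whose weight exceeds that of the old letter by \<gamma>, hence
  is larger at \<open>X\<close>, and at the right end \<open>e\<close> kills
  \<open>j v0\<close>.\<close>

lemma wd_raise:
  assumes "\<And>H. H \<in> T \<Longrightarrow> br H e = sc (\<gamma> H) e" "\<gamma> Z = 0" "Re (\<gamma> X) > 0" "set ys \<subseteq> BBm"
  shows "\<rho> e (wd ys) \<in>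
    V.span {wd zs | zs. set zs \<subseteq> BBm \<and> length zs = length ys \<and> Re (nu zs X) > Re (nu ys X)}"
  using assms(4)
proof (induction ys)
  case Nil
  have "e \<in> grade 0" using assms(1)[OF in_T(1)] assms(2) by (simp add: grade_def)
  moreover have "act e v0 = 0" by (rule v0(3)[OF assms(1,2,3)])
  moreover have "j 0 = 0" using j_add[of 0 0] by simp
  ultimately show ?case by (simp add: wd_simps j_act V.span_zero)
next
  case (Cons y ys)
  let ?S = "\<lambda>ys. {wd zs | zs. set zs \<subseteq> BBm \<and> length zs = length ys \<and> Re (nu zs X) > Re (nu ys X)}"
  have y: "y \<in> BB" "wt y Z = -1" using Cons.prems by auto
  have "V.span (?S ys) \<subseteq> {v. \<rho> y v \<in> V.span (?S (y # ys))}"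
  proof (intro V.span_minimal rho_vimage_subspace subsetI)
    fix w assume "w \<in> ?S ys"
    then obtain zs where zs: "w = wd zs" "set zs \<subseteq> BBm" "length zs = length ys" "Re (nu zs X) > Re (nu ys X)"
      by blast
    have "wd (y # zs) \<in> ?S (y # ys)"
      using zs y by (intro CollectI exI[of _ "y # zs"]) (auto simp: nu_def)
    then show "w \<in> {v. \<rho> y v \<in> V.span (?S (y # ys))}" by (simp add: zs(1) wd_simps V.span_base)
  qed simp
  then have 1: "\<rho> y (\<rho> e (wd ys)) \<in> V.span (?S (y # ys))" using Cons by auto
  have w: "br H (br e y) = sc (\<gamma> H + wt y H) (br e y)" if "H \<in> T" for H
    using assms(1)[OF that] wt[OF that y(1)] by (simp add: br_derivation[of H e y] br_simps scale_left_distrib)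
  have "\<rho> (\<Sum>b\<in>BB. sc (B (dl b) (br e y)) b) (wd ys) \<in> V.span (?S (y # ys))"
    unfolding rho_simps'
  proof (rule V.span_sum)
    fix b assume b: "b \<in> BB"
    show "sV (B (dl b) (br e y)) (\<rho> b (wd ys)) \<in> V.span (?S (y # ys))"
    proof (cases "B (dl b) (br e y) = 0")
      case False
      have "wt b Z = -1" "wt b X = \<gamma> X + wt y X"
        using coeff_weight[OF in_T(1) b w[OF in_T(1)] False] coeff_weight[OF in_T(2) b w[OF in_T(2)] False]
          assms(2) y(2) by simp_all
      then have "wd (b # ys) \<in> ?S (y # ys)"
        using b Cons.prems assms(3) by (intro CollectI exI[of _ "b # ys"]) (auto simp: nu_def)
      then show ?thesis by (intro V.span_scale V.span_base) (simp add: wd_simps)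
    qed (simp add: V.span_zero)
  qed
  then have "\<rho> (br e y) (wd ys) \<in> V.span (?S (y # ys))" by (simp add: expand)
  with 1 show ?case by (simp add: wd_simps rho_swap[of e y] V.span_add)
qed


section \<open>The Casimir operator and its graded parts\<close>

lemma dual_bases_commute:
  assumes "finite I" "\<And>i. i \<in> I \<Longrightarrow> br x (e i) = (\<Sum>k\<in>I. sc (a i k) (e k))"
    "\<And>i. i \<in> I \<Longrightarrow> br x (f i) = (\<Sum>k\<in>I. sc (- a k i) (f k))"
  shows "\<rho> x (\<Sum>i\<in>I. \<rho> (e i) (\<rho> (f i) v)) = (\<Sum>i\<in>I. \<rho> (e i) (\<rho> (f i) (\<rho> x v)))"
proof -
  have "\<rho> x (\<Sum>i\<in>I. \<rho> (e i) (\<rho> (f i) v)) - (\<Sum>i\<in>I. \<rho> (e i) (\<rho> (f i) (\<rho> x v)))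
      = (\<Sum>i\<in>I. \<rho> (br x (e i)) (\<rho> (f i) v) + \<rho> (e i) (\<rho> (br x (f i)) v))"
    by (simp add: rho_simps rho_br flip: sum_subtractf)
  also have "\<dots> = (\<Sum>i\<in>I. \<Sum>k\<in>I. sV (a i k) (\<rho> (e k) (\<rho> (f i) v)))
      + (\<Sum>i\<in>I. \<Sum>k\<in>I. sV (- a k i) (\<rho> (e i) (\<rho> (f k) v)))"
    by (simp add: assms rho_simps rho_simps' sum.distrib)
  also have "(\<Sum>i\<in>I. \<Sum>k\<in>I. sV (- a k i) (\<rho> (e i) (\<rho> (f k) v)))
      = (\<Sum>i\<in>I. \<Sum>k\<in>I. sV (- a i k) (\<rho> (e k) (\<rho> (f i) v)))"
    by (rule sum.swap)
  finally show ?thesis by (simp add: sum_negf)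
qed

text \<open>Invariance of the form makes the matrices of \<open>br x\<close> on \<open>BB\<close>
  and on the dual basis negative transposes of each other. The hypothesis says that
  \<open>br x\<close> does not mix \<open>I\<close> with the rest of \<open>BB\<close>, so the sum
  over \<open>I\<close> is invariant by itself. \<open>I = BB\<close> gives the Casimir operator;
  the graded parts are admissible for \<open>x\<close> of grade 0.\<close>

lemma partial_casimir_commute:
  assumes "I \<subseteq> BB" "\<And>b b'. b \<in> I \<Longrightarrow> b' \<in> BB - I \<Longrightarrow> B (dl b') (br x b) = 0 \<and> B (dl b) (br x b') = 0"
  shows "\<rho> x (\<Sum>b\<in>I. \<rho> b (\<rho> (dl b) v)) = (\<Sum>b\<in>I. \<rho> b (\<rho> (dl b) (\<rho> x v)))"
    and "\<rho> x (\<Sum>b\<in>I. \<rho> (dl b) (\<rho> b v)) = (\<Sum>b\<in>I. \<rho> (dl b) (\<rho> b (\<rho> x v)))"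
proof -
  have fin: "finite I" using assms(1) finite_BB finite_subset by blast
  have e: "br x b = (\<Sum>b'\<in>I. sc (B (dl b') (br x b)) b')" if "b \<in> I" for b
    using assms that finite_BB sum.mono_neutral_left[of BB I "\<lambda>b'. sc (B (dl b') (br x b)) b'"]
    by (simp add: expand)
  have swap: "B b' (br x (dl b)) = - B (dl b) (br x b')" for b b'
    by (metis form_ad form_sym)
  have f: "br x (dl b) = (\<Sum>b'\<in>I. sc (- B (dl b) (br x b')) (dl b'))" if "b \<in> I" for b
  proof -
    have "br x (dl b) = (\<Sum>b'\<in>BB. sc (B b' (br x (dl b))) (dl b'))" by (simp only: expand_dl)
    also have "\<dots> = (\<Sum>b'\<in>I. sc (B b' (br x (dl b))) (dl b'))"
      by (rule sum.mono_neutral_right[OF finite_BB assms(1)]) (use assms(2)[OF that] in \<open>simp add: swap\<close>)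
    finally show ?thesis by (simp only: swap)
  qed
  show "\<rho> x (\<Sum>b\<in>I. \<rho> b (\<rho> (dl b) v)) = (\<Sum>b\<in>I. \<rho> b (\<rho> (dl b) (\<rho> x v)))"
    by (rule dual_bases_commute[OF fin e f])
  show "\<rho> x (\<Sum>b\<in>I. \<rho> (dl b) (\<rho> b v)) = (\<Sum>b\<in>I. \<rho> (dl b) (\<rho> b (\<rho> x v)))"
    by (rule dual_bases_commute[where a = "\<lambda>b b'. - B (dl b) (br x b')", OF fin f]) (simp_all add: e[symmetric])
qed

abbreviation "BBg i \<equiv> {b \<in> BB. wt b Z = i}"

lemma grade0_closed:
  assumes "x \<in> grade 0" "b \<in> BBg i" "b' \<in> BB - BBg i"
  shows "B (dl b') (br x b) = 0 \<and> B (dl b) (br x b') = 0"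
proof -
  have "br x b \<in> grade i" "br x b' \<in> grade (wt b' Z)"
    using br_grade[OF assms(1) BB_grade(1)] assms(2,3) by auto
  then show ?thesis using coeff_weight[OF in_T(1)] assms by (fastforce simp: grade_def)
qed

definition Om :: "'v \<Rightarrow> 'v"
  where "Om v = (\<Sum>b\<in>BB. \<rho> b (\<rho> (dl b) v))"

text \<open>The terms of the Casimir sum ordered so that the right factor lies in grade 1
  (\<open>dl b\<close> has grade 1 when \<open>b\<close> has grade -1); they vanish on vectors
  killed by grade 1.\<close>

definition Om_plus :: "'v \<Rightarrow> 'v"
  where "Om_plus v = (\<Sum>b\<in>BBg 1. \<rho> (dl b) (\<rho> b v)) + (\<Sum>b\<in>BBg (-1). \<rho> b (\<rho> (dl b) v))"

text \<open>What this reordering leaves of \<open>Om\<close>, involving only elements of grade 0: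
  the operator \<open>C\<close> of the overview.\<close>

definition Om_zero :: "'v \<Rightarrow> 'v"
  where "Om_zero v = (\<Sum>b\<in>BBg 0. \<rho> b (\<rho> (dl b) v)) + (\<Sum>b\<in>BBg 1. \<rho> (br b (dl b)) v)"

lemma sum_graded: "(\<Sum>b\<in>BB. h b) = (\<Sum>b\<in>BBg 0. h b) + (\<Sum>b\<in>BBg 1. h b) + (\<Sum>b\<in>BBg (-1). h b)"
  for h :: "'l \<Rightarrow> 'x::comm_monoid_add"
proof -
  have "BB = (BBg 0 \<union> BBg 1) \<union> BBg (-1)" using grading by auto
  then have "(\<Sum>b\<in>BB. h b) = (\<Sum>b\<in>(BBg 0 \<union> BBg 1) \<union> BBg (-1). h b)" by simp
  also have "\<dots> = (\<Sum>b\<in>BBg 0. h b) + (\<Sum>b\<in>BBg 1. h b) + (\<Sum>b\<in>BBg (-1). h b)"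
    using finite_BB by (subst sum.union_disjoint; (subst sum.union_disjoint)?) auto
  finally show ?thesis .
qed

lemma Om_split: "Om v = Om_zero v + Om_plus v"
proof -
  have "(\<Sum>b\<in>BBg 1. \<rho> b (\<rho> (dl b) v))
      = (\<Sum>b\<in>BBg 1. \<rho> (dl b) (\<rho> b v)) + (\<Sum>b\<in>BBg 1. \<rho> (br b (dl b)) v)"
    by (simp add: rho_br flip: sum.distrib)
  then show ?thesis by (simp add: Om_def Om_zero_def Om_plus_def sum_graded)
qed

lemma Om_commute: "\<rho> x (Om v) = Om (\<rho> x v)"
  unfolding Om_def by (rule partial_casimir_commute) auto

lemma Om_zero_commute:
  assumes "x \<in> grade 0"
  shows "\<rho> x (Om_zero v) = Om_zero (\<rho> x v)"
proof -
  have "\<rho> x (Om_plus v) = Om_plus (\<rho> x v)"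
    unfolding Om_plus_def rho_simps(1)
    using partial_casimir_commute[of "BBg 1" x v] partial_casimir_commute[of "BBg (-1)" x v] grade0_closed[OF assms]
    by simp
  moreover have "Om_zero v = Om v - Om_plus v" for v by (simp add: Om_split)
  ultimately show ?thesis by (simp add: rho_simps Om_commute)
qed

lemma Om_zero_linear: "Vector_Spaces.linear sV sV Om_zero"
  by (rule V.linear_endoI)
    (simp_all add: Om_zero_def rho_simps sum.distrib V.scale_sum_right V.scale_right_distrib algebra_simps)

lemma Om_linear: "Vector_Spaces.linear sV sV Om"
  by (rule V.linear_endoI)
    (simp_all add: Om_def rho_simps sum.distrib V.scale_sum_right)

text \<open>The Casimir eigenvalue for the highest weight \<mu>. The first sum runs over the basis
  vectors in \<open>T\<close> and gives \<langle>\<mu>, \<mu>\<rangle>; the second is the pairing of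
  \<mu> with the sum of all positive roots, as \<open>br b (dl b)\<close> represents the weight of
  \<open>b\<close>.\<close>

definition cas :: "('l \<Rightarrow> complex) \<Rightarrow> complex"
  where "cas \<mu> = (\<Sum>b\<in>{b\<in>BB. Re (wt b X) = 0}. \<mu> b * \<mu> (dl b)) + (\<Sum>b\<in>{b\<in>BB. Re (wt b X) > 0}. \<mu> (br b (dl b)))"

text \<open>Every summand of grade 0 is evaluated modulo \<open>U\<close> with the raising factor
  applied first: for \<open>b\<close> of positive weight the factors are swapped at the cost of
  their bracket, for \<open>b\<close> of negative weight \<open>dl b\<close> already raises, and for
  weight zero both factors act by \<mu>.\<close>

lemma Om_zero_highest:
  assumes U: "V.subspace U" "\<And>x u. x \<in> grade 0 \<Longrightarrow> u \<in> U \<Longrightarrow> \<rho> x u \<in> U"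
    and w: "\<And>H. H \<in> T \<Longrightarrow> \<rho> H m = sV (\<mu> H) m"
    and h: "\<And>e \<gamma>. (\<And>H. H \<in> T \<Longrightarrow> br H e = sc (\<gamma> H) e) \<Longrightarrow> \<gamma> Z = 0 \<Longrightarrow> Re (\<gamma> X) > 0 \<Longrightarrow> \<rho> e m \<in> U"
  shows "Om_zero m - sV (cas \<mu>) m \<in> U"
proof -
  \<comment> \<open>\<open>I b\<close> is the scalar contributed by \<open>b\<close>. On grade 1 it
    is the bracket term of \<open>Om_zero\<close>, on grade -1 it is zero, so that the sum over all
    of \<open>BB\<close> is \<open>cas \<mu>\<close>.\<close>
  define I where "I b = (if Re (wt b X) = 0 then \<mu> b * \<mu> (dl b) else if Re (wt b X) > 0 then \<mu> (br b (dl b)) else 0)" for b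
  have 0: "\<rho> b (\<rho> (dl b) m) - sV (I b) m \<in> U" if b: "b \<in> BBg 0" for b
  proof -
    note bz = BB_grade(1)[of b 0] BB_grade(2)[of b 0]
    consider "Re (wt b X) = 0" | "Re (wt b X) > 0" | "Re (wt b X) < 0" by linarith
    then show ?thesis
    proof cases
      case 1
      then have "b \<in> T" "dl b \<in> T" using weight_zero_in_T b by auto
      then show ?thesis using 1 U(1) by (simp add: I_def w rho_simps V.subspace_0 mult.commute)
    next
      case 2
      have "\<rho> b m \<in> U" using 2 b wt by (intro h[of b "wt b"]) auto
      then have "\<rho> (dl b) (\<rho> b m) \<in> U" using U(2) bz b by auto
      moreover have "\<rho> b (\<rho> (dl b) m) - sV (I b) m = \<rho> (dl b) (\<rho> b m)"
        using 2 b by (simp add: I_def rho_swap[of b "dl b"] w br_dl_in_T)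
      ultimately show ?thesis by simp
    next
      case 3
      have "\<rho> (dl b) m \<in> U" using 3 b wt_dl by (intro h[of "dl b" "\<lambda>H. - wt b H"]) auto
      then show ?thesis using U(2) bz b 3 by (auto simp: I_def)
    qed
  qed
  have I1: "I b = \<mu> (br b (dl b))" if "b \<in> BBg 1" for b using that positive(1)[of b] by (auto simp: I_def)
  have Im: "I b = 0" if "b \<in> BBg (-1)" for b using that positive(2)[of b] by (auto simp: I_def)
  have "cas \<mu> = (\<Sum>b\<in>BB. I b)"
  proof -
    have "(\<Sum>b\<in>{b\<in>BB. Re (wt b X) = 0}. \<mu> b * \<mu> (dl b)) = (\<Sum>b\<in>BB. if Re (wt b X) = 0 then \<mu> b * \<mu> (dl b) else 0)"
      "(\<Sum>b\<in>{b\<in>BB. Re (wt b X) > 0}. \<mu> (br b (dl b))) = (\<Sum>b\<in>BB. if Re (wt b X) > 0 then \<mu> (br b (dl b)) else 0)"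
      using finite_BB by (simp_all add: sum.inter_filter)
    then show ?thesis unfolding cas_def by (simp add: I_def flip: sum.distrib) (rule sum.cong; simp)
  qed
  also have "\<dots> = (\<Sum>b\<in>BBg 0. I b) + (\<Sum>b\<in>BBg 1. \<mu> (br b (dl b)))" by (simp add: sum_graded I1 Im)
  finally have "Om_zero m - sV (cas \<mu>) m = (\<Sum>b\<in>BBg 0. \<rho> b (\<rho> (dl b) m) - sV (I b) m)"
    by (simp add: Om_zero_def w br_dl_in_T V.scale_left_distrib V.scale_sum_left sum_subtractf)
  moreover have "(\<Sum>b\<in>BBg 0. \<rho> b (\<rho> (dl b) m) - sV (I b) m) \<in> U"
    by (rule V.subspace_sum[OF U(1) 0])
  ultimately show ?thesis by simp
qed

text \<open>\<open>Om\<close> commutes with the whole action, so only its value at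
  \<open>j v0\<close> has to be known. There \<open>Om_plus\<close> vanishes and
  \<open>Om_zero_highest\<close> applies with \<open>U = {0}\<close>.\<close>

lemma Om_N: "w \<in> N d \<Longrightarrow> Om w = sV (cas lam) w"
proof (induction d arbitrary: w)
  case 0
  let ?U = "{v. Om v = sV (cas lam) v}"
  have "j v0 \<in> ?U"
  proof -
    have "Om_zero (j v0) - sV (cas lam) (j v0) \<in> {0}"
    proof (rule Om_zero_highest)
      show "\<rho> H (j v0) = sV (lam H) (j v0)" if "H \<in> T" for H
        using v0(2)[OF that] T_grade[OF that] by (simp add: j_act j_scale)
      have "j 0 = 0" using j_add[of 0 0] by simp
      then show "\<rho> e (j v0) \<in> {0}"
        if "\<And>H. H \<in> T \<Longrightarrow> br H e = sc (\<gamma> H) e" "\<gamma> Z = 0" "Re (\<gamma> X) > 0" for e \<gamma>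
        using v0(3)[OF that] that(1)[OF in_T(1)] that(2) by (simp add: j_act grade_def)
    qed (auto simp: rho_simps)
    moreover have "Om_plus (j v0) = 0"
      using BB_grade(1)[of _ 1] BB_grade(2)[of _ 1] j_plus by (simp add: Om_plus_def rho_simps)
    ultimately show ?thesis by (simp add: Om_split)
  qed
  moreover have "V.subspace ?U"
    by (auto simp: V.subspace_def V.linear_apply[OF Om_linear] V.scale_right_distrib V.scale_left_commute)
  moreover have "\<rho> x u \<in> ?U" if "u \<in> ?U" for x u using that by (simp add: rho_simps flip: Om_commute)
  ultimately have "range j \<subseteq> ?U" using j_vimage_UNIV[of ?U v0] v0(1) by blast
  then show ?case using 0 by auto
next
  case (Suc d)
  have "w \<in> {v. Om v = sV (cas lam) v}"
  proof (rule N_Suc_induct[OF Suc.prems])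
    show "V.subspace {v. Om v = sV (cas lam) v}"
      by (auto simp: V.subspace_def V.linear_apply[OF Om_linear] V.scale_right_distrib V.scale_left_commute)
  qed (use Suc.IH in \<open>simp add: rho_simps flip: Om_commute\<close>)
  then show ?case by simp
qed

text \<open>The rank one argument with \<open>b\<close>, \<open>dl b\<close> and their bracket
  \<open>h\<close>, carried out modulo \<open>U\<close>: the lowering string through
  \<open>m\<close> enters \<open>U\<close> at some first step, and applying \<open>b\<close> there
  forces the structure constant to vanish. The factor \<open>wt b h\<close> appears because
  \<open>b\<close> and \<open>dl b\<close> are normalized by the form and not as a standard
  triple.\<close>

lemma dominant_mod:
  assumes U: "V.subspace U" "\<And>x u. x \<in> grade 0 \<Longrightarrow> u \<in> U \<Longrightarrow> \<rho> x u \<in> U"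
    and m: "m \<in> N d" "m \<notin> U" "\<And>H. H \<in> T \<Longrightarrow> \<rho> H m = sV (\<mu> H) m" "\<rho> b m \<in> U"
    and b: "b \<in> BB" "wt b Z = 0" "Re (wt b X) > 0"
  shows "\<exists>n::nat. 2 * \<mu> (br b (dl b)) = of_nat n * wt b (br b (dl b))"
proof -
  define v where "v n = (\<rho> (dl b) ^^ n) m" for n
  define h where "h = br b (dl b)"
  have hT: "h \<in> T" using br_dl_in_T[OF b(1)] by (simp add: h_def)
  have vS: "v (Suc n) = \<rho> (dl b) (v n)" for n by (simp add: v_def)
  have g: "b \<in> grade 0" "dl b \<in> grade 0" using BB_grade b by auto
  have vw: "\<rho> H (v n) = sV (\<mu> H - of_nat n * wt b H) (v n)" if "H \<in> T" for H n
  proof (induction n)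
    case 0 then show ?case using m(3)[OF that] by (simp add: v_def)
  next
    case (Suc n)
    show ?case unfolding vS rho_swap[of H "dl b"] Suc
      by (simp add: wt_dl[OF that b(1)] rho_simps rho_simps' algebra_simps)
  qed
  obtain A where A: "finite A" "N d = V.span A" using N_finite by blast
  \<comment> \<open>The vectors \<open>v n\<close> have pairwise different eigenvalues for
    \<open>X\<close> inside the finitely spanned \<open>N d\<close>.\<close>
  have "\<exists>n. v n = 0"
  proof (rule V.eigenvector_sequence_vanishes[OF A(1) _ rho_linear vw[OF in_T(2)]])
    show "v n \<in> V.span A" for n
      by (induction n) (use m(1) g grade0_N[of "dl b" _ d] A(2) in \<open>auto simp: vS, auto simp: v_def\<close>)
    show "inj (\<lambda>n. \<mu> X - of_nat n * wt b X)" using b(3) by (auto simp: inj_def)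
  qed
  then have ex: "\<exists>n. v n \<in> U" using U(1) V.subspace_0 by metis
  define k where "k = (LEAST n. v n \<in> U)"
  have k: "v k \<in> U" using LeastI_ex[OF ex] by (simp add: k_def)
  have "k \<noteq> 0" using k m(2) by (auto simp: v_def intro: ccontr)
  then obtain n where n: "k = Suc n" by (cases k) auto
  have nU: "v n \<notin> U" using not_less_Least[of n "\<lambda>n. v n \<in> U"] n by (simp add: k_def)
  \<comment> \<open>\<open>c n\<close> is the constant in
    \<open>\<rho> b (v (Suc n)) = sV (c n) (v n)\<close> modulo \<open>U\<close>, the sum of the
    \<open>h\<close>-eigenvalues of \<open>v 0\<close> up to \<open>v n\<close>.\<close>
  define c where "c n = of_nat (n + 1) * \<mu> h - wt b h * of_nat n * of_nat (n + 1) / 2" for n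
  have ind: "\<rho> b (v (Suc n)) - sV (c n) (v n) \<in> U" for n
  proof (induction n)
    case 0
    have "\<rho> b (v (Suc 0)) - sV (c 0) (v 0) = \<rho> (dl b) (\<rho> b m)"
      using vw[OF hT, of 0] by (simp add: vS rho_swap[of b "dl b"] c_def v_def flip: h_def)
    then show ?case using U(2)[OF g(2) m(4)] by simp
  next
    case (Suc n)
    have "\<rho> b (v (Suc (Suc n))) = \<rho> (dl b) (\<rho> b (v (Suc n))) + \<rho> h (v (Suc n))"
      unfolding vS[of "Suc n"] rho_swap[of b "dl b"] h_def ..
    then have "\<rho> b (v (Suc (Suc n))) - sV (c n + (\<mu> h - of_nat (Suc n) * wt b h)) (v (Suc n))
        = \<rho> (dl b) (\<rho> b (v (Suc n)) - sV (c n) (v n))"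
      by (simp only: vw[OF hT] rho_simps V.scale_left_distrib) (simp add: vS)
    moreover have "c n + (\<mu> h - of_nat (Suc n) * wt b h) = c (Suc n)"
      by (simp add: c_def field_simps)
    ultimately show ?case using U(2)[OF g(2) Suc] by simp
  qed
  have "\<rho> b (v (Suc n)) - (\<rho> b (v (Suc n)) - sV (c n) (v n)) \<in> U"
    using U(2)[OF g(1) k[unfolded n]] by (rule V.subspace_diff[OF U(1) _ ind])
  then have "sV (c n) (v n) \<in> U" by simp
  then have "c n = 0"
    using nU V.subspace_scale[OF U(1), of "sV (c n) (v n)" "inverse (c n)"] by (cases "c n = 0") auto
  moreover have "c n = of_nat (n + 1) * (\<mu> h - wt b h * of_nat n / 2)" by (simp add: c_def field_simps)
  moreover have "of_nat (n + 1) \<noteq> (0::complex)" by (metis Suc_eq_plus1 of_nat_neq_0)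
  ultimately have "\<mu> h - wt b h * of_nat n / 2 = 0" by (metis mult_eq_0_iff)
  then have "2 * \<mu> h = of_nat n * wt b h" by (simp add: field_simps)
  then show ?thesis unfolding h_def by blast
qed

text \<open>The conclusion speaks of weights only, so that the contradiction can be derived inside
  the root system. Taking a word outside \<open>U\<close> with the largest weight at
  \<open>X\<close> produces a highest weight vector modulo \<open>U\<close>, from which both the
  Casimir condition and dominance are read off.\<close>

theorem singular_weight_exists:
  assumes S: "V.subspace S" "\<And>x u. u \<in> S \<Longrightarrow> \<rho> x u \<in> S"
    and w: "w \<in> S" "w \<in> V.span (\<Union>d. N d)" "w \<noteq> 0" and nS: "\<not> range j \<subseteq> S"
  shows "\<exists>ys. ys \<noteq> [] \<and> set ys \<subseteq> BBm \<and> cas (nu ys) = cas lam \<and>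
    (\<forall>b\<in>BB. wt b Z = 0 \<and> Re (wt b X) > 0 \<longrightarrow>
       (\<exists>n::nat. 2 * nu ys (br b (dl b)) = of_nat n * wt b (br b (dl b))))"
proof -
  \<comment> \<open>Members of the span are finite sums of components \<open>u d\<close>; these have
    distinct eigenvalues for \<open>Z\<close>, so the stable subspace \<open>S\<close> contains each
    of them.\<close>
  have "\<exists>u n. (\<forall>d. u d \<in> N d) \<and> w = (\<Sum>d<(n::nat). u d)"
    using w(2)
  proof (induction rule: V.span_induct_alt)
    case base
    show ?case by (rule exI[of _ "\<lambda>_. 0"], rule exI[of _ 0]) (auto intro: V.subspace_0 N_subspace simp del: N.simps)
  next
    case (step c x y)
    then obtain u n e where u: "\<forall>d. u d \<in> N d" "y = (\<Sum>d<(n::nat). u d)" and e: "x \<in> N e" by auto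
    define m where "m = n + Suc e"
    define u' where "u' d = (if d < n then u d else 0) + (if d = e then sV c x else 0)" for d
    have "sV c x + y = (\<Sum>d<m. u' d)"
    proof -
      have "(\<Sum>d<m. if d < n then u d else 0) = (\<Sum>d<n. u d)"
        by (rule sum.mono_neutral_cong_right) (auto simp: m_def)
      moreover have "(\<Sum>d<m. if d = e then sV c x else 0) = sV c x" by (simp add: m_def)
      ultimately show ?thesis by (simp add: u'_def sum.distrib u(2) add.commute)
    qed
    moreover have "u' d \<in> N d" for d
      unfolding u'_def using u(1) e N_subspace by (auto intro!: V.subspace_add V.subspace_scale simp: V.subspace_0 simp del: N.simps)
    ultimately show ?case by blast
  qed
  then obtain u n where u: "\<And>d. u d \<in> N d" "w = (\<Sum>d<(n::nat). u d)" by blast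
  have "\<forall>d\<in>{..<n}. u d \<in> S"
    by (rule V.eigencomponents_mem[where A = "\<rho> Z" and c = "\<lambda>d. lam Z - of_nat d"])
      (use S w u(2) Z_N[OF u(1)] rho_linear in \<open>auto simp: inj_on_def\<close>)
  moreover obtain d0 where "d0 < n" "u d0 \<noteq> 0" using u(2) w(3) by (metis lessThan_iff sum.neutral)
  ultimately have ex: "\<exists>d x. x \<in> S \<and> x \<in> N d \<and> x \<noteq> 0" using u(1) by blast
  \<comment> \<open>The least \<open>d\<close>, that is the component closest to the top: grade 1
    maps it into \<open>S\<close> one step higher, where only zero is left.\<close>
  define d where "d = (LEAST d. \<exists>x. x \<in> S \<and> x \<in> N d \<and> x \<noteq> 0)"
  obtain x where x: "x \<in> S" "x \<in> N d" "x \<noteq> 0" using LeastI_ex[OF ex] by (auto simp: d_def)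
  have least: "y = 0" if "y \<in> S" "y \<in> N e" "e < d" for y e
    using not_less_Least[OF that(3)[unfolded d_def]] that by blast
  have d0: "d \<noteq> 0"
  proof
    assume "d = 0"
    then obtain f where f: "x = j f" using x(2) by auto
    moreover have "f \<noteq> 0" using f x(3) j_add[of 0 0] by auto
    ultimately show False using j_vimage_UNIV[of S f] S x nS by blast
  qed
  then obtain d' where d': "d = Suc d'" by (cases d) auto
  let ?c = "cas lam"
  have kill: "\<rho> e x = 0" if "e \<in> grade 1" for e
    using least[of "\<rho> e x" d'] grade1_N(2)[OF that] S(2) x d' by simp
  have "Om_plus x = 0"
    using BB_grade(1)[of _ 1] BB_grade(2)[of _ 1] kill by (simp add: Om_plus_def rho_simps)
  then have cx: "Om_zero x = sV ?c x" using Om_N[OF x(2)] by (simp add: Om_split)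
  define D where "D v = Om_zero v - sV ?c v" for v
  have D: "Vector_Spaces.linear sV sV D"
    by (rule V.linear_endoI) (simp_all add: D_def V.linear_apply[OF Om_zero_linear] algebra_simps)
  interpret D: Vector_Spaces.linear sV sV D by (rule D)
  define U where "U = D ` N d"
  have U: "V.subspace U" "\<And>x u. x \<in> grade 0 \<Longrightarrow> u \<in> U \<Longrightarrow> \<rho> x u \<in> U"
  proof -
    show "V.subspace U" unfolding U_def by (rule D.subspace_image[OF N_subspace])
    fix x u assume "x \<in> grade 0" "u \<in> U"
    then obtain w where w: "u = D w" "w \<in> N d" by (auto simp: U_def)
    have "\<rho> x u = D (\<rho> x w)" using \<open>x \<in> grade 0\<close> by (simp add: w D_def rho_simps Om_zero_commute)
    then show "\<rho> x u \<in> U" using grade0_N[OF \<open>x \<in> grade 0\<close> w(2)] by (simp add: U_def)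
  qed
  obtain A where A: "finite A" "N d = V.span A" using N_finite by blast
  \<comment> \<open>\<open>x\<close> is a nonzero vector of \<open>N d\<close> killed by
    \<open>D\<close>, and \<open>N d\<close> is finite-dimensional.\<close>
  have "\<not> N d \<subseteq> U"
  proof
    assume "N d \<subseteq> U"
    then have "V.span A \<subseteq> D ` V.span A" using A(2) by (simp add: U_def)
    from V.surj_on_finite_span_imp_inj[OF A(1) D this, of x] show False
      using x A(2) cx by (simp add: D_def)
  qed
  then have "\<exists>ys. set ys \<subseteq> BBm \<and> length ys = d \<and> wd ys \<notin> U"
    using N_generated[OF U, of d] by blast
  then obtain ys0 where ys0: "set ys0 \<subseteq> BBm \<and> length ys0 = d \<and> wd ys0 \<notin> U" by blast
  define L where "L = {ys. set ys \<subseteq> BBm \<and> length ys = d \<and> wd ys \<notin> U}"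
  have "finite L"
    by (rule finite_subset[OF _ finite_lists_length_eq[of BBm d]]) (auto simp: L_def finite_BB)
  moreover have "L \<noteq> {}" using ys0 by (auto simp: L_def)
  \<comment> \<open>Raising a word of maximal weight in \<open>L\<close> leads to words of larger
    weight, which therefore all lie in \<open>U\<close>.\<close>
  ultimately have "\<exists>ys\<in>L. \<forall>zs\<in>L. \<not> Re (nu ys X) < Re (nu zs X)"
    using Max_in[of "(\<lambda>ys. Re (nu ys X)) ` L"] Max_ge[of "(\<lambda>ys. Re (nu ys X)) ` L"] by (fastforce simp: not_less)
  then obtain ys where ys: "ys \<in> L" "\<And>zs. zs \<in> L \<Longrightarrow> \<not> Re (nu ys X) < Re (nu zs X)" by blast
  have ysp: "set ys \<subseteq> BBm" "length ys = d" "wd ys \<notin> U" using ys(1) by (auto simp: L_def)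
  have yw: "\<rho> H (wd ys) = sV (nu ys H) (wd ys)" if "H \<in> T" for H
    using wd_weight[OF that] ysp(1) by auto
  have raise: "\<rho> e (wd ys) \<in> U"
    if "\<And>H. H \<in> T \<Longrightarrow> br H e = sc (\<gamma> H) e" "\<gamma> Z = 0" "Re (\<gamma> X) > 0" for e \<gamma>
  proof -
    have "V.span {wd zs | zs. set zs \<subseteq> BBm \<and> length zs = length ys \<and> Re (nu zs X) > Re (nu ys X)} \<subseteq> U"
      by (intro V.span_minimal U(1)) (use ys(2) ysp(2) in \<open>auto simp: L_def\<close>)
    then show ?thesis using wd_raise[OF that ysp(1)] by blast
  qed
  have N: "wd ys \<in> N d" using wd_N[OF ysp(1)] ysp(2) by simp
  \<comment> \<open>\<open>D (wd ys)\<close> lies in \<open>U\<close> by definition of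
    \<open>U\<close>, so a nonzero difference of the two Casimir eigenvalues would put
    \<open>wd ys\<close> itself into \<open>U\<close>.\<close>
  have "D (wd ys) - (Om_zero (wd ys) - sV (cas (nu ys)) (wd ys)) \<in> U"
    by (rule V.subspace_diff[OF U(1) _ Om_zero_highest[OF U yw raise]]) (use N in \<open>simp_all add: U_def\<close>)
  then have *: "sV (cas (nu ys) - ?c) (wd ys) \<in> U" by (simp add: D_def algebra_simps)
  have "cas (nu ys) = ?c"
  proof (rule ccontr)
    assume "cas (nu ys) \<noteq> ?c"
    then show False
      using V.subspace_scale[OF U(1) *, of "inverse (cas (nu ys) - ?c)"] ysp(3) by simp
  qed
  moreover have "\<exists>n::nat. 2 * nu ys (br b (dl b)) = of_nat n * wt b (br b (dl b))"
    if b: "b \<in> BB" "wt b Z = 0" "Re (wt b X) > 0" for b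
  proof (rule dominant_mod[OF U N ysp(3) yw _ b])
    show "\<rho> b (wd ys) \<in> U" using b wt by (intro raise[of b "wt b"]) auto
  qed
  moreover have "ys \<noteq> []" using ysp(2) d0 by auto
  ultimately show ?thesis using ysp(1) by blast
qed

end

section \<open>The Killing form and the complexification\<close>

locale finite_lie_algebra = lie_algebra sc br
  for sc :: "'k::field \<Rightarrow> 'v::ab_group_add \<Rightarrow> 'v" and br +
  fixes Bas :: "'v set"
  assumes basis: "independent Bas" "span Bas = UNIV" "finite Bas"
begin

lemma ad_linear: "Vector_Spaces.linear sc sc (\<lambda>z. br x (br y z))"
  by (rule linear_endoI) (simp_all add: br_simps)

abbreviation "Kil \<equiv> killing_form sc br"

lemma killing_sym: "Kil x y = Kil y x"
  unfolding killing_form_def by (rule lin_trace_commute[OF basis linear_right linear_right])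

lemma killing_simps:
  "Kil x (y + z) = Kil x y + Kil x z" "Kil (x + y) z = Kil x z + Kil y z"
  "Kil x (sc c y) = c * Kil x y" "Kil (sc c x) y = c * Kil x y"
proof -
  show 1: "Kil x (y + z) = Kil x y + Kil x z" for x y z
    using lin_trace_linear(1)[OF basis ad_linear ad_linear] by (simp add: killing_form_def br_simps)
  show 2: "Kil x (sc c y) = c * Kil x y" for x y
    using lin_trace_linear(2)[OF basis ad_linear ad_linear] by (simp add: killing_form_def br_simps)
  show "Kil (x + y) z = Kil x z + Kil y z" "Kil (sc c x) y = c * Kil x y"
    by (simp_all only: killing_sym[of _ z] killing_sym[of "sc c x"] killing_sym[of x y] 1 2)
qed

lemma killing_inv: "Kil (br x y) z = Kil x (br y z)"
proof -
  have lin3: "Vector_Spaces.linear sc sc (\<lambda>w. br x (br y (br z w)))" for x y z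
    by (rule linear_endoI) (simp_all add: br_simps)
  have diff: "lin_trace sc (\<lambda>w. f w - g w) = lin_trace sc f - lin_trace sc g"
    if "Vector_Spaces.linear sc sc f" "Vector_Spaces.linear sc sc g" for f g
  proof -
    have "Vector_Spaces.linear sc sc (\<lambda>w. f w - g w)"
      using that by (intro linear_endoI) (simp_all add: linear_apply algebra_simps)
    from lin_trace_linear(1)[OF basis this that(2)] show ?thesis by simp
  qed
  have "Kil (br x y) z = lin_trace sc (\<lambda>w. br x (br y (br z w)) - br y (br x (br z w)))"
    unfolding killing_form_def by (simp add: br_derivation[of x y])
  also have "\<dots> = lin_trace sc (\<lambda>w. br x (br y (br z w))) - lin_trace sc (\<lambda>w. br y (br x (br z w)))"
    by (rule diff[OF lin3 lin3])
  also have "lin_trace sc (\<lambda>w. br y (br x (br z w))) = lin_trace sc (\<lambda>w. br x (br z (br y w)))"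
    by (rule lin_trace_commute[OF basis linear_right ad_linear])
  also have "lin_trace sc (\<lambda>w. br x (br y (br z w))) - lin_trace sc (\<lambda>w. br x (br z (br y w)))
      = lin_trace sc (\<lambda>w. br x (br y (br z w)) - br x (br z (br y w)))"
    by (rule diff[OF lin3 lin3, symmetric])
  also have "\<dots> = Kil x (br y z)"
    unfolding killing_form_def by (simp add: br_derivation[of y z] br_simps)
  finally show ?thesis .
qed

text \<open>Conjugation by \<phi> preserves the trace: cyclicity moves one \<phi> next to the other,
  where they cancel.\<close>

lemma killing_involution:
  assumes "Vector_Spaces.linear sc sc \<phi>" "\<And>x y. \<phi> (br x y) = br (\<phi> x) (\<phi> y)" "\<And>x. \<phi> (\<phi> x) = x"
  shows "Kil (\<phi> x) (\<phi> y) = Kil x y"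
proof -
  have lin: "Vector_Spaces.linear sc sc (\<lambda>w. br x (br y (\<phi> w)))"
    by (rule linear_endoI) (simp_all add: br_simps linear_apply[OF assms(1)])
  have "Kil (\<phi> x) (\<phi> y) = lin_trace sc (\<lambda>w. \<phi> (br x (br y (\<phi> w))))"
    unfolding killing_form_def by (simp add: assms(2,3))
  also have "\<dots> = lin_trace sc (\<lambda>w. br x (br y (\<phi> (\<phi> w))))"
    by (rule lin_trace_commute[OF basis assms(1) lin])
  finally show ?thesis by (simp add: assms(3) killing_form_def)
qed

end

lemma vector_space_cscale: "vector_space (cscale :: complex \<Rightarrow> 'g::real_vector cplx \<Rightarrow> 'g cplx)"
  by unfold_locales (auto simp: cscale_def prod_eq_iff algebra_simps)

global_interpretation C: vector_space "cscale :: complex \<Rightarrow> 'g::real_vector cplx \<Rightarrow> 'g cplx"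
  by (rule vector_space_cscale)

lemma cscale_real: "cscale (of_real c) X = c *\<^sub>R X"
  by (simp add: cscale_def prod_eq_iff)

lemma sum_fst_snd: "sum h I = ((\<Sum>i\<in>I. fst (h i)), (\<Sum>i\<in>I. snd (h i)))"
  for h :: "_ \<Rightarrow> 'a::real_vector \<times> 'b::real_vector"
  by (induction I rule: infinite_finite_induct) (auto simp: prod_eq_iff)

lemma complexified_basis:
  fixes Bas :: "'g::real_vector set"
  assumes "independent Bas" "span Bas = UNIV" "finite Bas"
  defines "CB \<equiv> (\<lambda>b. (b, 0)) ` Bas"
  shows "C.independent CB" "C.span CB = UNIV" "finite CB"
    and "b \<in> Bas \<Longrightarrow> C.representation CB X (b, 0)
      = Complex (representation Bas (fst X) b) (representation Bas (snd X) b)"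
proof -
  have inj: "inj_on (\<lambda>b. (b, 0)) Bas" by (auto simp: inj_on_def)
  show fin: "finite CB" by (simp add: CB_def assms)
  have comb: "(\<Sum>x\<in>CB. cscale (u x) x) = (\<Sum>b\<in>Bas. Re (u (b, 0)) *\<^sub>R b, \<Sum>b\<in>Bas. Im (u (b, 0)) *\<^sub>R b)" for u
    unfolding CB_def by (simp add: sum.reindex[OF inj] sum_fst_snd cscale_def)
  show ind: "C.independent CB"
  proof (rule C.independent_if_scalars_zero[OF fin])
    fix u x assume "(\<Sum>x\<in>CB. cscale (u x) x) = 0" and "x \<in> CB"
    then obtain b where b: "b \<in> Bas" "x = (b, 0)" "(\<Sum>b\<in>Bas. Re (u (b, 0)) *\<^sub>R b) = 0" "(\<Sum>b\<in>Bas. Im (u (b, 0)) *\<^sub>R b) = 0"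
      by (auto simp: CB_def comb[unfolded CB_def] zero_prod_def)
    have "Re (u (b, 0)) = 0" "Im (u (b, 0)) = 0"
      using independentD[OF assms(1,3) subset_refl b(3) b(1)] independentD[OF assms(1,3) subset_refl b(4) b(1)]
      by simp_all
    then show "u x = 0" by (simp add: b complex_eq_iff)
  qed
  define r where "r X x = (if x \<in> CB then Complex (representation Bas (fst X) (fst x)) (representation Bas (snd X) (fst x)) else 0)"
    for X :: "'g cplx" and x
  have "(\<Sum>b\<in>Bas. representation Bas x b *\<^sub>R b) = x" for x
    using assms by (intro real_vector.sum_representation_eq) auto
  moreover have "Re (r X (b, 0)) = representation Bas (fst X) b \<and> Im (r X (b, 0)) = representation Bas (snd X) b"
    if "b \<in> Bas" for b X using that by (auto simp: r_def CB_def)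
  ultimately have rsum: "(\<Sum>x\<in>CB. cscale (r X x) x) = X" for X by (simp add: comb)
  show span: "C.span CB = UNIV"
  proof -
    have "X \<in> C.span CB" for X
      by (subst rsum[of X, symmetric]) (intro C.span_sum C.span_scale C.span_base)
    then show ?thesis by blast
  qed
  have "C.representation CB X = r X"
  proof (rule C.representation_eqI[OF ind])
    show "b \<in> CB" if "r X b \<noteq> 0" for b using that by (auto simp: r_def split: if_splits)
    then have sub: "{b. r X b \<noteq> 0} \<subseteq> CB" by blast
    then show "finite {b. r X b \<noteq> 0}" using fin finite_subset by blast
    have "(\<Sum>b | r X b \<noteq> 0. cscale (r X b) b) = (\<Sum>x\<in>CB. cscale (r X x) x)"
      using sub fin by (intro sum.mono_neutral_left) auto
    then show "(\<Sum>b | r X b \<noteq> 0. cscale (r X b) b) = X" by (simp add: rsum)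
  qed (simp add: span)
  then show "b \<in> Bas \<Longrightarrow> C.representation CB X (b, 0)
      = Complex (representation Bas (fst X) b) (representation Bas (snd X) b)"
    by (auto simp: r_def CB_def)
qed

lemma lie_algebra_complexification:
  assumes "lie_algebra (*\<^sub>R) br"
  shows "lie_algebra cscale (cbr br)"
proof -
  interpret lie_algebra "(*\<^sub>R)" br by fact
  show ?thesis
  proof (intro lie_algebra.intro lie_algebra_axioms.intro vector_space_cscale)
    show "Vector_Spaces.linear cscale cscale (cbr br X)" for X
      by (rule C.linear_endoI) (auto simp: cbr_def cscale_def br_simps algebra_simps)
    show "Vector_Spaces.linear cscale cscale (\<lambda>X. cbr br X Y)" for Y
      by (rule C.linear_endoI) (auto simp: cbr_def cscale_def br_simps algebra_simps)
    have sk: "br a b + br b a = 0" for a b using br_skew[of a b] by simp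
    show "cbr br X X = 0" for X
      by (simp add: cbr_def alternating prod_eq_iff sk)
    have j: "br a (br b c) = - br b (br c a) - br c (br a b)" for a b c
      using jacobi[of a b c] by (simp add: eq_diff_eq eq_neg_iff_add_eq_0 ac_simps)
    show "cbr br X (cbr br Y Z) + cbr br Y (cbr br Z X) + cbr br Z (cbr br X Y) = 0" for X Y Z
      using jacobi[of "fst X" "fst Y" "fst Z"] jacobi[of "fst X" "snd Y" "snd Z"]
        jacobi[of "snd X" "fst Y" "snd Z"] jacobi[of "snd X" "snd Y" "fst Z"]
        jacobi[of "snd X" "snd Y" "snd Z"] jacobi[of "snd X" "fst Y" "fst Z"]
        jacobi[of "fst X" "snd Y" "fst Z"] jacobi[of "fst X" "fst Y" "snd Z"]
      by (simp add: cbr_def br_simps prod_eq_iff) (simp add: j[of "fst X"] j[of "snd X"] br_simps algebra_simps)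
  qed
qed

text \<open>Both traces can be computed in the same real basis \<open>Bas\<close>, viewed as
  \<open>(b, 0)\<close> in the complexification; real and imaginary parts of the coefficients are
  then coefficients of the two components.\<close>

lemma killing_complexification:
  fixes br :: "'g::real_vector \<Rightarrow> 'g \<Rightarrow> 'g" and Bas :: "'g set"
  assumes "lie_algebra (*\<^sub>R) br" "independent Bas" "span Bas = UNIV" "finite Bas"
  shows "killing_form cscale (cbr br) X Y =
    Complex (killing_form (*\<^sub>R) br (fst X) (fst Y) - killing_form (*\<^sub>R) br (snd X) (snd Y))
      (killing_form (*\<^sub>R) br (fst X) (snd Y) + killing_form (*\<^sub>R) br (snd X) (fst Y))"
proof -
  interpret R: lie_algebra "(*\<^sub>R)" br by fact
  interpret L: lie_algebra cscale "cbr br" using assms(1) by (rule lie_algebra_complexification)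
  have "finite_lie_algebra (*\<^sub>R) br Bas"
    using assms by (simp add: finite_lie_algebra_def finite_lie_algebra_axioms_def
        dependent_raw_def span_raw_def)
  then interpret R: finite_lie_algebra "(*\<^sub>R)" br Bas .
  note cb = complexified_basis[OF assms(2-4)]
  define CB where "CB = (\<lambda>b. (b, 0::'g)) ` Bas"
  note cb' = cb[folded CB_def]
  interpret L: finite_lie_algebra cscale "cbr br" CB
    using cb' by unfold_locales
  have K: "killing_form (*\<^sub>R) br x y = (\<Sum>b\<in>Bas. representation Bas (br x (br y b)) b)" for x y
    unfolding killing_form_def vector_space.lin_trace_eq[OF real_vector.vector_space_axioms R.basis R.ad_linear] by (simp add: representation_raw_def)
  have rl: "representation Bas (x + y) b = representation Bas x b + representation Bas y b"
    "representation Bas (x - y) b = representation Bas x b - representation Bas y b" for x y b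
    using assms by (simp_all add: representation_add representation_diff)
  have "killing_form cscale (cbr br) X Y = (\<Sum>x\<in>CB. C.representation CB (cbr br X (cbr br Y x)) x)"
    unfolding killing_form_def by (rule C.lin_trace_eq[OF L.basis L.ad_linear])
  also have "\<dots> = (\<Sum>b\<in>Bas. C.representation CB (cbr br X (cbr br Y (b, 0))) (b, 0))"
    unfolding CB_def by (subst sum.reindex) (auto simp: inj_on_def)
  also have "\<dots> = (\<Sum>b\<in>Bas. Complex (representation Bas (br (fst X) (br (fst Y) b) - br (snd X) (br (snd Y) b)) b)
       (representation Bas (br (fst X) (br (snd Y) b) + br (snd X) (br (fst Y) b)) b))"
    by (rule sum.cong) (simp_all add: cb'(4) cbr_def R.br_simps)
  finally show ?thesis
    by (simp add: complex_eq_iff K rl sum.distrib sum_subtractf)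
qed

section \<open>Antilinear involutions\<close>

locale antilinear_involution =
  fixes \<sigma> :: "'g::real_vector cplx \<Rightarrow> 'g cplx"
  assumes sig_add: "\<sigma> (X + Y) = \<sigma> X + \<sigma> Y"
    and sig_scale: "\<sigma> (cscale c X) = cscale (cnj c) (\<sigma> X)"
    and sig_sig: "\<sigma> (\<sigma> X) = X"
begin

lemma sig_zero: "\<sigma> 0 = 0" using sig_add[of 0 0] by simp

lemma sig_sum: "\<sigma> (sum h I) = (\<Sum>i\<in>I. \<sigma> (h i))"
  by (induction I rule: infinite_finite_induct) (auto simp: sig_zero sig_add)

lemma dim_sig_le:
  fixes A :: "'g cplx set"
  assumes "finite A" "C.span A = UNIV" "C.subspace U"
  shows "C.dim (\<sigma> ` U) \<le> C.dim U"
proof -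
  obtain D where D: "D \<subseteq> U" "C.independent D" "U \<subseteq> C.span D" "card D = C.dim U"
    using C.basis_exists by blast
  have fin: "finite D" using C.independent_span_bound[OF assms(1) D(2)] assms(2) by auto
  have "\<sigma> X \<in> C.span (\<sigma> ` D)" if "X \<in> C.span D" for X
    using that
  proof (induction rule: C.span_induct_alt)
    case base show ?case by (simp add: sig_zero C.span_zero)
  next
    case (step c x y)
    then show ?case by (simp add: sig_add sig_scale C.span_add C.span_scale C.span_base)
  qed
  then have "C.dim (\<sigma> ` U) \<le> card (\<sigma> ` D)" using D(3) fin by (intro C.dim_le_card) auto
  also have "\<dots> \<le> card D" using fin by (rule card_image_le)
  finally show ?thesis using D(4) by simp
qed

text \<open>A real basis of the fixed points is a complex basis of \<open>U\<close>: independence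
  follows by applying \<sigma> and separating real and imaginary parts of the coefficients, and
  every vector is a complex combination of two fixed ones. This relates multiplicities in a real
  form to complex dimensions.\<close>

lemma dim_fixed:
  fixes A :: "'g cplx set"
  assumes A: "finite A" "C.span A = UNIV" and U: "C.subspace U" "\<sigma> ` U \<subseteq> U"
  shows "dim {X \<in> U. \<sigma> X = X} = C.dim U"
proof -
  let ?F = "{X \<in> U. \<sigma> X = X}"
  obtain D where D: "D \<subseteq> ?F" "independent D" "?F \<subseteq> span D" "card D = dim ?F"
    using basis_exists by blast
  have fx: "\<sigma> d = d" if "d \<in> D" for d using that D(1) by auto
  have comb0: "\<forall>d\<in>E. u d = 0" if "finite E" "E \<subseteq> D" "(\<Sum>d\<in>E. cscale (u d) d) = 0" for E u
  proof -
    have "(\<Sum>d\<in>E. cscale (cnj (u d)) d) = \<sigma> (\<Sum>d\<in>E. cscale (u d) d)"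
      unfolding sig_sum sig_scale using that(2) fx by (intro sum.cong) auto
    then have c: "(\<Sum>d\<in>E. cscale (cnj (u d)) d) = 0" by (simp add: that(3) sig_zero)
    have "(\<Sum>d\<in>E. cscale (of_real (2 * Re (u d))) d) = 0" "(\<Sum>d\<in>E. cscale (of_real (2 * Im (u d))) d) = 0"
    proof -
      have "(\<Sum>d\<in>E. cscale (u d) d + cscale (cnj (u d)) d) = 0" by (simp add: sum.distrib that(3) c)
      then show "(\<Sum>d\<in>E. cscale (of_real (2 * Re (u d))) d) = 0"
        by (simp only: C.scale_left_distrib[symmetric] complex_add_cnj)
      have "cscale (- \<i>) (\<Sum>d\<in>E. cscale (u d) d - cscale (cnj (u d)) d) = 0"
        by (simp add: sum_subtractf that(3) c)
      then have "(\<Sum>d\<in>E. cscale (- \<i> * (u d - cnj (u d))) d) = 0"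
        by (simp only: C.scale_sum_right C.scale_scale C.scale_left_diff_distrib[symmetric])
      moreover have "- \<i> * (z - cnj z) = of_real (2 * Im z)" for z by (simp add: complex_eq_iff)
      ultimately show "(\<Sum>d\<in>E. cscale (of_real (2 * Im (u d))) d) = 0" by (simp only:)
    qed
    then have "(\<Sum>d\<in>E. (2 * Re (u d)) *\<^sub>R d) = 0" "(\<Sum>d\<in>E. (2 * Im (u d)) *\<^sub>R d) = 0"
      by (simp_all only: cscale_real)
    then have "2 * Re (u d) = 0 \<and> 2 * Im (u d) = 0" if "d \<in> E" for d
      using independentD[OF D(2) \<open>finite E\<close> \<open>E \<subseteq> D\<close>, of "\<lambda>d. 2 * Re (u d)" d]
        independentD[OF D(2) \<open>finite E\<close> \<open>E \<subseteq> D\<close>, of "\<lambda>d. 2 * Im (u d)" d] that by simp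
    then show ?thesis by (simp add: complex_eq_iff)
  qed
  have "C.independent D" unfolding C.independent_explicit_module using comb0 by blast
  moreover have "D \<subseteq> U" using D(1) by auto
  moreover have "U \<subseteq> C.span D"
  proof
    fix X assume X: "X \<in> U"
    have sp: "span D \<subseteq> C.span D"
    proof (rule span_minimal)
      show "subspace (C.span D)"
        by (auto simp: subspace_def C.span_zero C.span_add C.span_scale simp flip: cscale_real)
    qed (rule C.span_superset)
    define Y where "Y = X + \<sigma> X"
    \<comment> \<open>The factor \<open>\<i>\<close> turns the antifixed vector
      \<open>X - \<sigma> X\<close> into a fixed one.\<close>
    define W where "W = cscale \<i> (X - \<sigma> X)"
    have neg: "\<sigma> (- V) = - \<sigma> V" for V using sig_scale[of "-1" V] by simp
    have "Y \<in> ?F" using X U by (auto simp: Y_def sig_add sig_sig add.commute intro: C.subspace_add)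
    moreover have "W \<in> ?F"
    proof -
      have "\<sigma> W = cscale (- \<i>) (\<sigma> (X + - \<sigma> X))" by (simp add: W_def sig_scale)
      also have "\<dots> = W" by (simp only: sig_add neg sig_sig W_def) (simp add: algebra_simps)
      finally show ?thesis using X U by (auto simp: W_def intro!: C.subspace_scale C.subspace_diff)
    qed
    ultimately have "Y \<in> C.span D" "W \<in> C.span D" using D(3) sp by auto
    moreover have "X = cscale (1/2) Y + cscale (- \<i> / 2) W"
      unfolding Y_def W_def C.scale_scale by (simp add: cscale_def prod_eq_iff algebra_simps flip: scaleR_left_distrib)
    ultimately show "X \<in> C.span D" by (metis C.span_add C.span_scale)
  qed
  ultimately have "C.dim U = card D" by (metis C.basis_card_eq_dim)
  then show ?thesis using D(4) by simp
qed

end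

section \<open>Root decomposition of a compactly causal symmetric Lie algebra\<close>

locale compactly_causal_data =
  fixes br :: "'g::real_vector \<Rightarrow> 'g \<Rightarrow> 'g" and \<theta> \<tau> :: "'g \<Rightarrow> 'g" and Z0 :: "'g cplx"
    and a :: "'g cplx set" and t :: "'g set" and P :: "('g cplx \<Rightarrow> complex) set"
  assumes causal: "compactly_causal br \<theta> \<tau>"
    and Z0_normalized: "normalized_central_element br \<theta> Z0"
    and a_maximal: "maximal_abelian_in (cbr br) ({0} \<times> (minus_space \<tau> \<inter> plus_space \<theta>)) a"
    and t_cartan: "cartan_subalgebra br t" and t_compact: "t \<subseteq> plus_space \<theta>"
    and t_split: "t \<times> {0} = {x + cscale \<i> y | x y. x \<in> (t \<inter> plus_space \<tau>) \<times> {0} \<and> y \<in> a}"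
    and P_positive: "positive_system br t P"
    and P_noncompact: "{\<beta> \<in> P. \<beta> Z0 \<noteq> 0} = {\<beta> \<in> lie_roots br t. \<beta> Z0 = 1}"
    and P_tau: "\<forall>\<beta>\<in>P. (\<lambda>H. - \<beta> (cmap \<tau> H)) \<in> P \<union> {\<mu>. \<forall>H\<in>a. \<mu> H = 0}"
begin

definition "Bas = (SOME B::'g set. independent B \<and> span B = UNIV \<and> finite B)"

lemma Bas: "independent Bas" "span Bas = UNIV" "finite Bas"
proof -
  obtain S :: "'g set" where S: "finite S" "span S = UNIV"
    using causal by (auto simp: compactly_causal_def hermitian_lie_algebra_def)
  obtain B where B: "B \<subseteq> S" "independent B" "S \<subseteq> span B"
    using real_vector.maximal_independent_subset by blast
  have "span S \<subseteq> span B" using B(3) by (simp add: real_vector.span_minimal)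
  then have "independent B \<and> span B = UNIV \<and> finite B" using B S finite_subset by auto
  then have "independent Bas \<and> span Bas = UNIV \<and> finite Bas" unfolding Bas_def by (rule someI)
  then show "independent Bas" "span Bas = UNIV" "finite Bas" by auto
qed

lemma lie: "lie_algebra (*\<^sub>R) br"
  using causal by (simp add: compactly_causal_def hermitian_lie_algebra_def)

lemma finite_lie: "finite_lie_algebra (*\<^sub>R) br Bas"
  using lie Bas by (simp add: finite_lie_algebra_def finite_lie_algebra_axioms_def dependent_raw_def span_raw_def)

definition "CB = (\<lambda>b. (b, 0::'g)) ` Bas"

lemma finite_lie_complex: "finite_lie_algebra cscale (cbr br) CB"
  using lie_algebra_complexification[OF lie] complexified_basis[OF Bas, folded CB_def]
  by (simp add: finite_lie_algebra_def finite_lie_algebra_axioms_def)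

end

sublocale compactly_causal_data \<subseteq> R: finite_lie_algebra "(*\<^sub>R)" br Bas
  by (rule finite_lie)

sublocale compactly_causal_data \<subseteq> L: finite_lie_algebra cscale "cbr br" CB
  by (rule finite_lie_complex)

section \<open>Inner products and the Cartan subalgebra\<close>

context compactly_causal_data
begin

abbreviation "K \<equiv> killing_form (*\<^sub>R) br"
abbreviation "KC \<equiv> killing_form cscale (cbr br)"
abbreviation "T \<equiv> t \<times> t"
abbreviation "cb \<equiv> cbr br"

lemma theta: "linear \<theta>" "\<theta> (br x y) = br (\<theta> x) (\<theta> y)" "\<theta> (\<theta> x) = x"
  and tau: "linear \<tau>" "\<tau> (br x y) = br (\<tau> x) (\<tau> y)" "\<tau> (\<tau> x) = x"
  and K_neg: "x \<noteq> 0 \<Longrightarrow> K x (\<theta> x) < 0"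
proof -
  have 1: "lie_automorphism br \<theta>" "\<theta> \<circ> \<theta> = id" "lie_automorphism br \<tau>" "\<tau> \<circ> \<tau> = id"
    "x \<noteq> 0 \<Longrightarrow> - K x (\<theta> x) > 0"
    using causal by (simp_all add: compactly_causal_def hermitian_lie_algebra_def cartan_involution_def)
  show "linear \<theta>" "\<theta> (br x y) = br (\<theta> x) (\<theta> y)" "linear \<tau>" "\<tau> (br x y) = br (\<tau> x) (\<tau> y)"
    using 1 by (simp_all add: lie_automorphism_def)
  show "\<theta> (\<theta> x) = x" "\<tau> (\<tau> x) = x" using 1(2,4) by (metis comp_apply id_apply)+
  show "x \<noteq> 0 \<Longrightarrow> K x (\<theta> x) < 0" using 1(5) by simp
qed

lemmas theta_simps = linear_add[OF theta(1)] linear_diff[OF theta(1)] linear_neg[OF theta(1)]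
  linear_0[OF theta(1)] linear_scale[OF theta(1)]
lemmas tau_simps = linear_add[OF tau(1)] linear_diff[OF tau(1)] linear_neg[OF tau(1)]
  linear_0[OF tau(1)] linear_scale[OF tau(1)]

lemma K_theta: "K (\<theta> x) (\<theta> y) = K x y"
  by (rule R.killing_involution) (use theta in \<open>auto simp: linear_def\<close>)

lemma K_tau: "K (\<tau> x) (\<tau> y) = K x y"
  by (rule R.killing_involution) (use tau in \<open>auto simp: linear_def\<close>)

lemma K_simps:
  "K x (y + z) = K x y + K x z" "K (x + y) z = K x z + K y z" "K x (c *\<^sub>R y) = c * K x y"
  "K (c *\<^sub>R x) y = c * K x y" "K 0 y = 0" "K x 0 = 0" "K (- x) y = - K x y" "K x (- y) = - K x y"
  "K (x - y) z = K x z - K y z" "K x (y - z) = K x y - K x z"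
  "K (sum h I) y = (\<Sum>i\<in>I. K (h i) y)" "K x (sum h I) = (\<Sum>i\<in>I. K x (h i))"
proof -
  note R = R.killing_simps
  show "K x (y + z) = K x y + K x z" and 2: "K (x + y) z = K x z + K y z" and "K x (c *\<^sub>R y) = c * K x y"
    and 4: "K (c *\<^sub>R x) y = c * K x y" for x y z c by (fact R)+
  have l: "linear (\<lambda>x. K x y)" for y by (rule linearI) (simp_all add: R)
  have r: "linear (\<lambda>y. K x y)" for x by (rule linearI) (simp_all add: R)
  show "K 0 y = 0" "K (- x) y = - K x y" "K (x - y) z = K x z - K y z" "K (sum h I) y = (\<Sum>i\<in>I. K (h i) y)"
    by (rule linear_0[OF l] linear_neg[OF l] linear_diff[OF l] linear_sum[OF l])+
  show "K x 0 = 0" "K x (- y) = - K x y" "K x (y - z) = K x y - K x z" "K x (sum h I) = (\<Sum>i\<in>I. K x (h i))"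
    by (rule linear_0[OF r] linear_neg[OF r] linear_diff[OF r] linear_sum[OF r])+
qed

lemma KC_eq: "KC X Y = Complex (K (fst X) (fst Y) - K (snd X) (snd Y)) (K (fst X) (snd Y) + K (snd X) (fst Y))"
  by (rule killing_complexification[OF lie Bas])

definition "ip x y = - K x (\<theta> y)"
text \<open>The real part of the hermitian extension of \<open>ip\<close>, kept as a real form so
  that \<open>positive_definite_riesz\<close> applies to it.\<close>

definition "sp X Y = ip (fst X) (fst Y) + ip (snd X) (snd Y)"

lemma ip_sym: "ip x y = ip y x"
  unfolding ip_def using K_theta[of x "\<theta> y"] by (simp add: theta R.killing_sym)

lemma ip_simps: "ip x (y + z) = ip x y + ip x z" "ip (x + y) z = ip x z + ip y z" "ip x (c *\<^sub>R y) = c * ip x y"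
  "ip (c *\<^sub>R x) y = c * ip x y" "ip 0 y = 0" "ip x 0 = 0" "ip (- x) y = - ip x y" "ip x (- y) = - ip x y"
  "ip (x - y) z = ip x z - ip y z" "ip x (y - z) = ip x y - ip x z"
  by (simp_all add: ip_def K_simps theta_simps)

lemma ip_pos: "x \<noteq> 0 \<Longrightarrow> ip x x > 0"
  using K_neg by (simp add: ip_def)

lemma ip_nonneg: "ip x x \<ge> 0" by (cases "x = 0") (simp_all add: ip_simps order.strict_implies_order ip_pos)

lemma ip_ad: "\<theta> h = h \<Longrightarrow> ip (br h x) y = - ip x (br h y)"
  using R.killing_inv[of x h "\<theta> y"] R.br_skew[of h x] by (simp add: ip_def theta K_simps)

lemma sp_pos: "X \<noteq> 0 \<Longrightarrow> sp X X > 0"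
  using ip_pos ip_nonneg by (cases X) (auto simp: sp_def prod_eq_iff add_pos_nonneg add_nonneg_pos)

lemma sp_simps: "sp (X + Y) Z = sp X Z + sp Y Z" "sp (c *\<^sub>R X) Y = c * sp X Y" "sp X Y = sp Y X"
  by (simp_all add: sp_def ip_simps ip_sym algebra_simps)

lemma sp_cscale: "sp (cscale c X) Y = sp X (cscale (cnj c) Y)"
  by (simp add: sp_def cscale_def ip_simps algebra_simps)

lemma t_theta: "h \<in> t \<Longrightarrow> \<theta> h = h"
  using t_compact by (auto simp: plus_space_def)

text \<open>Elements of \<open>t\<close> act by skew and elements of \<open>i t\<close> by symmetric
  operators, so the adjoint of an operator from \<open>T\<close> again comes from
  \<open>T\<close>.\<close>

lemma sp_ad: "H \<in> T \<Longrightarrow> sp (cb H X) Y = sp X (cb (- fst H, snd H) Y)"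
  by (cases H; cases X; cases Y) (simp add: sp_def cbr_def ip_simps ip_ad t_theta R.br_simps)

lemma t_subspace: "subspace t"
  and t_normalizer: "(\<And>y. y \<in> t \<Longrightarrow> br x y \<in> t) \<Longrightarrow> x \<in> t"
  using t_cartan unfolding cartan_subalgebra_def by blast+

text \<open>A Cartan subalgebra is nilpotent by definition. As \<open>x\<close> lies in the compact
  part, \<open>br x\<close> is skew for \<open>ip\<close>, so its square has the same kernel as
  \<open>br x\<close> itself, and nilpotency leaves \<open>br x y = 0\<close>.\<close>

lemma t_abelian:
  assumes "x \<in> t" "y \<in> t" shows "br x y = 0"
proof -
  obtain N where N: "lower_central_series br t N = {0}"
    using t_cartan by (auto simp: cartan_subalgebra_def)
  have "(br x ^^ n) y \<in> lower_central_series br t n" for n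
    by (induction n) (use assms in \<open>auto intro!: span_base\<close>)
  then have "(br x ^^ N) y = 0" using N by auto
  then show ?thesis
  proof (induction N)
    case (Suc n)
    show ?case
    proof (cases n)
      case (Suc m)
      define w where "w = (br x ^^ m) y"
      have "br x (br x w) = 0" using Suc.prems Suc by (simp add: w_def)
      then have "ip (br x w) (br x w) = 0"
        using ip_ad[OF t_theta[OF assms(1)], of w "br x w"] by (simp add: ip_simps)
      then have "br x w = 0" using ip_pos[of "br x w"] by auto
      then show ?thesis using Suc.IH Suc by (simp add: w_def)
    qed (use Suc.prems in simp)
  qed (simp add: R.br_simps)
qed

lemma T_subspace: "C.subspace T"
  using t_subspace by (auto simp: C.subspace_def cscale_def zero_prod_def subspace_add subspace_scale subspace_0 subspace_diff)

lemma T_abelian: "H \<in> T \<Longrightarrow> H' \<in> T \<Longrightarrow> cb H H' = 0"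
  by (auto simp: cbr_def t_abelian zero_prod_def)

text \<open>An element that commutes with \<open>t\<close> normalizes it, and \<open>t\<close> is
  its own normalizer.\<close>

lemma T_centralizer:
  assumes "\<And>H. H \<in> T \<Longrightarrow> cb H X = 0" shows "X \<in> T"
proof -
  have "0 \<in> t" using t_subspace by (rule subspace_0)
  then have "br y (fst X) = 0 \<and> br y (snd X) = 0" if "y \<in> t" for y
    using assms[of "(y, 0)"] that by (simp add: cbr_def R.br_simps zero_prod_def)
  then have "br (fst X) y \<in> t" "br (snd X) y \<in> t" if "y \<in> t" for y
    using that R.br_skew[of "fst X" y] R.br_skew[of "snd X" y] \<open>0 \<in> t\<close> by simp_all
  then show ?thesis using t_normalizer by (simp add: mem_Times_iff)
qed

lemma finite_real_span: "\<exists>A. finite A \<and> span A = (UNIV :: 'g cplx set)"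
proof -
  let ?A = "(\<lambda>b. (b, 0::'g)) ` Bas \<union> (\<lambda>b. (0::'g, b)) ` Bas"
  have l: "linear (\<lambda>x. (x, 0::'g))" "linear (\<lambda>x. (0::'g, x))" by (auto intro!: linearI)
  have "(x, y) \<in> span ?A" for x y
  proof -
    have "(x, 0) \<in> span ((\<lambda>b. (b, 0::'g)) ` Bas)" "(0, y) \<in> span ((\<lambda>b. (0::'g, b)) ` Bas)"
      using Bas by (auto simp: linear_span_image[OF l(1)] linear_span_image[OF l(2)])
    moreover have "span ((\<lambda>b. (b, 0)) ` Bas) \<subseteq> span ?A" "span ((\<lambda>b. (0, b)) ` Bas) \<subseteq> span ?A"
      by (intro span_mono; blast)+
    ultimately have "(x, 0) \<in> span ?A" "(0, y) \<in> span ?A" by blast+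
    from span_add[OF this] show ?thesis by simp
  qed
  then show ?thesis using Bas(3) by (intro exI[of _ ?A]) auto
qed

text \<open>Positive definiteness of \<open>sp\<close> provides the representing vector over the
  reals. The result gives the dual basis for the Killing form.\<close>

lemma complex_riesz:
  assumes "\<And>x y. f (x + y) = f x + f y" "\<And>c x. f (cscale c x) = c * f x"
  shows "\<exists>Y. \<forall>U. KC Y U = f U"
proof -
  obtain A :: "'g cplx set" where A: "finite A" "span A = UNIV" using finite_real_span by blast
  have "\<exists>y\<in>span A. \<forall>u\<in>span A. sp y u = Re (f u)"
  proof (rule positive_definite_riesz[OF A(1)])
    show "sp x y = sp y x" for x y by (rule sp_simps(3))
    show "Re (f (c *\<^sub>R x)) = c * Re (f x)" for c x by (simp add: assms flip: cscale_real)
  qed (simp_all add: sp_simps(1,2) sp_pos assms)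
  then obtain y where y: "\<And>u. sp y u = Re (f u)" using A by auto
  \<comment> \<open>Sign and \<theta> are chosen such that \<open>Re (KC Y U) = sp y U\<close>; the
    imaginary part follows on replacing \<open>U\<close> by \<open>cscale \<i> U\<close>.\<close>
  define Y where "Y = (- \<theta> (fst y), \<theta> (snd y))"
  have re: "Re (KC Y U) = Re (f U)" for U
    using K_theta[of "fst y" "\<theta> (fst U)"] K_theta[of "snd y" "\<theta> (snd U)"] y[of U]
    by (simp add: KC_eq Y_def sp_def ip_def K_simps theta)
  have "Im (KC Y U) = Im (f U)" for U
    using re[of "cscale \<i> U"] by (simp add: L.killing_simps assms)
  with re show ?thesis by (metis complex_eq_iff)
qed

section \<open>Weight vectors and the dual basis\<close>

definition "WV = {X. \<exists>\<mu>. \<forall>H\<in>T. cb H X = cscale (\<mu> H) X}"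

text \<open>By \<open>sp_ad\<close> the orthogonal complement of the span is stable under
  \<open>T\<close>. If it were nonzero, the commuting operators from \<open>T\<close> would have a
  common eigenvector in it: a weight vector orthogonal to itself.\<close>

lemma weight_vectors_span: "C.span WV = UNIV"
proof (rule ccontr)
  let ?W = "C.span WV"
  assume "?W \<noteq> UNIV"
  then obtain V where V: "V \<notin> ?W" by blast
  obtain A :: "'g cplx set" where A: "finite A" "span A = UNIV" using finite_real_span by blast
  have Wsub: "subspace ?W"
    by (auto simp: subspace_def C.span_zero C.span_add C.span_scale simp flip: cscale_real)
  obtain D where D: "D \<subseteq> ?W" "independent D" "?W \<subseteq> span D"
    using basis_exists[of ?W] by metis
  have finD: "finite D" using real_vector.independent_span_bound[OF A(1) D(2)] A(2) by auto
  have WD: "?W = span D" using D Wsub by (metis span_minimal subset_antisym)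
  have "\<exists>y\<in>span D. \<forall>u\<in>span D. sp y u = sp V u"
  proof (rule positive_definite_riesz[OF finD])
    show "sp x y = sp y x" for x y by (rule sp_simps(3))
    show "sp V (x + y) = sp V x + sp V y" "sp V (c *\<^sub>R x) = c * sp V x" for x y c
      by (simp_all add: sp_def ip_simps algebra_simps)
  qed (simp_all add: sp_simps(1,2) sp_pos)
  then obtain y where y: "y \<in> ?W" "\<And>u. u \<in> ?W \<Longrightarrow> sp y u = sp V u" using WD by auto
  define Q where "Q = {X. \<forall>u\<in>?W. sp X u = 0}"
  have Wst: "cb H X \<in> ?W" if H: "H \<in> T" and X: "X \<in> ?W" for H X
    using X
  proof (induction rule: C.span_induct_alt)
    case base show ?case by (simp add: L.br_simps C.span_zero)
  next
    case (step c x y)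
    then obtain \<mu> where "cb H x = cscale (\<mu> H) x" using H by (auto simp: WV_def)
    then show ?case using step by (simp add: L.br_simps C.span_add C.span_scale C.span_base)
  qed
  have "V + (-1) *\<^sub>R y \<in> Q" using y(2) by (simp only: Q_def mem_Collect_eq sp_simps(1,2)) simp
  moreover have "V + (-1) *\<^sub>R y \<noteq> 0" using V y(1) by auto
  ultimately have "Q \<noteq> {0}" by blast
  have Osub: "C.subspace Q"
  proof (rule C.subspaceI)
    show "0 \<in> Q" by (simp add: Q_def sp_def ip_simps)
  qed (simp_all add: Q_def sp_simps(1) sp_cscale C.span_scale)
  have Ost: "cb H X \<in> Q" if "H \<in> T" "X \<in> Q" for H X
  proof -
    have "(- fst H, snd H) \<in> T" using that(1) t_subspace by (auto simp: subspace_neg)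
    then show ?thesis using that Wst by (simp add: Q_def sp_ad)
  qed
  have "finite_dimensional_vector_space cscale CB"
    using L.basis by unfold_locales (auto simp: C.scale_right_distrib C.scale_left_distrib)
  then have "\<exists>y\<in>Q. y \<noteq> 0 \<and> (\<forall>f\<in>cb ` T. \<exists>a. f y = cscale a y)"
  proof (rule common_eigenvector_exists[OF _ _ _ Osub _ \<open>Q \<noteq> {0}\<close>])
    show "Vector_Spaces.linear cscale cscale f" if "f \<in> cb ` T" for f
      using that L.linear_right by blast
    show "f (g x) = g (f x)" if fg: "f \<in> cb ` T" "g \<in> cb ` T" for f g x
    proof -
      obtain H H' where H: "H \<in> T" "f = cb H" "H' \<in> T" "g = cb H'" using fg by blast
      show ?thesis using L.br_derivation[of H H' x] T_abelian[OF H(1,3)] by (simp add: H L.br_simps(5))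
    qed
    show "f x \<in> Q" if "f \<in> cb ` T" "x \<in> Q" for f x using that Ost by blast
  qed
  then obtain x where x: "x \<in> Q" "x \<noteq> 0" "\<forall>H\<in>T. \<exists>c. cb H x = cscale c x" by blast
  from bchoice[OF x(3)] have "x \<in> WV" by (simp add: WV_def)
  then have "sp x x = 0" using x(1) C.span_base[of x WV] by (simp add: Q_def)
  then show False using sp_pos[OF x(2)] by simp
qed

definition "BB = (SOME B. B \<subseteq> WV \<and> C.independent B \<and> C.span B = UNIV \<and> finite B)"

lemma BB: "BB \<subseteq> WV" "C.independent BB" "C.span BB = UNIV" "finite BB"
proof -
  obtain B where B: "B \<subseteq> WV" "C.independent B" "WV \<subseteq> C.span B"
    using C.maximal_independent_subset by blast
  have "C.span B = UNIV" using B(3) weight_vectors_span by (metis C.span_mono C.span_span top.extremum_uniqueI)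
  moreover have "finite B" using C.independent_span_bound[OF L.basis(3) B(2)] L.basis(2) by auto
  ultimately have "B \<subseteq> WV \<and> C.independent B \<and> C.span B = UNIV \<and> finite B" using B by blast
  then have "BB \<subseteq> WV \<and> C.independent BB \<and> C.span BB = UNIV \<and> finite BB" unfolding BB_def by (rule someI)
  then show "BB \<subseteq> WV" "C.independent BB" "C.span BB = UNIV" "finite BB" by auto
qed

text \<open>The value 0 off \<open>T\<close> follows the encoding of functionals in
  \<open>dual_space\<close>.\<close>

definition "wt b H = (if H \<in> T then THE c. cb H b = cscale c b else 0)"
definition "dl b = (SOME Y. \<forall>U. KC Y U = C.representation BB U b)"

lemma BB_nonzero: "b \<in> BB \<Longrightarrow> b \<noteq> 0"
  using BB(2) C.dependent_zero by blast

lemma wt_eqI: "H \<in> T \<Longrightarrow> b \<noteq> 0 \<Longrightarrow> cb H b = cscale c b \<Longrightarrow> wt b H = c"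
  by (auto simp: wt_def intro!: the_equality)

lemma wt: "H \<in> T \<Longrightarrow> b \<in> BB \<Longrightarrow> cb H b = cscale (wt b H) b"
proof -
  assume H: "H \<in> T" and b: "b \<in> BB"
  then have "b \<in> WV" using BB(1) by blast
  then obtain \<mu> where "\<And>H. H \<in> T \<Longrightarrow> cb H b = cscale (\<mu> H) b" unfolding WV_def by blast
  then show ?thesis using H wt_eqI[OF H BB_nonzero[OF b]] by metis
qed

lemma wt_dual: "b \<in> BB \<Longrightarrow> wt b \<in> dual_space cscale T"
proof -
  assume b: "b \<in> BB"
  have "wt b (x + y) = wt b x + wt b y" if "x \<in> T" "y \<in> T" for x y
    using C.subspace_add[OF T_subspace that] b that
    by (intro wt_eqI) (simp_all add: BB_nonzero L.br_simps wt C.scale_left_distrib)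
  moreover have "wt b (cscale c x) = c * wt b x" if "x \<in> T" for x c
    using C.subspace_scale[OF T_subspace that] b that
    by (intro wt_eqI) (simp_all add: BB_nonzero L.br_simps wt)
  moreover have "wt b x = 0" if "x \<notin> T" for x using that unfolding wt_def by (rule if_not_P)
  ultimately show ?thesis unfolding dual_space_def by blast
qed

lemma KC_dl: "KC (dl b) U = C.representation BB U b"
proof -
  have "\<exists>Y. \<forall>U. KC Y U = C.representation BB U b"
    by (rule complex_riesz) (simp_all add: C.rep_linear[OF BB(2,3)])
  then have "\<forall>U. KC (dl b) U = C.representation BB U b" unfolding dl_def by (rule someI_ex)
  then show ?thesis by blast
qed

lemma dual: "b \<in> BB \<Longrightarrow> b' \<in> BB \<Longrightarrow> KC (dl b) b' = (if b = b' then 1 else 0)"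
  by (simp add: KC_dl C.representation_basis[OF BB(2)])

lemma expand: "(\<Sum>b\<in>BB. cscale (KC (dl b) x) b) = x"
  by (simp add: KC_dl C.rep_sum[OF BB(2,3,4)])

subsection \<open>The central element\<close>

definition "z = snd Z0"

lemma z: "fst Z0 = 0" "\<theta> z = z" "\<tau> z = - z" "\<theta> y = y \<Longrightarrow> br z y = 0" "z \<in> t"
proof -
  have Z: "Z0 \<in> {0} \<times> lie_centre br (plus_space \<theta>)"
    using Z0_normalized by (simp add: normalized_central_element_def)
  show "fst Z0 = 0" "\<theta> z = z" and c: "\<theta> y = y \<Longrightarrow> br z y = 0" for y
    using Z by (auto simp: z_def lie_centre_def plus_space_def)
  show "\<tau> z = - z" using causal Z by (auto simp: z_def compactly_causal_def minus_space_def)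
  show "z \<in> t"
    by (rule t_normalizer) (use c t_theta subspace_0[OF t_subspace] in auto)
qed

lemma cb_Z0: "cb Z0 X = (- br z (snd X), br z (fst X))"
  by (simp add: cbr_def z(1) R.br_simps flip: z_def)

lemma Z0_T: "Z0 \<in> T"
  using z(5) subspace_0[OF t_subspace] by (simp add: mem_Times_iff z(1) flip: z_def)

lemma Z0_spectrum: "X \<noteq> 0 \<Longrightarrow> cb Z0 X = cscale c X \<Longrightarrow> c \<in> {-1, 0, 1}"
  using Z0_normalized unfolding normalized_central_element_def by blast

lemma z_nonzero: "z \<noteq> 0"
proof
  assume "z = 0"
  have "1 \<in> {c. \<exists>X. X \<noteq> 0 \<and> cb Z0 X = cscale c X}"
    using Z0_normalized by (simp add: normalized_central_element_def)
  then show False using \<open>z = 0\<close> by (auto simp: cb_Z0 R.br_simps zero_prod_def)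
qed

lemma grading: "b \<in> BB \<Longrightarrow> wt b Z0 \<in> {-1, 0, 1}"
  using Z0_spectrum wt[OF Z0_T] BB_nonzero by blast

text \<open>The eigenvalues of \<open>cb Z0\<close> on the weight basis satisfy
  \<open>c^3 = c\<close>, and \<open>Z0\<close> is \<open>\<i>\<close> times \<open>z\<close>, which
  accounts for the sign.\<close>

lemma ad_z_cube: "br z (br z (br z x)) = - br z x"
proof -
  have "cb Z0 (cb Z0 (cb Z0 X)) = cb Z0 X" for X
  proof -
    have 1: "cb Z0 (cb Z0 (cb Z0 b)) = cb Z0 b" if "b \<in> BB" for b
      using grading[OF that] by (auto simp: wt[OF Z0_T that] L.br_simps)
    have "cb Z0 (cb Z0 (cb Z0 (\<Sum>b\<in>BB. cscale (KC (dl b) X) b))) = cb Z0 (\<Sum>b\<in>BB. cscale (KC (dl b) X) b)"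
      by (simp only: L.br_simps) (simp add: 1)
    then show ?thesis by (simp only: expand)
  qed
  from this[of "(x, 0)"] show ?thesis by (simp add: cb_Z0 R.br_simps minus_equation_iff)
qed

lemma simple: "lie_ideal (*\<^sub>R) br I \<Longrightarrow> I = {0} \<or> I = UNIV" "\<exists>x y. br x y \<noteq> 0"
  using causal by (simp_all add: compactly_causal_def hermitian_lie_algebra_def simple_lie_def)

lemma lie_idealI:
  assumes "subspace I" "\<And>x y. y \<in> I \<Longrightarrow> br x y \<in> I" shows "lie_ideal (*\<^sub>R) br I"
  using assms by (simp add: lie_ideal_def subspace_raw_def)

lemma centre_trivial: "(\<And>x. br x y = 0) \<Longrightarrow> y = 0"
proof -
  assume y: "\<And>x. br x y = 0"
  let ?I = "{y. \<forall>x. br x y = 0}"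
  have "?I = {0} \<or> ?I = UNIV"
    by (intro simple(1) lie_idealI) (auto simp: subspace_def R.br_simps)
  then show "y = 0" using y simple(2) by blast
qed

text \<open>Simplicity enters here. The centralizer \<open>I\<close> of \<open>[z, p]\<close> turns
  out to be an ideal. It is not everything, since then \<open>[z, p]\<close> and hence
  \<open>z\<close> would be central; so it is zero. But it contains every \<open>u\<close> in
  \<open>p\<close> with \<open>[z, u] = 0\<close>: for \<open>y\<close> in \<open>p\<close> the
  bracket \<open>[u, y]\<close> lies in \<open>k\<close> and so commutes with
  \<open>z\<close>.\<close>

lemma z_centralizer:
  assumes "br z x = 0" shows "\<theta> x = x"
proof -
  let ?p = "{x. \<theta> x = - x}"
  define I where "I = {x. \<forall>y\<in>?p. br x (br z y) = 0}"
  have p0I: "u \<in> I" if u: "u \<in> ?p" "br z u = 0" for u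
  proof -
    have "br u (br z y) = 0" if "y \<in> ?p" for y
    proof -
      have "\<theta> (br u y) = br u y" using that u(1) by (simp add: theta R.br_simps)
      then have "br z (br u y) = 0" by (rule z(4))
      then show ?thesis using R.br_derivation[of z u y] u(2) by (simp add: R.br_simps)
    qed
    then show ?thesis by (simp add: I_def)
  qed
  have k: "br v x \<in> I" if x: "x \<in> I" and v: "\<theta> v = v" for v x
  proof -
    have "br (br v x) (br z y) = 0" if y: "y \<in> ?p" for y
    proof -
      have "br v y \<in> ?p" using v y by (simp add: theta R.br_simps)
      then have "br x (br z (br v y)) = 0" "br x (br z y) = 0" using x y by (simp_all add: I_def)
      moreover have "br v (br z y) = br z (br v y)"
        using R.br_derivation[of v z y] z(4)[OF v] R.br_skew[of v z] by (simp add: R.br_simps)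
      ultimately show ?thesis using R.br_derivation[of v x "br z y"] by (simp add: R.br_simps)
    qed
    then show ?thesis by (simp add: I_def)
  qed
  have p: "br v x \<in> I" if x: "x \<in> I" and v: "v \<in> ?p" for v x
  proof -
    \<comment> \<open>By \<open>ad_z_cube\<close>, \<open>u\<close> is the component of
      \<open>v\<close> killed by \<open>z\<close>; the other component \<open>- [z, [z, v]]\<close>
      lies in \<open>[z, p]\<close> and so commutes with \<open>x\<close>.\<close>
    define u where "u = v + br z (br z v)"
    have up: "u \<in> ?p" "br z u = 0" "br z v \<in> ?p"
      using v z(2) by (simp_all add: u_def theta theta_simps R.br_simps ad_z_cube)
    have u_p1: "br u (br z y) = 0" if "y \<in> ?p" for y using p0I[OF up(1,2)] that by (simp add: I_def)
    have "br (br u x) (br z y) = 0" if y: "y \<in> ?p" for y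
      using R.br_derivation[of u x "br z y"] u_p1[OF y] x y by (simp add: I_def R.br_simps)
    then have "br u x \<in> I" by (simp add: I_def)
    moreover have "br (br z (br z v)) x = 0"
      using x up(3) R.br_skew[of "br z (br z v)" x] by (simp add: I_def)
    ultimately show ?thesis using R.br_simps(1)[of v "br z (br z v)" x] by (simp add: u_def)
  qed
  have sub: "subspace I" by (auto simp: subspace_def I_def R.br_simps)
  have "lie_ideal (*\<^sub>R) br I"
  proof (rule lie_idealI[OF sub])
    fix v x assume x: "x \<in> I"
    let ?k = "(1/2) *\<^sub>R (v + \<theta> v)" and ?q = "(1/2) *\<^sub>R (v - \<theta> v)"
    have "br ?k x \<in> I" by (rule k[OF x]) (simp add: theta theta_simps add.commute)
    moreover have "br ?q x \<in> I" by (rule p[OF x]) (simp add: theta theta_simps algebra_simps)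
    moreover have "v = ?k + ?q" by (simp add: algebra_simps flip: scaleR_left_distrib)
    ultimately show "br v x \<in> I" using sub by (metis R.br_simps(1) subspace_add)
  qed
  moreover have "I \<noteq> UNIV"
  proof
    assume I: "I = UNIV"
    have "br z y = 0" if "y \<in> ?p" for y
      by (rule centre_trivial) (use I that in \<open>auto simp: I_def\<close>)
    moreover have "v = (1/2) *\<^sub>R (v + \<theta> v) + (1/2) *\<^sub>R (v - \<theta> v)" for v
      by (simp add: algebra_simps flip: scaleR_left_distrib)
    moreover have "br z ((1/2) *\<^sub>R (v + \<theta> v)) = 0" for v
      by (rule z(4)) (simp add: theta theta_simps add.commute)
    moreover have "(1/2) *\<^sub>R (v - \<theta> v) \<in> ?p" for v by (simp add: theta theta_simps algebra_simps)
    ultimately have "br z v = 0" for v by (metis R.br_simps(2) add.right_neutral)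
    then have "br v z = 0" for v using R.br_skew[of v z] by simp
    then show False using centre_trivial z_nonzero by blast
  qed
  ultimately have "I = {0}" using simple(1) by blast
  let ?q = "(1/2) *\<^sub>R (x - \<theta> x)"
  have "?q \<in> I"
  proof (rule p0I)
    have "br z (\<theta> x) = \<theta> (br z x)" by (simp add: theta z(2))
    then show "br z ?q = 0" using assms by (simp add: R.br_simps theta_simps)
  qed (simp add: theta theta_simps algebra_simps)
  then show ?thesis using \<open>I = {0}\<close> by simp
qed

lemma centralizer_Z0: "cb Z0 X = 0 \<longleftrightarrow> X \<in> k_complex \<theta>"
  using z_centralizer z(4) by (cases X) (auto simp: cb_Z0 k_complex_def plus_space_def zero_prod_def)

end

subsection \<open>Positive roots\<close>

context compactly_causal_data
begin

definition "Xe = (SOME X. X \<in> {0} \<times> t \<and> (\<forall>\<beta>\<in>lie_roots br t. Re (\<beta> X) \<noteq> 0) \<and>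
  P = {\<beta> \<in> lie_roots br t. Re (\<beta> X) > 0})"

lemma Xe: "Xe \<in> T" "fst Xe = 0" "\<beta> \<in> lie_roots br t \<Longrightarrow> Re (\<beta> Xe) \<noteq> 0"
  "\<beta> \<in> P \<longleftrightarrow> \<beta> \<in> lie_roots br t \<and> Re (\<beta> Xe) > 0"
proof -
  have "\<exists>X. X \<in> {0} \<times> t \<and> (\<forall>\<beta>\<in>lie_roots br t. Re (\<beta> X) \<noteq> 0) \<and> P = {\<beta> \<in> lie_roots br t. Re (\<beta> X) > 0}"
    using P_positive unfolding positive_system_def by blast
  from someI_ex[OF this, folded Xe_def]
  have *: "Xe \<in> {0} \<times> t" "\<forall>\<beta>\<in>lie_roots br t. Re (\<beta> Xe) \<noteq> 0" "P = {\<beta> \<in> lie_roots br t. Re (\<beta> Xe) > 0}"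
    by blast+
  from *(3) show "\<beta> \<in> P \<longleftrightarrow> \<beta> \<in> lie_roots br t \<and> Re (\<beta> Xe) > 0" by blast
  show "Xe \<in> T" "fst Xe = 0" "\<beta> \<in> lie_roots br t \<Longrightarrow> Re (\<beta> Xe) \<noteq> 0"
    using *(1,2) subspace_0[OF t_subspace] by auto
qed

lemma lie_rootI:
  assumes "\<beta> \<in> dual_space cscale T" "\<beta> \<noteq> (\<lambda>_. 0)" "X \<noteq> 0" "\<And>H. H \<in> T \<Longrightarrow> cb H X = cscale (\<beta> H) X"
  shows "\<beta> \<in> lie_roots br t"
proof -
  have "X \<in> root_space br t \<beta>" unfolding root_space_def using assms(4) by blast
  then show ?thesis unfolding lie_roots_def using assms(1-3) by blast
qed

lemma wt_root: "b \<in> BB \<Longrightarrow> wt b \<noteq> (\<lambda>_. 0) \<Longrightarrow> wt b \<in> lie_roots br t"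
  by (rule lie_rootI[OF wt_dual _ BB_nonzero wt])

end

text \<open>Roots of value 1 on \<open>Z0\<close> are positive and those of value -1 negative
  because the normalization of \<open>P\<close> identifies the positive non-compact roots with the
  roots of value 1. Regularity of \<open>Xe\<close> excludes nonzero weights whose real part
  vanishes there.\<close>

sublocale compactly_causal_data \<subseteq> W: weight_basis cscale "cbr br" "killing_form cscale (cbr br)" "t \<times> t" BB dl wt Z0 Xe
proof (intro weight_basis.intro weight_basis_axioms.intro)
  show "lie_algebra cscale cb" by (rule L.lie_algebra_axioms)
  show "0 < Re (wt b Xe)" if "b \<in> BB" "wt b Z0 = 1" for b
  proof -
    have "wt b \<noteq> (\<lambda>_. 0)" using that(2) by (metis zero_neq_one)
    then have "wt b \<in> {\<beta> \<in> lie_roots br t. \<beta> Z0 = 1}" using wt_root that by simp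
    then have "wt b \<in> P" unfolding P_noncompact[symmetric] by blast
    then show ?thesis by (simp add: Xe(4))
  qed
  show "Re (wt b Xe) < 0" if "b \<in> BB" "wt b Z0 = - 1" for b
  proof -
    have "wt b \<noteq> (\<lambda>_. 0)" using that(2) by (metis zero_neq_neg_one)
    then have r: "wt b \<in> lie_roots br t" using wt_root that by simp
    have "wt b \<notin> P"
    proof
      assume "wt b \<in> P"
      then have "wt b \<in> {\<beta> \<in> P. \<beta> Z0 \<noteq> 0}" using that(2) by simp
      then have "wt b Z0 = 1" unfolding P_noncompact by simp
      then show False using that(2) by simp
    qed
    then show ?thesis using Xe(3)[OF r] r by (auto simp: Xe(4))
  qed
  show "wt b H = 0" if "b \<in> BB" "Re (wt b Xe) = 0" for b H
    using wt_root[OF that(1)] Xe(3) that(2) by metis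
  show "finite BB" by (rule BB(4))
  show "KC x (y + z) = KC x y + KC x z" for x y z by (rule L.killing_simps(1))
  show "KC x (cscale c y) = c * KC x y" for x c y by (rule L.killing_simps(3))
  show "KC x y = KC y x" for x y by (rule L.killing_sym)
  show "KC (cb x y) z = KC x (cb y z)" for x y z by (rule L.killing_inv)
  show "(\<Sum>b\<in>BB. cscale (KC (dl b) x) b) = x" for x by (rule expand)
  show "KC (dl b) b' = (if b = b' then 1 else 0)" if "b \<in> BB" "b' \<in> BB" for b b' using that by (rule dual)
  show "cb H b = cscale (wt b H) b" if "H \<in> T" "b \<in> BB" for H b using that by (rule wt)
  show "Z0 \<in> T" "Xe \<in> T" by (rule Z0_T, rule Xe(1))
  show "x \<in> T" if "\<And>H. H \<in> T \<Longrightarrow> cb H x = 0" for x using that by (rule T_centralizer)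
  show "cb H H' = 0" if "H \<in> T" "H' \<in> T" for H H' using that by (rule T_abelian)
  show "wt b Z0 \<in> {- 1, 0, 1}" if "b \<in> BB" for b using that by (rule grading)
qed

section \<open>Roots as vectors of \<open>t\<close>\<close>

context compactly_causal_data
begin

lemma grade_0: "W.grade 0 = k_complex \<theta>"
  using centralizer_Z0 by (simp add: W.grade_def set_eq_iff)

lemma grade_1: "W.grade 1 = p_plus br Z0"
  by (simp add: W.grade_def p_plus_def)

text \<open>A nonzero root vector has a nonzero coefficient at some basis vector, which then has the
  same weight.\<close>

lemma lie_rootE:
  assumes "\<beta> \<in> lie_roots br t" obtains b where "b \<in> BB" "wt b = \<beta>"
proof -
  obtain x where x: "x \<noteq> 0" "x \<in> root_space br t \<beta>" and \<beta>: "\<beta> \<in> dual_space cscale T"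
    using assms C.subspace_0 by (auto simp: lie_roots_def root_space_def L.br_simps)
  have "\<exists>b\<in>BB. KC (dl b) x \<noteq> 0"
  proof (rule ccontr)
    assume "\<not> (\<exists>b\<in>BB. KC (dl b) x \<noteq> 0)"
    then have "(\<Sum>b\<in>BB. cscale (KC (dl b) x) b) = 0" by (intro sum.neutral) simp
    then show False using x(1) expand by simp
  qed
  then obtain b where b: "b \<in> BB" "KC (dl b) x \<noteq> 0" by blast
  have "wt b H = \<beta> H" for H
  proof (cases "H \<in> T")
    case True
    then show ?thesis using W.coeff_weight[OF True b(1) _ b(2), of "\<beta> H"] x(2) unfolding root_space_def by blast
  next
    case False
    then show ?thesis using \<beta> wt_dual[OF b(1)] by (simp only: dual_space_def mem_Collect_eq) metis
  qed
  then show thesis using that b(1) by blast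
qed

lemma dl_nonzero: "b \<in> BB \<Longrightarrow> dl b \<noteq> 0"
  using W.dual[of b b] W.form_simps(6) by (metis zero_neq_one)

lemma neg_root: "b \<in> BB \<Longrightarrow> wt b \<noteq> (\<lambda>_. 0) \<Longrightarrow> (\<lambda>H. - wt b H) \<in> lie_roots br t"
proof (rule lie_rootI)
  assume b: "b \<in> BB" "wt b \<noteq> (\<lambda>_. 0)"
  show "(\<lambda>H. - wt b H) \<in> dual_space cscale T"
    using wt_dual[OF b(1)] by (auto simp: dual_space_def)
  show "(\<lambda>H. - wt b H) \<noteq> (\<lambda>_. 0)" using b(2) by (metis neg_equal_0_iff_equal ext)
  show "dl b \<noteq> 0" using dl_nonzero b(1) .
  show "cb H (dl b) = cscale (- wt b H) (dl b)" if "H \<in> T" for H using W.wt_dl[OF that b(1)] .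
qed

lemma wt_add: "b \<in> BB \<Longrightarrow> x \<in> T \<Longrightarrow> y \<in> T \<Longrightarrow> wt b (x + y) = wt b x + wt b y"
  and wt_scale: "b \<in> BB \<Longrightarrow> x \<in> T \<Longrightarrow> wt b (cscale c x) = c * wt b x"
  and wt_off: "b \<in> BB \<Longrightarrow> x \<notin> T \<Longrightarrow> wt b x = 0"
  using wt_dual[of b] unfolding dual_space_def by blast+

lemma zero_t: "0 \<in> t" using t_subspace by (rule subspace_0)

text \<open>\<open>h b\<close> represents the weight of \<open>b\<close> for the Killing form. It
  turns out to lie in \<open>i t\<close>, and \<open>u b\<close> is the vector of \<open>t\<close>
  that represents the weight for \<open>ip\<close>.\<close>

definition "h b = cb b (dl b)"
definition "u b = snd (h b)"

lemma h_T: "b \<in> BB \<Longrightarrow> h b \<in> T"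
  using W.br_dl_in_T by (simp add: h_def)

lemma KC_h: "b \<in> BB \<Longrightarrow> H \<in> T \<Longrightarrow> KC (h b) H = wt b H"
proof -
  assume b: "b \<in> BB" "H \<in> T"
  have "KC (h b) H = KC b (- cb H (dl b))" using L.br_skew[of "dl b" H] by (simp add: h_def W.form_inv)
  also have "\<dots> = wt b H * KC (dl b) b" by (simp add: W.wt_dl b W.form_simps W.form_sym)
  finally show ?thesis using b by (simp add: dual)
qed

text \<open>\<open>cb (y, 0)\<close> is skew for the inner product \<open>sp\<close>, so its
  eigenvalues are imaginary; multiplication by \<open>\<i>\<close> makes them real on
  \<open>i t\<close>.\<close>

lemma wt_real:
  assumes "b \<in> BB" "y \<in> t" shows "Re (wt b (y, 0)) = 0" "Im (wt b (0, y)) = 0"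
proof -
  have T: "(y, 0) \<in> T" "(0, y) \<in> T" using assms(2) zero_t by auto
  have re: "sp (cscale c b) b = Re c * sp b b" for c
    by (simp add: sp_def cscale_def ip_simps ip_sym[of "snd b" "fst b"] algebra_simps)
  have "sp (cb (y, 0) b) b = sp b (cb (- y, 0) b)" using sp_ad[OF T(1), of b b] by simp
  also have "cb (- y, 0) b = - cb (y, 0) b" by (simp add: cbr_def R.br_simps)
  also have "sp b (- cb (y, 0) b) = - sp (cb (y, 0) b) b" by (simp add: sp_def ip_simps ip_sym)
  finally have "Re (wt b (y, 0)) * sp b b = 0" by (simp add: wt[OF T(1) assms(1)] re)
  then show *: "Re (wt b (y, 0)) = 0" using sp_pos[OF BB_nonzero[OF assms(1)]] by simp
  have "(0, y) = cscale \<i> (y, 0)" by (simp add: cscale_def)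
  then have "wt b (0, y) = \<i> * wt b (y, 0)" using wt_scale[OF assms(1) T(1)] by metis
  then show "Im (wt b (0, y)) = 0" using * by simp
qed

lemma ip_t: "y \<in> t \<Longrightarrow> ip x y = - K x y"
  by (simp add: ip_def t_theta)

lemma KC_imag: "y \<in> t \<Longrightarrow> KC (0, x) (0, y) = of_real (ip x y)" "y \<in> t \<Longrightarrow> KC (0, x) (y, 0) = - \<i> * of_real (ip x y)"
  by (simp_all add: KC_eq K_simps ip_t complex_eq_iff)

text \<open>Pairing \<open>h b\<close> with \<open>(0, fst (h b))\<close> is a value of the weight
  on \<open>i t\<close>, hence real, while its imaginary part is minus the square length of
  \<open>fst (h b)\<close>.\<close>

lemma h_u: assumes "b \<in> BB" shows "h b = (0, u b)" "u b \<in> t"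
proof -
  have T: "fst (h b) \<in> t" "snd (h b) \<in> t" using h_T[OF assms] by auto
  have "Im (KC (h b) (0, fst (h b))) = 0"
    using KC_h[OF assms, of "(0, fst (h b))"] wt_real(2)[OF assms T(1)] T zero_t by simp
  then have "ip (fst (h b)) (fst (h b)) = 0" using T by (simp add: KC_eq K_simps ip_t)
  then have "fst (h b) = 0" using ip_pos by force
  then show "h b = (0, u b)" "u b \<in> t" using T by (simp_all add: u_def prod_eq_iff)
qed

lemma wt_u: "b \<in> BB \<Longrightarrow> y \<in> t \<Longrightarrow> wt b (0, y) = of_real (ip (u b) y)"
  using KC_h[of b "(0, y)"] h_u[of b] zero_t by (simp add: KC_imag)

subsection \<open>The subspace \<open>a\<close> and functionals on it\<close>

definition "a0 = {w \<in> t. \<tau> w = - w}"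

lemma a_eq: "a = {0} \<times> a0" and t_decomp: "y \<in> t \<Longrightarrow> \<exists>v w. v \<in> t \<and> \<tau> v = v \<and> w \<in> a0 \<and> y = v + w"
proof -
  have a: "subspace a" "a \<subseteq> {0} \<times> (minus_space \<tau> \<inter> plus_space \<theta>)"
    using a_maximal by (simp_all add: maximal_abelian_in_def Let_def)
  have aform: "\<exists>w. x = (0, w) \<and> w \<in> a0" if "x \<in> a" for x
  proof -
    have "x \<in> {0} \<times> (minus_space \<tau> \<inter> plus_space \<theta>)" using a(2) that by blast
    then obtain w where w: "x = (0, w)" "\<tau> w = - w" by (auto simp: minus_space_def)
    have "(0, 0) + cscale \<i> x \<in> {x + cscale \<i> y | x y. x \<in> (t \<inter> plus_space \<tau>) \<times> {0} \<and> y \<in> a}"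
      by (intro CollectI exI[of _ "(0, 0)"] exI[of _ x])
        (use that zero_t in \<open>simp add: plus_space_def tau_simps\<close>)
    then have "(0, 0) + cscale \<i> x \<in> t \<times> {0}" unfolding t_split .
    then have "- w \<in> t" by (simp add: w cscale_def)
    then have "w \<in> t" using subspace_neg[OF t_subspace, of "- w"] by simp
    then show ?thesis using w by (simp add: a0_def)
  qed
  have dec: "\<exists>v w. v \<in> t \<and> \<tau> v = v \<and> w \<in> a0 \<and> (0, w) \<in> a \<and> y = v + w" if "y \<in> t" for y
  proof -
    have "(y, 0) \<in> t \<times> {0}" using that by simp
    then have "(y, 0) \<in> {x + cscale \<i> y | x y. x \<in> (t \<inter> plus_space \<tau>) \<times> {0} \<and> y \<in> a}"
      by (rule subsetD[OF equalityD1[OF t_split]])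
    then obtain v' x where "(y, 0) = v' + cscale \<i> x" "v' \<in> (t \<inter> plus_space \<tau>) \<times> {0}" "x \<in> a"
      by blast
    then obtain v where v: "(y, 0) = (v, 0) + cscale \<i> x" "v \<in> t" "\<tau> v = v" "x \<in> a"
      by (auto simp: plus_space_def)
    obtain w where w: "x = (0, w)" "w \<in> a0" using aform[OF v(4)] by blast
    have "(0, - w) \<in> a" using subspace_neg[OF a(1) v(4)] w by simp
    moreover have "y = v + - w" using v(1) by (simp add: w cscale_def)
    moreover have "- w \<in> a0" using w(2) subspace_neg[OF t_subspace] by (simp add: a0_def tau_simps)
    ultimately show ?thesis using v by blast
  qed
  then show "y \<in> t \<Longrightarrow> \<exists>v w. v \<in> t \<and> \<tau> v = v \<and> w \<in> a0 \<and> y = v + w" by blast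
  have "(0, y) \<in> a" if y: "y \<in> a0" for y
  proof -
    obtain v w where vw: "\<tau> v = v" "w \<in> a0" "(0, w) \<in> a" "y = v + w"
      using dec[of y] y by (auto simp: a0_def)
    have "- (v + w) = v + - w" using y vw by (simp add: a0_def tau_simps)
    then have "- v = v" by simp
    then have "v + v = 0" by (metis left_minus)
    then have "v = 0" by (simp flip: scaleR_2)
    then show ?thesis using vw by simp
  qed
  then show "a = {0} \<times> a0" using aform by auto
qed

lemma a0_t: "w \<in> a0 \<Longrightarrow> w \<in> t" and a0_tau: "w \<in> a0 \<Longrightarrow> \<tau> w = - w"
  by (simp_all add: a0_def)

lemma a0_subspace: "subspace a0"
  using t_subspace by (auto simp: a0_def subspace_def tau_simps)

lemma tau_t: "y \<in> t \<Longrightarrow> \<tau> y \<in> t"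
proof -
  assume "y \<in> t"
  then obtain v w where "v \<in> t" "\<tau> v = v" "w \<in> a0" "y = v + w" using t_decomp by blast
  then show ?thesis using t_subspace by (simp add: tau_simps a0_tau a0_t subspace_diff)
qed

lemma ip_orth: "v \<in> t \<Longrightarrow> \<tau> v = v \<Longrightarrow> w \<in> a0 \<Longrightarrow> ip w v = 0"
  using K_tau[of w v] by (simp add: ip_t a0_tau K_simps)

lemma z_a0: "z \<in> a0" using z by (simp add: a0_def)

lemma Z0_a: "Z0 \<in> a"
  using z_a0 z(1) by (auto simp: a_eq z_def mem_Times_iff)

lemma a0_riesz:
  assumes "f \<in> dual_space (*\<^sub>R) a"
  shows "\<exists>r\<in>a0. \<forall>w\<in>a0. ip r w = f (0, w)"
proof -
  obtain D where D: "D \<subseteq> a0" "independent D" "a0 \<subseteq> span D" using basis_exists[of a0] by metis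
  have fin: "finite D" using real_vector.independent_span_bound[OF Bas(3) D(2)] Bas(2) by auto
  have sp: "span D = a0" using D a0_subspace by (metis span_minimal subset_antisym)
  have fa: "f (0, x + y) = f (0, x) + f (0, y)" if "x \<in> a0" "y \<in> a0" for x y
  proof -
    have "\<forall>x\<in>a. \<forall>y\<in>a. f (x + y) = f x + f y" using assms unfolding dual_space_def by blast
    from this[rule_format, of "(0, x)" "(0, y)"] show ?thesis using that by (simp add: a_eq)
  qed
  have fs: "f (0, c *\<^sub>R x) = c * f (0, x)" if "x \<in> a0" for c x
  proof -
    have "\<forall>c. \<forall>x\<in>a. f (c *\<^sub>R x) = c * f x" using assms unfolding dual_space_def by blast
    from this[rule_format, of "(0, x)" c] show ?thesis using that by (simp add: a_eq)
  qed
  have "\<exists>y\<in>span D. \<forall>u\<in>span D. ip y u = f (0, u)"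
  proof (rule positive_definite_riesz[OF fin])
    show "ip x y = ip y x" for x y by (rule ip_sym)
  qed (use sp fa fs in \<open>simp_all add: ip_simps ip_pos\<close>)
  then show ?thesis by (simp add: sp)
qed

text \<open>The same vector \<open>r\<close> represents a functional on \<open>a\<close> and its
  extension, because \<open>a0\<close> is orthogonal to the \<tau>-fixed part of \<open>t\<close>.
  The extension is unique since these two parts span \<open>T\<close> over the complex numbers, and
  the representing vector is unique since \<open>ip\<close> is definite.\<close>

lemma ext_eq:
  assumes f: "f \<in> dual_space (*\<^sub>R) a" and r: "r \<in> a0" "\<And>w. w \<in> a0 \<Longrightarrow> ip r w = f (0, w)"
  shows "extend_functional \<tau> t a f = (\<lambda>H. if H \<in> T then KC (0, r) H else 0)"
    and "riesz KC T (extend_functional \<tau> t a f) = (0, r)"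
proof -
  define E where "E = (\<lambda>H. if H \<in> T then KC (0, r) H else 0)"
  have E: "E x = KC (0, r) x" if "x \<in> T" for x unfolding E_def using that by (rule if_P)
  have E0: "E x = 0" if "x \<notin> T" for x unfolding E_def using that by (rule if_not_P)
  let ?C = "\<lambda>\<mu>. \<mu> \<in> dual_space cscale T \<and> (\<forall>H\<in>a. \<mu> H = complex_of_real (f H)) \<and>
       (\<forall>H \<in> (t \<inter> plus_space \<tau>) \<times> {0}. \<mu> H = 0)"
  have rt: "r \<in> t" using r(1) a0_t by blast
  have "E (x + y) = E x + E y" if "x \<in> T" "y \<in> T" for x y
    using C.subspace_add[OF T_subspace that] that by (simp only: E W.form_simps)
  moreover have "E (cscale c x) = c * E x" if "x \<in> T" for c x
    using C.subspace_scale[OF T_subspace that] that by (simp only: E W.form_simps)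
  moreover have "E x = 0" if "x \<notin> T" for x using that by (rule E0)
  ultimately have ed: "E \<in> dual_space cscale T" unfolding dual_space_def by blast
  have "E H = complex_of_real (f H)" if "H \<in> a" for H
    using that r(2) zero_t by (auto simp: a_eq E KC_imag a0_t)
  moreover have "E H = 0" if "H \<in> (t \<inter> plus_space \<tau>) \<times> {0}" for H
    using that zero_t ip_orth[OF _ _ r(1)] by (auto simp: E KC_imag plus_space_def)
  ultimately have ex: "?C E" using ed by blast
  have un: "\<mu> = E" if C: "?C \<mu>" for \<mu>
  proof
    fix H
    show "\<mu> H = E H"
    proof (cases "H \<in> T")
      case True
      then obtain v1 w1 v2 w2 where H: "H = (v1 + w1, v2 + w2)" "v1 \<in> t" "\<tau> v1 = v1" "w1 \<in> a0"
        "v2 \<in> t" "\<tau> v2 = v2" "w2 \<in> a0"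
        using t_decomp[of "fst H"] t_decomp[of "snd H"] by (metis mem_Times_iff prod.collapse)
      have dec: "H = ((v1, 0) + cscale \<i> (v2, 0)) + ((0, w2) + cscale (- \<i>) (0, w1))"
        by (simp add: H cscale_def)
      have mem: "(v1, 0) \<in> T" "(v2, 0) \<in> T" "(0, w1) \<in> T" "(0, w2) \<in> T"
        using H zero_t a0_t by auto
      have val: "\<nu> H = \<nu> (v1, 0) + \<i> * \<nu> (v2, 0) + (\<nu> (0, w2) + - \<i> * \<nu> (0, w1))"
        if "\<nu> \<in> dual_space cscale T" for \<nu>
      proof -
        have add: "\<And>x y. x \<in> T \<Longrightarrow> y \<in> T \<Longrightarrow> \<nu> (x + y) = \<nu> x + \<nu> y"
          and sc: "\<And>c x. x \<in> T \<Longrightarrow> \<nu> (cscale c x) = c * \<nu> x"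
          using that unfolding dual_space_def by blast+
        note m = C.subspace_add[OF T_subspace] C.subspace_scale[OF T_subspace] mem
        show ?thesis by (subst dec) (simp only: add sc m)
      qed
      have "\<mu> (v1, 0) = E (v1, 0) \<and> \<mu> (v2, 0) = E (v2, 0) \<and> \<mu> (0, w1) = E (0, w1) \<and> \<mu> (0, w2) = E (0, w2)"
      proof -
        have "(v1, 0) \<in> (t \<inter> plus_space \<tau>) \<times> {0}" "(v2, 0) \<in> (t \<inter> plus_space \<tau>) \<times> {0}" "(0, w1) \<in> a" "(0, w2) \<in> a"
          using H by (auto simp: plus_space_def a_eq)
        then show ?thesis using C ex by metis
      qed
      then show ?thesis using val[OF ed] val[OF conjunct1[OF C]] by simp
    next
      case False
      moreover have "\<forall>x. x \<notin> T \<longrightarrow> \<mu> x = 0" using C unfolding dual_space_def by blast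
      ultimately show ?thesis using E0 False by metis
    qed
  qed
  have e: "extend_functional \<tau> t a f = E"
    unfolding extend_functional_def by (rule the_equality, fact ex, rule un, assumption)
  then show "extend_functional \<tau> t a f = (\<lambda>H. if H \<in> T then KC (0, r) H else 0)" by (simp only: E_def)
  show "riesz KC T (extend_functional \<tau> t a f) = (0, r)"
    unfolding e riesz_def
  proof (rule the_equality)
    show "(0, r) \<in> T \<and> (\<forall>y\<in>T. KC (0, r) y = E y)" using rt zero_t by (simp add: E)
    fix x assume x: "x \<in> T \<and> (\<forall>y\<in>T. KC x y = E y)"
    define d where "d = x + - (0, r)"
    have dT: "d \<in> T" unfolding d_def using x rt zero_t C.subspace_add[OF T_subspace, of x "- (0, r)"]
        C.subspace_neg[OF T_subspace, of "(0, r)"] by simp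
    have d0: "KC d y = 0" if "y \<in> T" for y using x that by (simp only: d_def W.form_simps) (simp add: E)
    have m: "(fst d, 0) \<in> T" "(snd d, 0) \<in> T" using dT zero_t by auto
    have "K (fst d) (fst d) = 0" "K (snd d) (snd d) = 0"
      using d0[OF m(1)] d0[OF m(2)] by (simp_all add: KC_eq K_simps complex_eq_iff)
    then have "ip (fst d) (fst d) = 0" "ip (snd d) (snd d) = 0" using dT by (auto simp: ip_t mem_Times_iff)
    then have "fst d = 0" "snd d = 0" using ip_pos by force+
    then show "x = (0, r)" by (simp add: d_def prod_eq_iff)
  qed
qed

lemma a_inner_eq:
  assumes f: "f \<in> dual_space (*\<^sub>R) a" and r: "r \<in> a0" "\<And>w. w \<in> a0 \<Longrightarrow> ip r w = f (0, w)"
    and g: "g \<in> dual_space (*\<^sub>R) a"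
  shows "a_inner br \<tau> t a f g = g (0, r)"
proof -
  obtain s where s: "s \<in> a0" "\<And>w. w \<in> a0 \<Longrightarrow> ip s w = g (0, w)" using a0_riesz[OF g] by blast
  have "a_inner br \<tau> t a f g = Re (KC (0, r) (0, s))"
    using ext_eq(2)[OF f r] ext_eq(2)[OF g s] by (simp only: a_inner_def weight_form_def dual_form_def)
  then show ?thesis using s r(1) by (simp add: KC_imag a0_t ip_sym[of r])
qed

end

subsection \<open>Multiplicities\<close>

context compactly_causal_data
begin

lemma eigenspace_dim:
  assumes "S \<subseteq> T"
  shows "C.dim {X. \<forall>H\<in>S. cb H X = cscale (f H) X} = card {b \<in> BB. \<forall>H\<in>S. wt b H = f H}"
    and "C.subspace {X. \<forall>H\<in>S. cb H X = cscale (f H) X}"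
proof -
  let ?V = "{X. \<forall>H\<in>S. cb H X = cscale (f H) X}" and ?D = "{b \<in> BB. \<forall>H\<in>S. wt b H = f H}"
  show sub: "C.subspace ?V"
    by (rule C.subspaceI) (auto simp: L.br_simps C.scale_right_distrib C.scale_left_commute)
  have 1: "?V \<subseteq> C.span ?D"
  proof
    fix X assume X: "X \<in> ?V"
    have "cscale (KC (dl b) X) b \<in> C.span ?D" if b: "b \<in> BB" for b
    proof (cases "KC (dl b) X = 0")
      case False
      have "wt b H = f H" if "H \<in> S" for H
        using W.coeff_weight[OF _ b _ False] X assms that by blast
      then show ?thesis using b by (intro C.span_scale C.span_base) simp
    qed (simp add: C.span_zero)
    then have "(\<Sum>b\<in>BB. cscale (KC (dl b) X) b) \<in> C.span ?D" by (rule C.span_sum)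
    then show "X \<in> C.span ?D" by (simp only: expand)
  qed
  have 2: "?D \<subseteq> ?V" using wt assms by auto
  have "C.independent ?D" using BB(2) by (rule C.independent_mono) blast
  from C.basis_card_eq_dim[OF 2 1 this] show "C.dim ?V = card ?D" by simp
qed

text \<open>The conjugation of the complexification whose real form is \<open>\<g>\<^sup>c\<close>,
  that is the +1 part of \<tau> plus \<open>\<i>\<close> times its -1 part.\<close>

definition "sig X = (\<tau> (fst X), - \<tau> (snd X))"

lemma sig: "antilinear_involution sig"
  by unfold_locales (simp_all add: sig_def cscale_def tau_simps tau prod_eq_iff algebra_simps)

sublocale S: antilinear_involution sig by (rule sig)

lemma sig_br: "sig (cb X Y) = cb (sig X) (sig Y)"
  by (simp add: sig_def cbr_def tau_simps tau R.br_simps)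

lemma sig_T: "H \<in> T \<Longrightarrow> sig H \<in> T"
  using tau_t subspace_neg[OF t_subspace] by (simp add: sig_def mem_Times_iff)

lemma T_scale_neg_i: "cscale (- \<i>) (0, y) = (y, 0)"
  by (simp add: cscale_def)

lemma wt_split: "b \<in> BB \<Longrightarrow> x \<in> t \<Longrightarrow> y \<in> t \<Longrightarrow>
  wt b (x, y) = - \<i> * of_real (ip (u b) x) + of_real (ip (u b) y)"
  using wt_add[of b "(x, 0)" "(0, y)"] wt_scale[of b "(0, x)" "- \<i>", unfolded T_scale_neg_i] zero_t
  by (simp add: wt_u)

abbreviation "res \<equiv> restrict_functional a"

lemma res_wt: "b \<in> BB \<Longrightarrow> w \<in> a0 \<Longrightarrow> res (wt b) (0, w) = ip (u b) w"
  by (simp add: restrict_functional_def a_eq wt_u a0_t)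

lemma wt_a: "b \<in> BB \<Longrightarrow> H \<in> a \<Longrightarrow> wt b H = of_real (res (wt b) H)"
  by (auto simp: restrict_functional_def a_eq wt_u a0_t)

lemma a_T: "a \<subseteq> T" using a0_t zero_t by (auto simp: a_eq)

text \<open>The restricted root space is the set of \<open>sig\<close>-fixed points of a complex
  joint eigenspace of \<open>a\<close>, whose dimension is the number of basis vectors with that
  restricted weight.\<close>

lemma mult_dim:
  assumes "b0 \<in> BB"
  shows "dim (restricted_root_space br \<tau> a (res (wt b0))) = card {b \<in> BB. res (wt b) = res (wt b0)}"
proof -
  let ?\<alpha> = "res (wt b0)"
  let ?V = "{X. \<forall>H\<in>a. cb H X = cscale (of_real (?\<alpha> H)) X}"
  have sa: "sig H = H" if "H \<in> a" for H using that by (auto simp: a_eq sig_def a0_tau tau_simps)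
  have "sig ` ?V \<subseteq> ?V"
  proof (intro image_subsetI CollectI ballI)
    fix X H assume X: "X \<in> ?V" and H: "H \<in> a"
    have "cb H (sig X) = sig (cb H X)" by (simp only: sig_br sa[OF H])
    also have "\<dots> = cscale (of_real (?\<alpha> H)) (sig X)" using X H by (simp add: S.sig_scale)
    finally show "cb H (sig X) = cscale (of_real (?\<alpha> H)) (sig X)" .
  qed
  then have "dim {X \<in> ?V. sig X = X} = C.dim ?V"
    by (rule S.dim_fixed[OF L.basis(3,2) eigenspace_dim(2)[OF a_T]])
  moreover have "restricted_root_space br \<tau> a ?\<alpha> = {X \<in> ?V. sig X = X}"
    by (auto simp: restricted_root_space_def sig_def plus_space_def minus_space_def cscale_real prod_eq_iff
        minus_equation_iff)
  moreover have "(\<forall>H\<in>a. wt b H = of_real (?\<alpha> H)) \<longleftrightarrow> res (wt b) = ?\<alpha>" if "b \<in> BB" for b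
    using wt_a[OF that] by (auto simp: fun_eq_iff restrict_functional_def)
  then have "{b \<in> BB. \<forall>H\<in>a. wt b H = of_real (?\<alpha> H)} = {b \<in> BB. res (wt b) = ?\<alpha>}" by blast
  ultimately show ?thesis using eigenspace_dim(1)[OF a_T, of "\<lambda>H. of_real (?\<alpha> H)"] by simp
qed

text \<open>Basis vectors stand for positive roots counted with multiplicity; those in
  \<open>pos0\<close> give the sum \<open>2\<rho>\<^sub>0\<close> of the overview.\<close>

definition "pos = {b \<in> BB. Re (wt b Xe) > 0}"
definition "pos0 = {b \<in> pos. res (wt b) = (\<lambda>_. 0)}"
definition "pos1 = {b \<in> pos. res (wt b) \<noteq> (\<lambda>_. 0)}"

lemma pos_iff: "b \<in> BB \<Longrightarrow> b \<in> pos \<longleftrightarrow> wt b \<in> P"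
proof -
  assume b: "b \<in> BB"
  have "wt b \<in> lie_roots br t" if "Re (wt b Xe) > 0"
  proof (rule wt_root[OF b])
    show "wt b \<noteq> (\<lambda>_. 0)" using that by (metis less_irrefl zero_complex.sel(1))
  qed
  then show ?thesis using b by (auto simp: pos_def Xe(4))
qed

lemma finite_pos: "finite pos" "finite pos0" "finite pos1"
  using BB(4) by (auto simp: pos_def pos0_def pos1_def)

lemma P_wt: "\<beta> \<in> P \<Longrightarrow> \<exists>b\<in>pos. wt b = \<beta>"
  using lie_rootE[of \<beta>] pos_iff by (metis Xe(4))

section \<open>The symmetry \<beta> \<mapsto> - \<tau>\<beta> of the roots\<close>

definition "\<iota> \<beta> = (\<lambda>H. - \<beta> (cmap \<tau> H))" for \<beta> :: "'g cplx \<Rightarrow> complex"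

lemma iota_iota: "\<iota> (\<iota> \<beta>) = \<beta>"
  by (simp add: \<iota>_def cmap_def tau)

lemma iota_a: "b \<in> BB \<Longrightarrow> w \<in> a0 \<Longrightarrow> \<iota> (wt b) (0, w) = wt b (0, w)"
proof -
  assume b: "b \<in> BB" "w \<in> a0"
  have "cmap \<tau> (0, w) = (0, - w)" using b by (simp add: cmap_def tau_simps a0_tau)
  then show ?thesis using b wt_u[of b w] wt_u[of b "- w"] subspace_neg[OF t_subspace]
    by (simp add: \<iota>_def a0_t ip_simps)
qed

text \<open>The alternative that the image vanishes on \<open>a\<close> is excluded, since
  \<open>\<iota>\<close> does not change the restriction to \<open>a\<close>.\<close>

lemma iota_P:
  assumes "b \<in> pos1" shows "\<iota> (wt b) \<in> wt ` pos1"
proof -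
  have b: "b \<in> BB" "res (wt b) \<noteq> (\<lambda>_. 0)" "b \<in> pos" using assms by (auto simp: pos1_def pos_def)
  then have bP: "wt b \<in> P" using pos_iff by blast
  have "\<exists>w\<in>a0. wt b (0, w) \<noteq> 0"
  proof (rule ccontr)
    assume "\<not> (\<exists>w\<in>a0. wt b (0, w) \<noteq> 0)"
    then have "res (wt b) = (\<lambda>_. 0)" by (auto simp: restrict_functional_def a_eq fun_eq_iff)
    then show False using b(2) by simp
  qed
  then obtain w where w: "w \<in> a0" "wt b (0, w) \<noteq> 0" by blast
  have "\<not> (\<forall>H\<in>a. \<iota> (wt b) H = 0)" using w iota_a[OF b(1)] by (auto simp: a_eq)
  moreover have "\<iota> (wt b) \<in> P \<union> {\<mu>. \<forall>H\<in>a. \<mu> H = 0}" unfolding \<iota>_def using P_tau bP by blast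
  ultimately have "\<iota> (wt b) \<in> P" by blast
  then obtain b' where b': "b' \<in> pos" "wt b' = \<iota> (wt b)" using P_wt by blast
  then have "wt b' (0, w) \<noteq> 0" using w iota_a[OF b(1)] by simp
  then have "ip (u b') w \<noteq> 0" using b'(1) w(1) by (simp add: pos_def wt_u a0_t)
  then have "res (wt b') (0, w) \<noteq> 0" using b'(1) w(1) by (simp add: pos_def res_wt)
  then have "b' \<in> pos1" using b'(1) by (auto simp: pos1_def)
  then show ?thesis using b'(2) by (metis imageI)
qed

text \<open>The antilinear \<open>sig\<close> conjugates eigenvalues, and roots are imaginary on
  \<open>t\<close> and real on \<open>i t\<close>; with the signs in the two components of
  \<open>sig\<close> this yields - \<beta> \<circ> \<tau>.\<close>

lemma root_space_iota:
  assumes b: "b \<in> BB" and X: "X \<in> root_space br t (wt b)"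
  shows "sig X \<in> root_space br t (\<iota> (wt b))"
proof -
  have "cb H (sig X) = cscale (\<iota> (wt b) H) (sig X)" if H: "H \<in> T" for H
  proof -
    obtain x y where xy: "H = (x, y)" "x \<in> t" "y \<in> t" using H by auto
    have "\<forall>H\<in>T. cb H X = cscale (wt b H) X" using X unfolding root_space_def by (rule CollectD)
    then have "cb (sig H) X = cscale (wt b (sig H)) X" using sig_T[OF H] by (rule bspec)
    then have "sig (cb (sig H) X) = cscale (cnj (wt b (sig H))) (sig X)" by (simp add: S.sig_scale)
    moreover have "cnj (wt b (sig H)) = \<iota> (wt b) H"
      using tau_t[OF xy(2)] tau_t[OF xy(3)] subspace_neg[OF t_subspace]
      by (simp add: xy sig_def \<iota>_def cmap_def wt_split[OF b] ip_simps)
    ultimately show ?thesis by (simp only: sig_br S.sig_sig)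
  qed
  then show ?thesis unfolding root_space_def by blast
qed

text \<open>\<open>sig\<close> carries one root space onto the other. As \<open>\<iota>\<close> is
  an involution, using the inequality in both directions gives equal multiplicities.\<close>

lemma mult_iota_le:
  assumes "b \<in> BB" "b' \<in> BB" "wt b' = \<iota> (wt b)"
  shows "card {c \<in> BB. wt c = wt b'} \<le> card {c \<in> BB. wt c = wt b}"
proof -
  have card: "card {c \<in> BB. wt c = wt b} = C.dim (root_space br t (wt b))" if "b \<in> BB" for b
  proof -
    have "wt c = wt b" if "c \<in> BB" "\<forall>H\<in>T. wt c H = wt b H" for c
      using that(2) wt_off[OF that(1)] wt_off[OF \<open>b \<in> BB\<close>] by (metis ext)
    then have "{c \<in> BB. wt c = wt b} = {c \<in> BB. \<forall>H\<in>T. wt c H = wt b H}" by auto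
    then show ?thesis using eigenspace_dim(1)[OF subset_refl, of "wt b"] by (simp add: root_space_def)
  qed
  have sub: "C.subspace (root_space br t (wt b))"
    using eigenspace_dim(2)[OF subset_refl, of "wt b"] by (simp add: root_space_def)
  have "root_space br t (wt b') = sig ` root_space br t (wt b)"
  proof
    show "sig ` root_space br t (wt b) \<subseteq> root_space br t (wt b')"
      using root_space_iota[OF assms(1)] assms(3) by auto
    have "wt b = \<iota> (wt b')" by (simp add: assms(3) iota_iota)
    then have "sig X \<in> root_space br t (wt b)" if "X \<in> root_space br t (wt b')" for X
      using root_space_iota[OF assms(2) that] by simp
    then show "root_space br t (wt b') \<subseteq> sig ` root_space br t (wt b)" by (metis S.sig_sig image_eqI subsetI)
  qed
  then show ?thesis
    using S.dim_sig_le[OF L.basis(3,2) sub] unfolding card[OF assms(1)] card[OF assms(2)] by simp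
qed

text \<open>\<open>\<iota>\<close> permutes the positive roots that are nonzero on \<open>a\<close>,
  preserves multiplicities and changes the sign at \<tau>-fixed vectors, so the sum equals its own
  negative.\<close>

lemma sum_pos1_fixed:
  assumes v: "v \<in> t" "\<tau> v = v"
  shows "(\<Sum>b\<in>pos1. ip (u b) v) = 0"
proof -
  define m where "m \<beta> = real (card {c \<in> BB. wt c = \<beta>})" for \<beta>
  define g where "g \<beta> = Re (\<beta> (0, v))" for \<beta> :: "'g cplx \<Rightarrow> complex"
  have T: "(0, v) \<in> T" using v zero_t by simp
  have "(\<Sum>b\<in>pos1. ip (u b) v) = (\<Sum>b\<in>pos1. g (wt b))"
    by (rule sum.cong) (auto simp: g_def wt_u v pos1_def pos_def)
  \<comment> \<open>The terms are grouped by weight because \<open>\<iota>\<close> acts on weights,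
    not on basis vectors.\<close>
  also have "\<dots> = (\<Sum>\<beta>\<in>wt ` pos1. \<Sum>b\<in>{b \<in> pos1. wt b = \<beta>}. g (wt b))"
    by (rule sum.group[symmetric]) (use finite_pos in auto)
  also have "\<dots> = (\<Sum>\<beta>\<in>wt ` pos1. m \<beta> * g \<beta>)"
  proof (rule sum.cong[OF refl])
    fix \<beta> assume "\<beta> \<in> wt ` pos1"
    then have "{b \<in> pos1. wt b = \<beta>} = {b \<in> BB. wt b = \<beta>}" by (auto simp: pos1_def pos_def)
    then show "(\<Sum>b\<in>{b \<in> pos1. wt b = \<beta>}. g (wt b)) = m \<beta> * g \<beta>" by (simp add: m_def)
  qed
  finally have 1: "(\<Sum>b\<in>pos1. ip (u b) v) = (\<Sum>\<beta>\<in>wt ` pos1. m \<beta> * g \<beta>)" .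
  have "(\<Sum>\<beta>\<in>wt ` pos1. m \<beta> * g \<beta>) = (\<Sum>\<beta>\<in>wt ` pos1. - (m \<beta> * g \<beta>))"
  proof (rule sum.reindex_bij_witness[where i = \<iota> and j = \<iota>])
    fix \<beta> assume "\<beta> \<in> wt ` pos1"
    then obtain b where b: "b \<in> pos1" "\<beta> = wt b" by blast
    then obtain b' where b': "b' \<in> pos1" "wt b' = \<iota> (wt b)" using iota_P by (metis imageE)
    have BBs: "b \<in> BB" "b' \<in> BB" using b b' by (auto simp: pos1_def pos_def)
    have "wt b = \<iota> (wt b')" by (simp add: b'(2) iota_iota)
    then have "m (wt b') = m (wt b)"
      using mult_iota_le[OF BBs b'(2)] mult_iota_le[OF BBs(2,1)] by (simp add: m_def)
    moreover have "g (\<iota> \<beta>) = - g \<beta>" by (simp add: g_def \<iota>_def cmap_def v tau_simps)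
    ultimately show "- (m (\<iota> \<beta>) * g (\<iota> \<beta>)) = m \<beta> * g \<beta>" using b b' by simp
  qed (use iota_P in \<open>auto simp: iota_iota\<close>)
  then show ?thesis using 1 by (simp add: sum_negf)
qed

text \<open>Test both weights on \<open>x - \<tau> x\<close>, an element of \<open>a0\<close>, where
  \<open>Xe = (0, x)\<close>. By the compatibility of \<open>P\<close> with - \<tau>, weights
  nonzero on \<open>a\<close> do not take opposite signs at \<open>x\<close> and
  \<open>- \<tau> x\<close>, so a positive and a negative one differ on \<open>a\<close>. Hence all
  weights above a positive restricted root are positive.\<close>

lemma res_positive:
  assumes b: "b \<in> pos" "b' \<in> BB" and eq: "res (wt b) = res (wt b')" and nz: "res (wt b) \<noteq> (\<lambda>_. 0)"
  shows "b' \<in> pos"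
proof (rule ccontr)
  assume "b' \<notin> pos"
  obtain x where x: "Xe = (0, x)" "x \<in> t" using Xe(1,2) by (metis mem_Times_iff prod.collapse)
  have bB: "b \<in> BB" using b(1) by (simp add: pos_def)
  have diff: "x - \<tau> x \<in> a0" using x(2) tau_t t_subspace by (simp add: a0_def subspace_diff tau_simps tau)
  have eqip: "ip (u b) w = ip (u b') w" if "w \<in> a0" for w
    using eq that res_wt[OF bB that] res_wt[OF b(2) that] by simp
  have nz': "wt b' \<noteq> (\<lambda>_. 0)"
    using eq nz by (auto simp: restrict_functional_def)
  have rb': "wt b' \<in> lie_roots br t" by (rule wt_root[OF b(2) nz'])
  then have "wt b' \<notin> P" using \<open>b' \<notin> pos\<close> pos_iff[OF b(2)] by simp
  then have neg: "Re (wt b' Xe) < 0" using Xe(3)[OF rb'] rb' by (auto simp: Xe(4))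
  then have "(\<lambda>H. - wt b' H) \<in> P" using neg_root[OF b(2) nz'] by (simp add: Xe(4))
  then have "(\<lambda>H. - (- wt b' (cmap \<tau> H))) \<in> P \<union> {\<mu>. \<forall>H\<in>a. \<mu> H = 0}"
    by (rule bspec[OF P_tau])
  moreover have "\<not> (\<forall>H\<in>a. - (- wt b' (cmap \<tau> H)) = 0)"
  proof
    assume *: "\<forall>H\<in>a. - (- wt b' (cmap \<tau> H)) = 0"
    have "wt b' (0, w) = 0" if "w \<in> a0" for w
      using iota_a[OF b(2) that] *[rule_format, of "(0, w)"] that by (simp add: \<iota>_def a_eq)
    then have "res (wt b') = (\<lambda>_. 0)" by (auto simp: restrict_functional_def a_eq fun_eq_iff)
    then show False using eq nz by simp
  qed
  ultimately have "(\<lambda>H. - (- wt b' (cmap \<tau> H))) \<in> P" by blast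
  then have "Re (wt b' (cmap \<tau> Xe)) > 0" by (simp add: Xe(4))
  then have 1: "ip (u b') (\<tau> x) > 0" "ip (u b') x < 0"
    using neg x b(2) tau_t by (simp_all add: cmap_def tau_simps wt_u)
  have 2: "ip (u b) x > 0" using b(1) x bB by (simp add: pos_def wt_u)
  have "ip (u b) (\<tau> x) \<le> 0"
  proof (cases "b \<in> pos1")
    case True
    then obtain b2 where "b2 \<in> pos1" "wt b2 = \<iota> (wt b)" using iota_P by (metis imageE)
    then have "Re (\<iota> (wt b) Xe) > 0" by (metis (no_types, lifting) mem_Collect_eq pos1_def pos_def)
    then show ?thesis using x bB tau_t by (simp add: \<iota>_def cmap_def tau_simps wt_u)
  qed (use b(1) nz in \<open>simp add: pos1_def\<close>)
  then have "ip (u b) (x - \<tau> x) > 0" using 2 by (simp add: ip_simps)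
  moreover have "ip (u b') (x - \<tau> x) < 0" using 1 by (simp add: ip_simps)
  ultimately show False using eqip[OF diff] by simp
qed

lemma restricted_positive_eq: "restricted_positive a P = (\<lambda>b. res (wt b)) ` pos1"
proof -
  have "\<alpha> \<in> res ` P \<longleftrightarrow> (\<exists>b\<in>pos. \<alpha> = res (wt b))" for \<alpha>
  proof
    assume "\<alpha> \<in> res ` P"
    then show "\<exists>b\<in>pos. \<alpha> = res (wt b)" using P_wt by blast
  next
    assume "\<exists>b\<in>pos. \<alpha> = res (wt b)"
    then obtain b where b: "b \<in> pos" "\<alpha> = res (wt b)" by blast
    then have "b \<in> BB" by (simp add: pos_def)
    then show "\<alpha> \<in> res ` P" using b pos_iff by blast
  qed
  then have "restricted_positive a P = {\<alpha>. \<exists>b\<in>pos. \<alpha> = res (wt b)} - {\<lambda>_. 0}"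
    unfolding restricted_positive_def by blast
  then show ?thesis unfolding pos1_def by auto
qed

text \<open>The multiplicity of a restricted root counts the basis vectors above it, all of which
  lie in \<open>pos1\<close>; the vectors in \<open>pos0\<close> contribute zero on
  \<open>a0\<close>.\<close>

lemma rho_eq:
  assumes w: "w \<in> a0"
  shows "2 * rho br \<tau> a P (0, w) = (\<Sum>b\<in>pos. ip (u b) w)"
proof -
  let ?R = "\<lambda>b. res (wt b)"
  have "2 * rho br \<tau> a P (0, w)
      = (\<Sum>\<alpha>\<in>?R ` pos1. real (dim (restricted_root_space br \<tau> a \<alpha>)) * \<alpha> (0, w))"
    by (simp add: rho_def restricted_positive_eq)
  also have "\<dots> = (\<Sum>\<alpha>\<in>?R ` pos1. \<Sum>b\<in>{b \<in> pos1. ?R b = \<alpha>}. ?R b (0, w))"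
  proof (rule sum.cong[OF refl])
    fix \<alpha> assume "\<alpha> \<in> ?R ` pos1"
    then obtain b0 where b0: "b0 \<in> pos1" "\<alpha> = ?R b0" by blast
    then have b0': "b0 \<in> pos" "b0 \<in> BB" "?R b0 \<noteq> (\<lambda>_. 0)" by (auto simp: pos1_def pos_def)
    have "{b \<in> BB. ?R b = \<alpha>} = {b \<in> pos1. ?R b = \<alpha>}"
      using res_positive[OF b0'(1) _ _ b0'(3)] b0'(3) b0(2) by (auto simp: pos1_def pos_def)
    then show "real (dim (restricted_root_space br \<tau> a \<alpha>)) * \<alpha> (0, w) = (\<Sum>b\<in>{b \<in> pos1. ?R b = \<alpha>}. ?R b (0, w))"
      using mult_dim[OF b0'(2)] b0(2) by simp
  qed
  also have "\<dots> = (\<Sum>b\<in>pos1. ?R b (0, w))" by (rule sum.group) (use finite_pos in auto)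
  also have "\<dots> = (\<Sum>b\<in>pos. ?R b (0, w))"
    by (rule sum.mono_neutral_left) (use finite_pos in \<open>auto simp: pos1_def\<close>)
  also have "\<dots> = (\<Sum>b\<in>pos. ip (u b) w)" by (rule sum.cong) (auto simp: pos_def res_wt w)
  finally show ?thesis .
qed

lemma res_dual: "b \<in> BB \<Longrightarrow> res (wt b) \<in> dual_space (*\<^sub>R) a"
proof -
  assume b: "b \<in> BB"
  have "subspace a" using a_maximal by (simp add: maximal_abelian_in_def Let_def)
  moreover have "res (wt b) (x + y) = res (wt b) x + res (wt b) y" if "x \<in> a" "y \<in> a" for x y
    using that subspace_add[OF \<open>subspace a\<close> that] wt_add[OF b subsetD[OF a_T that(1)] subsetD[OF a_T that(2)]] by (auto simp: restrict_functional_def)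
  moreover have "res (wt b) (c *\<^sub>R x) = c * res (wt b) x" if "x \<in> a" for c x
    using that subspace_scale[OF \<open>subspace a\<close> that, of c] wt_scale[OF b subsetD[OF a_T that], of "of_real c"]
    by (auto simp: restrict_functional_def cscale_real)
  moreover have "res (wt b) x = 0" if "x \<notin> a" for x using that by (simp add: restrict_functional_def)
  ultimately show ?thesis unfolding dual_space_def by blast
qed

lemma dual_space_combine:
  fixes F :: "('g cplx \<Rightarrow> real) set"
  shows "f \<in> dual_space (*\<^sub>R) a \<Longrightarrow> g \<in> dual_space (*\<^sub>R) a \<Longrightarrow> (\<lambda>H. f H + g H) \<in> dual_space (*\<^sub>R) a"
    and "F \<subseteq> dual_space (*\<^sub>R) a \<Longrightarrow> (\<lambda>H. c * (\<Sum>\<alpha>\<in>F. m \<alpha> * \<alpha> H)) \<in> dual_space (*\<^sub>R) a"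
proof -
  show "f \<in> dual_space (*\<^sub>R) a \<Longrightarrow> g \<in> dual_space (*\<^sub>R) a \<Longrightarrow> (\<lambda>H. f H + g H) \<in> dual_space (*\<^sub>R) a"
    by (auto simp: dual_space_def algebra_simps)
  assume F: "F \<subseteq> dual_space (*\<^sub>R) a"
  have 1: "\<alpha> (x + y) = \<alpha> x + \<alpha> y" if "\<alpha> \<in> F" "x \<in> a" "y \<in> a" for \<alpha> x y
    using F that unfolding dual_space_def by blast
  have 2: "\<alpha> (k *\<^sub>R x) = k * \<alpha> x" if "\<alpha> \<in> F" "x \<in> a" for \<alpha> k x
    using F that unfolding dual_space_def by blast
  have 3: "\<alpha> x = 0" if "\<alpha> \<in> F" "x \<notin> a" for \<alpha> x using F that unfolding dual_space_def by blast
  show "(\<lambda>H. c * (\<Sum>\<alpha>\<in>F. m \<alpha> * \<alpha> H)) \<in> dual_space (*\<^sub>R) a"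
    unfolding dual_space_def
  proof (intro CollectI conjI ballI allI impI)
    show "c * (\<Sum>\<alpha>\<in>F. m \<alpha> * \<alpha> (x + y)) = c * (\<Sum>\<alpha>\<in>F. m \<alpha> * \<alpha> x) + c * (\<Sum>\<alpha>\<in>F. m \<alpha> * \<alpha> y)"
      if "x \<in> a" "y \<in> a" for x y
      using that by (simp add: 1 distrib_left sum.distrib)
    show "c * (\<Sum>\<alpha>\<in>F. m \<alpha> * \<alpha> (k *\<^sub>R x)) = k * (c * (\<Sum>\<alpha>\<in>F. m \<alpha> * \<alpha> x))" if "x \<in> a" for k x
      using that by (simp add: 2 sum_distrib_left mult_ac)
    show "c * (\<Sum>\<alpha>\<in>F. m \<alpha> * \<alpha> x) = 0" if "x \<notin> a" for x using that by (simp add: 3)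
  qed
qed

lemma rho_dual: "rho br \<tau> a P \<in> dual_space (*\<^sub>R) a"
  unfolding rho_def restricted_positive_eq
  by (rule dual_space_combine(2)) (use res_dual in \<open>auto simp: pos1_def pos_def\<close>)

subsection \<open>The inequality\<close>

text \<open>The formula of \<open>cas\<close>, restated here because it depends on the root data
  alone.\<close>

definition "casimir \<mu> = (\<Sum>b\<in>{b \<in> BB. Re (wt b Xe) = 0}. \<mu> b * \<mu> (dl b)) +
  (\<Sum>b\<in>{b \<in> BB. Re (wt b Xe) > 0}. \<mu> (cb b (dl b)))"

text \<open>Since \<open>(0, r)\<close> lies in \<open>T\<close>, its expansion involves only basis
  vectors of weight zero, and the first sum collapses to the pairing of \<open>(0, r)\<close> with
  itself.\<close>

lemma casimir_eq:
  assumes "r \<in> t" "\<And>H. H \<in> T \<Longrightarrow> \<mu> H = KC (0, r) H"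
  shows "casimir \<mu> = of_real (ip r r + (\<Sum>b\<in>pos. ip r (u b)))"
proof -
  let ?R = "(0, r)" and ?Z = "{b \<in> BB. Re (wt b Xe) = 0}"
  have RT: "?R \<in> T" using assms(1) zero_t by simp
  have R: "?R = (\<Sum>b\<in>?Z. cscale (KC (dl b) ?R) b)"
  proof -
    have "KC (dl b) ?R = 0" if "b \<in> BB - ?Z" for b
    proof (rule ccontr)
      assume "KC (dl b) ?R \<noteq> 0"
      moreover have "cb Xe ?R = cscale 0 ?R" using T_abelian[OF Xe(1) RT] by simp
      ultimately have "wt b Xe = 0" using W.coeff_weight[OF Xe(1)] that by blast
      then show False using that by simp
    qed
    then have "(\<Sum>b\<in>?Z. cscale (KC (dl b) ?R) b) = (\<Sum>b\<in>BB. cscale (KC (dl b) ?R) b)"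
      using BB(4) by (intro sum.mono_neutral_left) auto
    then show ?thesis by (simp only: expand)
  qed
  have "(\<Sum>b\<in>?Z. \<mu> b * \<mu> (dl b)) = (\<Sum>b\<in>?Z. KC (dl b) ?R * KC ?R b)"
    using W.weight_zero_in_T by (intro sum.cong) (auto simp: assms(2) W.form_sym mult.commute)
  also have "\<dots> = KC ?R (\<Sum>b\<in>?Z. cscale (KC (dl b) ?R) b)" by (simp add: W.form_simps)
  also have "\<dots> = of_real (ip r r)" using assms(1) by (simp only: R[symmetric] KC_imag)
  finally have 1: "(\<Sum>b\<in>?Z. \<mu> b * \<mu> (dl b)) = of_real (ip r r)" .
  have "(\<Sum>b\<in>{b \<in> BB. Re (wt b Xe) > 0}. \<mu> (cb b (dl b))) = (\<Sum>b\<in>pos. of_real (ip r (u b)))"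
    unfolding pos_def
  proof (rule sum.cong[OF refl])
    fix b assume "b \<in> {b \<in> BB. Re (wt b Xe) > 0}"
    then have b: "b \<in> BB" by simp
    then show "\<mu> (cb b (dl b)) = of_real (ip r (u b))"
      using assms(2)[OF h_T[OF b]] h_u[OF b] by (simp add: KC_imag flip: h_def)
  qed
  then show ?thesis using 1 by (simp add: casimir_def)
qed

text \<open>Everything is transported to the Euclidean space \<open>t\<close>: \<open>l\<close>,
  \<open>p\<close>, \<open>v\<close>, \<open>n\<close>, \<open>r\<close> represent \<lambda>,
  \<rho>, - Q, \<nu> and \<lambda> + \<rho>. Equality of the Casimir eigenvalues then says that a
  positive term and two nonnegative ones add up to zero.\<close>

lemma no_singular_weight:
  assumes lam: "lam \<in> dual_space (*\<^sub>R) a"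
    and neg: "\<forall>\<alpha> \<in> restricted_noncompact_positive Z0 a P.
           a_inner br \<tau> t a (\<lambda>H. lam H + rho br \<tau> a P H) \<alpha> < 0"
    and ys: "ys \<noteq> []" "set ys \<subseteq> {b \<in> BB. wt b Z0 = -1}"
  defines "\<Lambda> \<equiv> extend_functional \<tau> t a lam"
  defines "\<nu> \<equiv> (\<lambda>H. \<Lambda> H + (\<Sum>y\<leftarrow>ys. wt y H))"
  assumes cas: "casimir \<nu> = casimir \<Lambda>"
    and dom: "\<And>b. b \<in> BB \<Longrightarrow> wt b Z0 = 0 \<Longrightarrow> Re (wt b Xe) > 0 \<Longrightarrow>
      \<exists>n::nat. 2 * \<nu> (cb b (dl b)) = of_nat n * wt b (cb b (dl b))"
  shows False
proof -
  obtain l where l: "l \<in> a0" "\<And>w. w \<in> a0 \<Longrightarrow> ip l w = lam (0, w)" using a0_riesz[OF lam] by blast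
  obtain p where p: "p \<in> a0" "\<And>w. w \<in> a0 \<Longrightarrow> ip p w = rho br \<tau> a P (0, w)" using a0_riesz[OF rho_dual] by blast
  define v where "v = (\<Sum>y\<leftarrow>ys. u y)"
  have yB: "y \<in> BB" "wt y Z0 = -1" if "y \<in> set ys" for y using ys(2) that by auto
  have sum_t: "(\<Sum>y\<leftarrow>zs. u y) \<in> t \<and> (\<forall>H\<in>T. (\<Sum>y\<leftarrow>zs. wt y H) = KC (0, \<Sum>y\<leftarrow>zs. u y) H)
      \<and> (\<forall>x. ip x (\<Sum>y\<leftarrow>zs. u y) = (\<Sum>y\<leftarrow>zs. ip x (u y)))"
    if "set zs \<subseteq> set ys" for zs
    using that
  proof (induction zs)
    case Nil
    show ?case using zero_t by (simp add: KC_eq K_simps complex_eq_iff ip_simps)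
  next
    case (Cons y zs)
    then have y: "y \<in> BB" using yB by simp
    have "KC (0, u y + (\<Sum>y\<leftarrow>zs. u y)) H = KC (0, u y) H + KC (0, \<Sum>y\<leftarrow>zs. u y) H" for H
      by (simp add: KC_eq K_simps complex_eq_iff)
    then show ?case using Cons KC_h[OF y] h_u[OF y] t_subspace by (simp add: subspace_add ip_simps)
  qed
  note v = sum_t[OF subset_refl, folded v_def]
  have Lam: "\<Lambda> H = KC (0, l) H" if "H \<in> T" for H
    using fun_cong[OF ext_eq(1)[OF lam l], of H] that by (simp only: \<Lambda>_def if_True)
  define n where "n = l + v"
  have lt: "l \<in> t" using l(1) a0_t by blast
  have nt: "n \<in> t" using v lt t_subspace by (simp add: n_def subspace_add)
  have nu: "\<nu> H = KC (0, n) H" if "H \<in> T" for H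
  proof -
    have "(\<Sum>y\<leftarrow>ys. wt y H) = KC (0, v) H" using v that by blast
    then show ?thesis using Lam[OF that] by (simp add: \<nu>_def n_def KC_eq K_simps complex_eq_iff)
  qed
  have "ip n n + (\<Sum>b\<in>pos. ip n (u b)) = ip l l + (\<Sum>b\<in>pos. ip l (u b))"
  proof -
    have "casimir \<nu> = of_real (ip n n + (\<Sum>b\<in>pos. ip n (u b)))" by (rule casimir_eq[OF nt nu])
    moreover have "casimir \<Lambda> = of_real (ip l l + (\<Sum>b\<in>pos. ip l (u b)))" by (rule casimir_eq[OF lt Lam])
    ultimately show ?thesis using cas by (simp only: of_real_eq_iff)
  qed
  moreover have "ip v l = ip l v" "ip v (u b) = ip (u b) v" for b by (rule ip_sym)+
  ultimately have eq: "2 * ip l v + ip v v + (\<Sum>b\<in>pos. ip (u b) v) = 0"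
    by (simp add: n_def ip_simps sum.distrib)
  \<comment> \<open>The sum of all positive roots is \<open>2 * p\<close> plus the sum over
    \<open>pos0\<close>: on \<open>a0\<close> the latter vanishes, while on the \<tau>-fixed part of
    \<open>t\<close> the roots in \<open>pos1\<close> cancel and \<open>p\<close> is
    orthogonal.\<close>
  have D: "(\<Sum>b\<in>pos. ip (u b) y) = 2 * ip p y + (\<Sum>b\<in>pos0. ip (u b) y)" if "y \<in> t" for y
  proof -
    obtain x w where xw: "x \<in> t" "\<tau> x = x" "w \<in> a0" "y = x + w" using t_decomp[OF \<open>y \<in> t\<close>] by blast
    have "(\<Sum>b\<in>pos. ip (u b) x) = (\<Sum>b\<in>pos0. ip (u b) x) + (\<Sum>b\<in>pos1. ip (u b) x)"
      using finite_pos by (subst sum.union_disjoint[symmetric]) (auto simp: pos0_def pos1_def intro: sum.cong)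
    moreover have "(\<Sum>b\<in>pos0. ip (u b) w) = 0"
      by (rule sum.neutral) (use xw(3) in \<open>auto simp: pos0_def pos_def simp flip: res_wt\<close>)
    ultimately show ?thesis
      using sum_pos1_fixed[OF xw(1,2)] rho_eq[OF xw(3)] p ip_orth[OF xw(1,2) p(1)] xw(3)
      by (simp add: xw(4) ip_simps sum.distrib)
  qed
  define r where "r = l + p"
  have r: "r \<in> a0" "\<And>w. w \<in> a0 \<Longrightarrow> ip r w = lam (0, w) + rho br \<tau> a P (0, w)"
    using l p a0_subspace by (simp_all add: r_def subspace_add ip_simps)
  \<comment> \<open>The negative of \<open>wt y\<close> is a positive non-compact root, and the
    hypothesis on \<lambda> + \<rho> applies to its restriction.\<close>
  have ypos: "ip r (u y) > 0" if "y \<in> set ys" for y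
  proof -
    note y = yB[OF that]
    have nz: "wt y \<noteq> (\<lambda>_. 0)" using y(2) by (metis zero_neq_neg_one)
    have "(\<lambda>H. - wt y H) \<in> {\<beta> \<in> P. \<beta> Z0 \<noteq> 0}"
      unfolding P_noncompact using neg_root[OF y(1) nz] y(2) by simp
    then have yP: "(\<lambda>H. - wt y H) \<in> P" by simp
    define \<alpha> where "\<alpha> = res (\<lambda>H. - wt y H)"
    have aZ: "\<alpha> Z0 = 1" using Z0_a y(2) by (simp add: \<alpha>_def restrict_functional_def)
    then have "\<alpha> \<noteq> (\<lambda>_. 0)" by (metis zero_neq_one)
    moreover have "\<alpha> \<in> res ` P" unfolding \<alpha>_def using yP by (rule imageI)
    ultimately have mem: "\<alpha> \<in> restricted_noncompact_positive Z0 a P"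
      using aZ by (simp add: restricted_noncompact_positive_def restricted_positive_def)
    then obtain b where "b \<in> pos1" "\<alpha> = res (wt b)"
      by (auto simp: restricted_noncompact_positive_def restricted_positive_eq)
    then have "\<alpha> \<in> dual_space (*\<^sub>R) a" using res_dual by (simp add: pos1_def pos_def)
    then have "a_inner br \<tau> t a (\<lambda>H. lam H + rho br \<tau> a P H) \<alpha> = \<alpha> (0, r)"
      by (intro a_inner_eq dual_space_combine lam rho_dual r)
    also have "\<dots> = - ip (u y) r"
      using r(1) y(1) by (simp add: \<alpha>_def restrict_functional_def a_eq wt_u a0_t)
    finally show ?thesis using neg mem by (auto simp: ip_sym)
  qed
  have "ip r v > 0"
  proof -
    have "ip r v = (\<Sum>y\<leftarrow>ys. ip r (u y))" using v by simp
    moreover have "(\<Sum>y\<leftarrow>zs. ip r (u y)) > 0" if "set zs \<subseteq> set ys" "zs \<noteq> []" for zs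
      using that by (induction zs rule: induct_list012) (auto simp: ypos add_pos_pos)
    ultimately show ?thesis using ys(1) by simp
  qed
  \<comment> \<open>These roots vanish on \<open>a\<close>, hence at \<open>Z0\<close>; so they are
    compact, \<nu> is dominant for them, and \<open>l\<close> is orthogonal to them.\<close>
  moreover have "(\<Sum>b\<in>pos0. ip (u b) v) \<ge> 0"
  proof (rule sum_nonneg)
    fix b assume "b \<in> pos0"
    then have b: "b \<in> BB" "Re (wt b Xe) > 0" "res (wt b) = (\<lambda>_. 0)" by (auto simp: pos0_def pos_def)
    have "wt b Z0 = 0" using wt_a[OF b(1) Z0_a] b(3) by simp
    then obtain k :: nat where "2 * \<nu> (h b) = of_nat k * wt b (h b)" using dom[OF b(1) _ b(2)] by (auto simp: h_def)
    moreover have "\<nu> (h b) = of_real (ip n (u b))" using nu[OF h_T[OF b(1)]] h_u[OF b(1)] by (simp add: KC_imag)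
    moreover have "wt b (h b) = of_real (ip (u b) (u b))" using h_u[OF b(1)] wt_u[OF b(1)] by simp
    ultimately have "complex_of_real (2 * ip n (u b)) = of_real (real k * ip (u b) (u b))" by simp
    then have "2 * ip n (u b) = real k * ip (u b) (u b)" by (simp only: of_real_eq_iff)
    then have "ip n (u b) \<ge> 0" using ip_nonneg[of "u b"] by (metis mult_nonneg_nonneg of_nat_0_le_iff zero_le_mult_iff zero_less_numeral not_le)
    moreover have "ip (u b) l = 0" using res_wt[OF b(1) l(1)] b(3) by simp
    ultimately show "ip (u b) v \<ge> 0" by (simp add: n_def ip_simps ip_sym[of l "u b"] ip_sym[of v "u b"])
  qed
  ultimately have "2 * ip r v + ip v v + (\<Sum>b\<in>pos0. ip (u b) v) > 0" using ip_nonneg[of v] by simp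
  moreover have "ip r v = ip l v + ip p v" by (simp add: r_def ip_simps)
  ultimately show False using eq D[OF conjunct1[OF v]] by linarith
qed

end

section \<open>Enveloping algebras and their modules\<close>

text \<open>With concatenation as addition of words, the product of the free algebra is the convolution
  product of \<^typ>\<open>'v list \<Rightarrow>\<^sub>0 'k\<close>, which is already known to be a ring.\<close>

instantiation list :: (type) monoid_add
begin
definition "zero_list = []"
definition "plus_list = (@)"
instance by standard (simp_all add: zero_list_def plus_list_def)
end

section \<open>Arithmetic in the free algebra\<close>

abbreviation "sg \<equiv> Poly_Mapping.single"
abbreviation "lk \<equiv> Poly_Mapping.lookup"
abbreviation "ks \<equiv> Poly_Mapping.keys"

lemma pm_expand: "(\<Sum>k\<in>ks p. sg k (lk p k)) = p"
  by (rule poly_mapping_eqI) (simp add: lookup_sum lookup_single when_def in_keys_iff)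

lemma pm_induct [case_names single add]:
  assumes "\<And>k x. Q (sg k x)" "\<And>p q. Q p \<Longrightarrow> Q q \<Longrightarrow> Q (p + q)"
  shows "Q (p :: 'a \<Rightarrow>\<^sub>0 'b::comm_monoid_add)"
proof -
  have "Q (\<Sum>k\<in>F. sg k (lk p k))" if "finite F" for F
    using that
  proof (induction F rule: finite_induct)
    case empty show ?case using assms(1)[of undefined 0] by simp
  qed (use assms in simp)
  then show ?thesis using pm_expand[of p] by (metis finite_keys)
qed

lemma single_mult_single: "sg u x * sg v y = sg (u @ v) (x * y)"
  by (simp add: mult_single plus_list_def)

definition pm_ext :: "('a \<Rightarrow> 'b::zero \<Rightarrow> 'c::comm_monoid_add) \<Rightarrow> ('a \<Rightarrow>\<^sub>0 'b) \<Rightarrow> 'c"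
  where "pm_ext h p = (\<Sum>k\<in>ks p. h k (lk p k))"

lemma pm_ext_single: "h k 0 = 0 \<Longrightarrow> pm_ext h (sg k x) = h k x"
  by (simp add: pm_ext_def)

lemma pm_ext_add:
  assumes "\<And>k. h k 0 = 0" "\<And>k x y. h k (x + y) = h k x + h k y"
  shows "pm_ext h (p + q) = pm_ext h p + pm_ext h q"
  unfolding pm_ext_def by (rule setsum_keys_plus_distrib) (simp_all add: assms)

lemma free_algebra_simps:
  "carrier (free_algebra S) = {a. ks a \<subseteq> lists S}" "\<one>\<^bsub>free_algebra S\<^esub> = sg [] 1" "\<zero>\<^bsub>free_algebra S\<^esub> = 0"
  "a \<oplus>\<^bsub>free_algebra S\<^esub> b = a + b" "a \<otimes>\<^bsub>free_algebra S\<^esub> b = a * b"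
proof -
  have "a * b = (\<Sum>u\<in>ks a. \<Sum>v\<in>ks b. sg (u @ v) (lk a u * lk b v))"
  proof -
    have "a * b = (\<Sum>u\<in>ks a. sg u (lk a u)) * (\<Sum>v\<in>ks b. sg v (lk b v))" by (simp only: pm_expand)
    then show ?thesis by (simp add: sum_product single_mult_single)
  qed
  then show "a \<otimes>\<^bsub>free_algebra S\<^esub> b = a * b" by (simp add: free_algebra_def)
qed (simp_all add: free_algebra_def)

lemma free_algebra_carrier:
  "w \<in> lists S \<Longrightarrow> sg w c \<in> carrier (free_algebra S)"
  "a \<in> carrier (free_algebra S) \<Longrightarrow> b \<in> carrier (free_algebra S) \<Longrightarrow> a + b \<in> carrier (free_algebra S)"
  "a \<in> carrier (free_algebra S) \<Longrightarrow> b \<in> carrier (free_algebra S) \<Longrightarrow> a * b \<in> carrier (free_algebra S)"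
  "a \<in> carrier (free_algebra S) \<Longrightarrow> - a \<in> carrier (free_algebra S)"
proof -
  show "a \<in> carrier (free_algebra S) \<Longrightarrow> b \<in> carrier (free_algebra S) \<Longrightarrow> a + b \<in> carrier (free_algebra S)"
    using Poly_Mapping.keys_add[of a b] by (auto simp: free_algebra_simps)
  show "a \<in> carrier (free_algebra S) \<Longrightarrow> b \<in> carrier (free_algebra S) \<Longrightarrow> a * b \<in> carrier (free_algebra S)"
    using keys_mult[of a b] by (force simp: free_algebra_simps plus_list_def)
  have "ks (- a) = ks a" by (auto simp: in_keys_iff)
  then show "a \<in> carrier (free_algebra S) \<Longrightarrow> - a \<in> carrier (free_algebra S)"
    by (simp add: free_algebra_simps)
qed (auto simp: free_algebra_simps)

lemma one_pm_list: "sg [] (1::'k::field) = 1"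
  unfolding zero_list_def[symmetric] by simp

lemma ring_free_algebra: "ring (free_algebra S :: ('v list \<Rightarrow>\<^sub>0 'k::field) ring)"
proof (rule ringI)
  show "abelian_group (free_algebra S :: ('v list \<Rightarrow>\<^sub>0 'k) ring)"
  proof (rule abelian_groupI)
    fix x assume "x \<in> carrier (free_algebra S :: ('v list \<Rightarrow>\<^sub>0 'k) ring)"
    then show "\<exists>y\<in>carrier (free_algebra S). y \<oplus>\<^bsub>free_algebra S\<^esub> x = \<zero>\<^bsub>free_algebra S\<^esub>"
      by (intro bexI[of _ "- x"]) (simp_all add: free_algebra_simps(3-5) free_algebra_carrier)
  qed (simp_all add: free_algebra_simps(3-5) free_algebra_carrier add_ac, simp add: free_algebra_simps)
  have "1 \<in> carrier (free_algebra S :: ('v list \<Rightarrow>\<^sub>0 'k) ring)"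
    using free_algebra_carrier(1)[of "[]" S "1::'k"] by (simp add: one_pm_list)
  then show "Group.monoid (free_algebra S :: ('v list \<Rightarrow>\<^sub>0 'k) ring)"
    by (intro monoidI)
      (simp_all add: free_algebra_simps(2-5) free_algebra_carrier one_pm_list mult.assoc)
qed (simp_all add: free_algebra_simps(2-5) algebra_simps)

lemma free_algebra_minus:
  assumes "a \<in> carrier (free_algebra S)" "b \<in> carrier (free_algebra S)"
  shows "a - b \<in> carrier (free_algebra S)"
  using free_algebra_carrier(2)[OF assms(1) free_algebra_carrier(4)[OF assms(2)]] by simp

lemma ideal_free_algebraI:
  fixes J :: "('v list \<Rightarrow>\<^sub>0 'k::field) set"
  assumes sub: "J \<subseteq> carrier (free_algebra S)"
    and "0 \<in> J" "\<And>x y. x \<in> J \<Longrightarrow> y \<in> J \<Longrightarrow> x + y \<in> J" "\<And>x. x \<in> J \<Longrightarrow> - x \<in> J"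
    and "\<And>x y. x \<in> J \<Longrightarrow> y \<in> carrier (free_algebra S) \<Longrightarrow> y * x \<in> J"
    and "\<And>x y. x \<in> J \<Longrightarrow> y \<in> carrier (free_algebra S) \<Longrightarrow> x * y \<in> J"
  shows "ideal J (free_algebra S)"
proof (rule idealI[OF ring_free_algebra])
  let ?G = "add_monoid (free_algebra S :: ('v list \<Rightarrow>\<^sub>0 'k) ring)"
  have G: "Group.group ?G"
    by (rule abelian_group.a_group[OF ring.is_abelian_group[OF ring_free_algebra]])
  show "subgroup J ?G"
  proof (rule group.subgroupI[OF G])
    fix x assume x: "x \<in> J"
    have "inv\<^bsub>?G\<^esub> x = - x"
      by (rule group.inv_equality[OF G])
        (use x sub in \<open>auto simp: free_algebra_simps(3,4) free_algebra_carrier\<close>)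
    then show "inv\<^bsub>?G\<^esub> x \<in> J" using x assms(4) by simp
  qed (use assms in \<open>auto simp: free_algebra_simps(4)\<close>)
qed (use assms in \<open>simp_all add: free_algebra_simps(5)\<close>)

section \<open>The enveloping algebra of a subalgebra\<close>

definition env_relations :: "('k::field \<Rightarrow> 'v::ab_group_add \<Rightarrow> 'v) \<Rightarrow> ('v \<Rightarrow> 'v \<Rightarrow> 'v) \<Rightarrow> 'v set \<Rightarrow> ('v list \<Rightarrow>\<^sub>0 'k) set"
  where "env_relations sc br S =
    {sg [x + y] 1 - sg [x] 1 - sg [y] 1 | x y. x \<in> S \<and> y \<in> S} \<union>
    {sg [sc c x] 1 - sg [x] c | c x. x \<in> S} \<union>
    {sg [x, y] 1 - sg [y, x] 1 - sg [br x y] 1 | x y. x \<in> S \<and> y \<in> S}"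

locale subalgebra = lie_algebra sc br for sc :: "'k::field \<Rightarrow> 'v::ab_group_add \<Rightarrow> 'v" and br +
  fixes S :: "'v set"
  assumes S_subspace: "subspace S" and S_br: "x \<in> S \<Longrightarrow> y \<in> S \<Longrightarrow> br x y \<in> S"
begin

abbreviation "A \<equiv> free_algebra S :: ('v list \<Rightarrow>\<^sub>0 'k) ring"
abbreviation "I \<equiv> enveloping_ideal sc br S"
abbreviation "U \<equiv> enveloping_algebra sc br S"
abbreviation "cls x \<equiv> I +>\<^bsub>A\<^esub> x"

lemma relations_carrier: "env_relations sc br S \<subseteq> carrier A"
  unfolding env_relations_def using S_br subspace_add[OF S_subspace] subspace_scale[OF S_subspace]
  by (auto intro!: free_algebra_minus free_algebra_carrier)

lemma I_eq: "I = genideal A (env_relations sc br S)"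
  by (simp add: enveloping_ideal_def env_relations_def)

lemma ideal_I: "ideal I A"
  unfolding I_eq using ring.genideal_ideal[OF ring_free_algebra relations_carrier] .

lemma relations_I: "env_relations sc br S \<subseteq> I"
  unfolding I_eq using ring.genideal_self[OF ring_free_algebra relations_carrier] .

lemma I_minimal: "ideal J A \<Longrightarrow> env_relations sc br S \<subseteq> J \<Longrightarrow> I \<subseteq> J"
  unfolding I_eq by (rule ring.genideal_minimal[OF ring_free_algebra])

lemma I_simps:
  "x \<in> I \<Longrightarrow> x \<in> carrier A" "0 \<in> I" "x \<in> I \<Longrightarrow> y \<in> I \<Longrightarrow> x + y \<in> I" "x \<in> I \<Longrightarrow> - x \<in> I"
  "x \<in> I \<Longrightarrow> y \<in> carrier A \<Longrightarrow> x * y \<in> I" "x \<in> I \<Longrightarrow> y \<in> carrier A \<Longrightarrow> y * x \<in> I"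
proof -
  interpret ideal I A by (rule ideal_I)
  show c: "x \<in> I \<Longrightarrow> x \<in> carrier A" by (rule Icarr)
  show "0 \<in> I" using additive_subgroup.zero_closed[OF ideal.axioms(1)[OF ideal_I]] by (simp add: free_algebra_simps)
  show "x \<in> I \<Longrightarrow> y \<in> I \<Longrightarrow> x + y \<in> I" 
    using additive_subgroup.a_closed[OF ideal.axioms(1)[OF ideal_I]] by (simp add: free_algebra_simps)
  show "x \<in> I \<Longrightarrow> y \<in> carrier A \<Longrightarrow> x * y \<in> I" "x \<in> I \<Longrightarrow> y \<in> carrier A \<Longrightarrow> y * x \<in> I"
    using I_r_closed[of x y] I_l_closed[of x y] by (simp_all add: free_algebra_simps(5))
  show "- x \<in> I" if "x \<in> I"
  proof -
    have "sg [] (-1) * x \<in> I" using I_l_closed[OF that free_algebra_carrier(1)[of "[]" S "-1"]]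
      by (simp add: free_algebra_simps(5))
    moreover have "sg [] (-1) = (- 1 :: 'v list \<Rightarrow>\<^sub>0 'k)" by (simp add: single_uminus one_pm_list)
    ultimately show ?thesis by simp
  qed
qed

lemma cls_eq: "cls x = (\<lambda>h. h + x) ` I"
  by (auto simp: a_r_coset_def' free_algebra_simps)

lemma cls_eq_iff: "x \<in> carrier A \<Longrightarrow> y \<in> carrier A \<Longrightarrow> cls x = cls y \<longleftrightarrow> x - y \<in> I"
proof
  assume "cls x = cls y"
  then have "0 + x \<in> (\<lambda>h. h + y) ` I" using I_simps(2) unfolding cls_eq by blast
  then show "x - y \<in> I" by auto
next
  assume *: "x - y \<in> I"
  have "h + x \<in> (\<lambda>h. h + y) ` I" if "h \<in> I" for h
    using I_simps(3)[OF that *] by (intro image_eqI[of _ _ "h + (x - y)"]) auto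
  moreover have "h + y \<in> (\<lambda>h. h + x) ` I" if "h \<in> I" for h
    using I_simps(3)[OF that I_simps(4)[OF *]] by (intro image_eqI[of _ _ "h + - (x - y)"]) auto
  ultimately show "cls x = cls y" unfolding cls_eq by (intro equalityI image_subsetI)
qed

lemma ring_U: "ring U"
  unfolding enveloping_algebra_def by (rule ideal.quotient_is_ring[OF ideal_I])

lemma cls_hom:
  assumes "x \<in> carrier A" "y \<in> carrier A"
  shows "cls x \<in> carrier U" "cls (x * y) = cls x \<otimes>\<^bsub>U\<^esub> cls y" "cls (x + y) = cls x \<oplus>\<^bsub>U\<^esub> cls y"
  using ring_hom_closed[OF ideal.rcos_ring_hom[OF ideal_I] assms(1)]
    ring_hom_mult[OF ideal.rcos_ring_hom[OF ideal_I] assms] ring_hom_add[OF ideal.rcos_ring_hom[OF ideal_I] assms]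
  by (simp_all only: enveloping_algebra_def free_algebra_simps)

lemma U_E: assumes "u \<in> carrier U" obtains x where "x \<in> carrier A" "u = cls x"
  using assms by (auto simp: enveloping_algebra_def FactRing_def A_RCOSETS_def')

lemma cls_relations:
  "x \<in> S \<Longrightarrow> y \<in> S \<Longrightarrow> sg [x + y] 1 - sg [x] 1 - sg [y] 1 \<in> I"
  "x \<in> S \<Longrightarrow> sg [sc c x] 1 - sg [x] c \<in> I"
  "x \<in> S \<Longrightarrow> y \<in> S \<Longrightarrow> sg [x, y] 1 - sg [y, x] 1 - sg [br x y] 1 \<in> I"
proof -
  show "sg [x + y] 1 - sg [x] 1 - sg [y] 1 \<in> I" if "x \<in> S" "y \<in> S"
    by (rule subsetD[OF relations_I], unfold env_relations_def, rule UnI1, rule UnI1)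
      (use that in blast)
  show "sg [sc c x] 1 - sg [x] c \<in> I" if "x \<in> S"
    by (rule subsetD[OF relations_I], unfold env_relations_def, rule UnI1, rule UnI2)
      (use that in blast)
  show "sg [x, y] 1 - sg [y, x] 1 - sg [br x y] 1 \<in> I" if "x \<in> S" "y \<in> S"
    by (rule subsetD[OF relations_I], unfold env_relations_def, rule UnI2)
      (use that in blast)
qed

end

text \<open>The module is a subspace \<open>V\<close> of a type, as the coinduced module consists of
  particular functions on words; for \<open>F\<close> it is \<open>UNIV\<close>.\<close>

locale subalgebra_module = subalgebra sc br S + M: vector_space sM
  for sc :: "'k::field \<Rightarrow> 'v::ab_group_add \<Rightarrow> 'v" and br S
    and sM :: "'k \<Rightarrow> 'm::ab_group_add \<Rightarrow> 'm" +
  fixes \<rho> :: "'v \<Rightarrow> 'm \<Rightarrow> 'm" and V :: "'m set"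
  assumes V_subspace: "M.subspace V"
    and rho_V: "x \<in> S \<Longrightarrow> v \<in> V \<Longrightarrow> \<rho> x v \<in> V"
    and rho_lin: "x \<in> S \<Longrightarrow> v \<in> V \<Longrightarrow> w \<in> V \<Longrightarrow> \<rho> x (v + w) = \<rho> x v + \<rho> x w"
      "x \<in> S \<Longrightarrow> v \<in> V \<Longrightarrow> \<rho> x (sM c v) = sM c (\<rho> x v)"
      "x \<in> S \<Longrightarrow> y \<in> S \<Longrightarrow> v \<in> V \<Longrightarrow> \<rho> (x + y) v = \<rho> x v + \<rho> y v"
      "x \<in> S \<Longrightarrow> v \<in> V \<Longrightarrow> \<rho> (sc c x) v = sM c (\<rho> x v)"
    and rho_br: "x \<in> S \<Longrightarrow> y \<in> S \<Longrightarrow> v \<in> V \<Longrightarrow> \<rho> (br x y) v = \<rho> x (\<rho> y v) - \<rho> y (\<rho> x v)"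
begin

lemma word_V: "w \<in> lists S \<Longrightarrow> v \<in> V \<Longrightarrow> foldr \<rho> w v \<in> V"
  by (induction w) (auto simp: rho_V)

lemma word_lin:
  "w \<in> lists S \<Longrightarrow> v \<in> V \<Longrightarrow> v' \<in> V \<Longrightarrow> foldr \<rho> w (v + v') = foldr \<rho> w v + foldr \<rho> w v'"
  "w \<in> lists S \<Longrightarrow> v \<in> V \<Longrightarrow> foldr \<rho> w (sM c v) = sM c (foldr \<rho> w v)"
  by (induction w) (auto simp: rho_lin word_V)

definition word_act :: "('v list \<Rightarrow>\<^sub>0 'k) \<Rightarrow> 'm \<Rightarrow> 'm"
  where "word_act x v = pm_ext (\<lambda>w c. sM c (foldr \<rho> w v)) x"

lemma word_act_simps:
  "word_act (sg w c) v = sM c (foldr \<rho> w v)" "word_act (x + y) v = word_act x v + word_act y v"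
  unfolding word_act_def by (simp_all add: pm_ext_single pm_ext_add M.scale_left_distrib)

lemma word_act_minus: "word_act (x - y) v = word_act x v - word_act y v"
  using word_act_simps(2)[of "x - y" y v] by (simp add: eq_diff_eq)

lemma word_act_zero: "word_act 0 v = 0"
  using word_act_simps(1)[of "[]" 0 v] by simp

lemma carrier_induct [consumes 1, case_names single add]:
  assumes "x \<in> carrier A" "\<And>w c. w \<in> lists S \<Longrightarrow> Q (sg w c)"
    "\<And>x y. x \<in> carrier A \<Longrightarrow> y \<in> carrier A \<Longrightarrow> Q x \<Longrightarrow> Q y \<Longrightarrow> Q (x + y)"
  shows "Q x"
proof -
  have "(\<Sum>k\<in>F. sg k (lk x k)) \<in> carrier A \<and> Q (\<Sum>k\<in>F. sg k (lk x k))" if "finite F" "F \<subseteq> lists S" for F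
    using that
  proof (induction F rule: finite_induct)
    case empty
    show ?case using assms(2)[of "[]" 0] free_algebra_carrier(1)[of "[]" S 0] by simp
  next
    case (insert k F)
    then have k: "k \<in> lists S" by simp
    have c: "sg k (lk x k) \<in> carrier A" using k by (rule free_algebra_carrier(1))
    show ?case
      using insert assms(3)[OF c _ assms(2)[OF k]] free_algebra_carrier(2)[OF c] by simp
  qed
  then show ?thesis using pm_expand[of x] assms(1) by (metis finite_keys free_algebra_simps(1) mem_Collect_eq)
qed

lemma word_act_V: "x \<in> carrier A \<Longrightarrow> v \<in> V \<Longrightarrow> word_act x v \<in> V"
  by (induction x rule: carrier_induct)
    (auto simp: word_act_simps intro!: M.subspace_add[OF V_subspace] M.subspace_scale[OF V_subspace] word_V)

lemma word_act_lin:
  "x \<in> carrier A \<Longrightarrow> v \<in> V \<Longrightarrow> v' \<in> V \<Longrightarrow> word_act x (v + v') = word_act x v + word_act x v'"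
  "x \<in> carrier A \<Longrightarrow> v \<in> V \<Longrightarrow> word_act x (sM c v) = sM c (word_act x v)"
  by (induction x rule: carrier_induct)
    (auto simp: word_act_simps word_lin M.scale_right_distrib M.scale_left_commute algebra_simps)

lemma word_act_mult:
  assumes "x \<in> carrier A" "y \<in> carrier A" "v \<in> V"
  shows "word_act (x * y) v = word_act x (word_act y v)"
  using assms(1)
proof (induction x rule: carrier_induct)
  case (single w c)
  show ?case using assms(2)
  proof (induction y rule: carrier_induct)
    case (single w' d)
    then show ?case using \<open>w \<in> lists S\<close> assms(3)
      by (simp add: single_mult_single word_act_simps word_lin word_V)
  next
    case (add y y')
    then show ?case
      using \<open>w \<in> lists S\<close> assms(3) word_act_lin(1)[of "sg w c" "word_act y v" "word_act y' v"]
      by (simp add: distrib_left word_act_simps(2) word_act_V free_algebra_carrier(1))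
  qed
qed (simp add: distrib_right word_act_simps)

text \<open>The annihilator of \<open>V\<close> is an ideal containing the defining relations, hence
  the ideal they generate.\<close>

lemma word_act_ideal:
  assumes "x \<in> I" "v \<in> V" shows "word_act x v = 0"
proof -
  let ?J = "{x \<in> carrier A. \<forall>v\<in>V. word_act x v = 0}"
  have z: "word_act y 0 = 0" if "y \<in> carrier A" for y
    using word_act_lin(2)[OF that M.subspace_0[OF V_subspace], of 0] by simp
  have "ideal ?J A"
  proof (rule ideal_free_algebraI)
    have "word_act (- x) v = - word_act x v" for x v
      using word_act_minus[of 0 x v] by (simp add: word_act_zero)
    then show "- x \<in> ?J" if "x \<in> ?J" for x using that by (simp add: free_algebra_carrier)
    show "0 \<in> ?J" using free_algebra_carrier(1)[of "[]" S 0] word_act_zero by auto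
  qed (use z in \<open>auto simp: free_algebra_carrier word_act_simps word_act_mult word_act_V\<close>)
  moreover have "env_relations sc br S \<subseteq> ?J"
  proof
    fix r assume r: "r \<in> env_relations sc br S"
    have "word_act r v = 0" if v: "v \<in> V" for v
      using r unfolding env_relations_def
      by (auto simp: word_act_minus word_act_simps rho_lin rho_br v rho_V)
    then show "r \<in> ?J" using relations_carrier r by blast
  qed
  ultimately show ?thesis using I_minimal assms by blast
qed

lemma enveloping_action_cls:
  assumes "x \<in> carrier A" "v \<in> V"
  shows "enveloping_action sM \<rho> (cls x) v = word_act x v"
proof -
  have "(\<lambda>x. \<Sum>w\<in>ks x. sM (lk x w) (foldr \<rho> w v)) ` cls x = {word_act x v}"
  proof -
    have "word_act (h + x) v = word_act x v" if "h \<in> I" for h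
      using word_act_ideal[OF that assms(2)] by (simp add: word_act_simps)
    then show ?thesis using I_simps(2) unfolding cls_eq word_act_def pm_ext_def by auto
  qed
  then show ?thesis by (simp add: enveloping_action_def)
qed

end

section \<open>Modules with only trivial submodules\<close>

text \<open>In a nonzero module whose only submodules are zero and the whole, zero is the only
  maximal submodule, which settles the definite choice; the zero module would have no maximal
  submodule at all.\<close>

lemma the_maximal_lsubmodule_trivial:
  assumes "Group.group N" "carrier N \<noteq> {\<one>\<^bsub>N\<^esub>}" "\<And>u. u \<in> R \<Longrightarrow> lact N u \<one>\<^bsub>N\<^esub> = \<one>\<^bsub>N\<^esub>"
    "\<And>J. lsubmodule R N J \<Longrightarrow> J = {\<one>\<^bsub>N\<^esub>} \<or> J = carrier N"
  shows "the_maximal_lsubmodule R N = {\<one>\<^bsub>N\<^esub>}"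
  unfolding the_maximal_lsubmodule_def
proof (rule the_equality)
  have "lsubmodule R N {\<one>\<^bsub>N\<^esub>}"
    using group.triv_subgroup[OF assms(1)] assms(3) by (simp add: lsubmodule_def)
  then show "maximal_lsubmodule R N {\<one>\<^bsub>N\<^esub>}"
    using assms(2,4) by (auto simp: maximal_lsubmodule_def)
  show "J = {\<one>\<^bsub>N\<^esub>}" if "maximal_lsubmodule R N J" for J
    using that assms(4) by (auto simp: maximal_lsubmodule_def)
qed

lemma trivial_quotient_iso:
  fixes N :: "('r, 'm) lmodule"
  assumes "Group.group N" "\<And>u x. u \<in> R \<Longrightarrow> x \<in> carrier N \<Longrightarrow> lact N u x \<in> carrier N"
  shows "(\<lambda>x. {\<one>\<^bsub>N\<^esub>} #>\<^bsub>N\<^esub> x) \<in> lmodule_iso R N (quotient_lmodule N {\<one>\<^bsub>N\<^esub>})"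
proof -
  interpret group N by fact
  let ?L = "quotient_lmodule N {\<one>\<^bsub>N\<^esub>}"
  have c: "{\<one>\<^bsub>N\<^esub>} #>\<^bsub>N\<^esub> x = {x}" if "x \<in> carrier N" for x using that by (simp add: r_coset_def)
  have L: "carrier ?L = (\<lambda>x. {x}) ` carrier N" "x \<otimes>\<^bsub>?L\<^esub> y = x <#>\<^bsub>N\<^esub> y" for x y
    by (auto simp: quotient_lmodule_def FactGroup_def RCOSETS_def c)
  have "bij_betw (\<lambda>x. {\<one>\<^bsub>N\<^esub>} #>\<^bsub>N\<^esub> x) (carrier N) (carrier ?L)"
    unfolding L bij_betw_def by (auto simp: inj_on_def c)
  moreover have "(\<lambda>x. {\<one>\<^bsub>N\<^esub>} #>\<^bsub>N\<^esub> x) \<in> hom N ?L"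
    by (auto simp: hom_def L c set_mult_def)
  moreover have "{\<one>\<^bsub>N\<^esub>} #>\<^bsub>N\<^esub> lact N u x = lact ?L u ({\<one>\<^bsub>N\<^esub>} #>\<^bsub>N\<^esub> x)" if "u \<in> R" "x \<in> carrier N" for u x
    using that by (simp add: quotient_lmodule_def c)
  ultimately show ?thesis by (simp add: lmodule_iso_def iso_def)
qed

section \<open>Induced modules\<close>

locale induced_module = Q: subalgebra_module sc br q sF act "UNIV :: 'f set"
  for sc :: "'k::field \<Rightarrow> 'v::ab_group_add \<Rightarrow> 'v" and br q
    and sF :: "'k \<Rightarrow> 'f::ab_group_add \<Rightarrow> 'f" and act
begin

sublocale G: subalgebra sc br UNIV
  by unfold_locales simp_all

lemma G_carrier: "x \<in> carrier G.A"
  by (simp add: free_algebra_simps(1) lists_UNIV)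

lemma G_U_E: assumes "u \<in> carrier G.U" obtains x where "u = G.cls x"
  using G.U_E[OF assms] by metis

text \<open>The relations over \<open>q\<close> are among those over the whole algebra, so all
  representatives of a coset have the same image.\<close>

lemma incl_cls:
  assumes "x \<in> carrier Q.A"
  shows "enveloping_inclusion sc br (Q.cls x) = G.cls x"
proof -
  have "Q.I \<subseteq> carrier Q.A \<inter> G.I"
  proof (rule Q.I_minimal)
    show "ideal (carrier Q.A \<inter> G.I) Q.A"
    proof (rule ideal_free_algebraI)
      show "0 \<in> carrier Q.A \<inter> G.I" using free_algebra_carrier(1)[of "[]" q 0] G.I_simps(2) by simp
    qed (auto simp: free_algebra_carrier G.I_simps G_carrier)
    have "env_relations sc br q \<subseteq> env_relations sc br UNIV"
      unfolding env_relations_def by (intro Un_mono) blast+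
    then show "env_relations sc br q \<subseteq> carrier Q.A \<inter> G.I"
      using Q.relations_carrier G.relations_I by (meson Int_greatest order_trans)
  qed
  then have "G.cls (h + x) = G.cls x" if "h \<in> Q.I" for h
    using that G_carrier by (subst G.cls_eq_iff) auto
  then have "G.cls ` Q.cls x = {G.cls x}"
    using Q.I_simps(2) unfolding Q.cls_eq by auto
  then show ?thesis by (simp add: enveloping_inclusion_def)
qed

section \<open>The tensor product as a quotient of a free abelian group\<close>

definition "Gr = free_Abelian_group (carrier G.U \<times> (UNIV :: 'f set))"
definition "rmul u r = u \<otimes>\<^bsub>G.U\<^esub> enveloping_inclusion sc br r"
definition "TK = tensor_kernel (carrier Q.U) G.U rmul (enveloping_action sF act)"
definition "NN = tensor_module (carrier Q.U) G.U rmul (enveloping_action sF act)"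

lemma carrier_Gr: "x \<in> carrier Gr \<longleftrightarrow> ks x \<subseteq> carrier G.U \<times> UNIV"
  by (simp add: Gr_def)

lemma Gr_simps: "x \<otimes>\<^bsub>Gr\<^esub> y = x + y" "\<one>\<^bsub>Gr\<^esub> = 0"
  by (simp_all add: Gr_def)

lemma group_Gr: "Group.group Gr"
  by (simp add: Gr_def)

lemma Gr_closed: "x \<in> carrier Gr \<Longrightarrow> y \<in> carrier Gr \<Longrightarrow> x + y \<in> carrier Gr"
  "x \<in> carrier Gr \<Longrightarrow> - x \<in> carrier Gr" "x \<in> carrier Gr \<Longrightarrow> y \<in> carrier Gr \<Longrightarrow> x - y \<in> carrier Gr"
  "0 \<in> carrier Gr" "m \<in> carrier G.U \<Longrightarrow> frag_of (m, f) \<in> carrier Gr"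
  using Poly_Mapping.keys_add[of x y] Poly_Mapping.keys_diff[of x y] by (auto simp: carrier_Gr keys_frag_of)

interpretation UR: ring G.U by (rule G.ring_U)

definition "gens = {frag_of (m \<oplus>\<^bsub>G.U\<^esub> m', f) - frag_of (m, f) - frag_of (m', f)
        | m m' f. m \<in> carrier G.U \<and> m' \<in> carrier G.U} \<union>
     {frag_of (m, f + f') - frag_of (m, f) - frag_of (m, f') | m f f'. m \<in> carrier G.U} \<union>
     {frag_of (rmul m r, f) - frag_of (m, enveloping_action sF act r f) | m r f. m \<in> carrier G.U \<and> r \<in> carrier Q.U}"

lemma rmul_cls: "x \<in> carrier Q.A \<Longrightarrow> rmul (G.cls y) (Q.cls x) = G.cls (y * x)"
  by (simp add: rmul_def incl_cls G.cls_hom G_carrier)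

lemma rmul_closed: "m \<in> carrier G.U \<Longrightarrow> r \<in> carrier Q.U \<Longrightarrow> rmul m r \<in> carrier G.U"
  by (metis G.U_E G.cls_hom(1) G_carrier Q.U_E rmul_cls)

lemma TK_eq: "TK = generate Gr gens"
  by (simp add: TK_def tensor_kernel_def gens_def Gr_def)

lemma gens_carrier: "gens \<subseteq> carrier Gr"
  unfolding gens_def using rmul_closed by (auto intro!: Gr_closed(3,5))

lemma TK_subgroup: "subgroup TK Gr"
  unfolding TK_eq by (rule group.generate_is_subgroup[OF group_Gr gens_carrier])

lemma TK_carrier: "x \<in> TK \<Longrightarrow> x \<in> carrier Gr"
  using TK_subgroup by (meson subgroup.mem_carrier)

lemma TK_simps: "0 \<in> TK" "x \<in> TK \<Longrightarrow> y \<in> TK \<Longrightarrow> x + y \<in> TK" "x \<in> TK \<Longrightarrow> - x \<in> TK"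
  "x \<in> TK \<Longrightarrow> y \<in> TK \<Longrightarrow> x - y \<in> TK"
proof -
  show "0 \<in> TK" using subgroup.one_closed[OF TK_subgroup] by (simp add: Gr_simps)
  show a: "x \<in> TK \<Longrightarrow> y \<in> TK \<Longrightarrow> x + y \<in> TK" for x y
    using subgroup.m_closed[OF TK_subgroup, of x y] by (simp add: Gr_simps)
  show n: "x \<in> TK \<Longrightarrow> - x \<in> TK" for x
    using subgroup.m_inv_closed[OF TK_subgroup, of x] TK_carrier[of x] by (simp add: Gr_def)
  show "x \<in> TK \<Longrightarrow> y \<in> TK \<Longrightarrow> x - y \<in> TK" using a[OF _ n, of x y] by simp
qed

lemma TK_sum: "(\<And>i. i \<in> J \<Longrightarrow> g i \<in> TK) \<Longrightarrow> sum g J \<in> TK"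
  by (induction J rule: infinite_finite_induct) (auto simp: TK_simps)

lemma gens_TK:
  "m \<in> carrier G.U \<Longrightarrow> m' \<in> carrier G.U \<Longrightarrow> frag_of (m \<oplus>\<^bsub>G.U\<^esub> m', f) - frag_of (m, f) - frag_of (m', f) \<in> TK"
  "m \<in> carrier G.U \<Longrightarrow> frag_of (m, f + f') - frag_of (m, f) - frag_of (m, f') \<in> TK"
  "m \<in> carrier G.U \<Longrightarrow> r \<in> carrier Q.U \<Longrightarrow> frag_of (rmul m r, f) - frag_of (m, enveloping_action sF act r f) \<in> TK"
proof -
  have g: "gens \<subseteq> TK" unfolding TK_eq by (auto intro: generate.incl)
  show "frag_of (m \<oplus>\<^bsub>G.U\<^esub> m', f) - frag_of (m, f) - frag_of (m', f) \<in> TK"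
    if "m \<in> carrier G.U" "m' \<in> carrier G.U"
    by (rule subsetD[OF g], unfold gens_def, rule UnI1, rule UnI1) (use that in blast)
  show "frag_of (m, f + f') - frag_of (m, f) - frag_of (m, f') \<in> TK" if "m \<in> carrier G.U"
    by (rule subsetD[OF g], unfold gens_def, rule UnI1, rule UnI2) (use that in blast)
  show "frag_of (rmul m r, f) - frag_of (m, enveloping_action sF act r f) \<in> TK"
    if "m \<in> carrier G.U" "r \<in> carrier Q.U"
    by (rule subsetD[OF g], unfold gens_def, rule UnI2) (use that in blast)
qed

definition "cg x y \<longleftrightarrow> x - y \<in> TK"

lemma cg_refl: "cg x x" by (simp add: cg_def TK_simps)
lemma cg_sym: "cg x y \<Longrightarrow> cg y x" using TK_simps(3)[of "x - y"] by (simp add: cg_def)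
lemma cg_trans [trans]: "cg x y \<Longrightarrow> cg y z \<Longrightarrow> cg x z"
  using TK_simps(2)[of "x - y" "y - z"] by (simp add: cg_def)
lemma cg_add: "cg x y \<Longrightarrow> cg x' y' \<Longrightarrow> cg (x + x') (y + y')"
  using TK_simps(2)[of "x - y" "x' - y'"] by (simp add: cg_def algebra_simps)
lemma cg_diff: "cg x y \<Longrightarrow> cg x' y' \<Longrightarrow> cg (x - x') (y - y')"
  using TK_simps(4)[of "x - y" "x' - y'"] by (simp add: cg_def algebra_simps)
lemma cg_TK: "cg x y \<Longrightarrow> x \<in> TK \<longleftrightarrow> y \<in> TK"
  using TK_simps(2)[of "x - y" y] TK_simps(4)[of x "x - y"] by (auto simp: cg_def)

lemma cg_gens:
  "cg (frag_of (G.cls (x + y), f)) (frag_of (G.cls x, f) + frag_of (G.cls y, f))"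
  "cg (frag_of (G.cls x, f + f')) (frag_of (G.cls x, f) + frag_of (G.cls x, f'))"
  "y \<in> carrier Q.A \<Longrightarrow> cg (frag_of (G.cls (x * y), f)) (frag_of (G.cls x, Q.word_act y f))"
  using gens_TK(1)[OF G.cls_hom(1)[OF G_carrier G_carrier] G.cls_hom(1)[OF G_carrier G_carrier], of x y f]
    gens_TK(2)[OF G.cls_hom(1)[OF G_carrier G_carrier], of x f f']
    gens_TK(3)[OF G.cls_hom(1)[OF G_carrier G_carrier] Q.cls_hom(1), of y y x f]
  by (simp_all add: cg_def G.cls_hom(3)[OF G_carrier G_carrier] rmul_cls Q.enveloping_action_cls algebra_simps)

lemma cg_zero: "cg (frag_of (G.cls x, 0)) 0" "cg (frag_of (G.cls 0, f)) 0"
  using TK_simps(3) cg_gens(2)[of x 0 0] cg_gens(1)[of 0 0 f] by (force simp: cg_def)+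

definition lmul :: "('v list \<Rightarrow>\<^sub>0 'k) set \<Rightarrow> (('v list \<Rightarrow>\<^sub>0 'k) set \<times> 'f \<Rightarrow>\<^sub>0 int) \<Rightarrow> (('v list \<Rightarrow>\<^sub>0 'k) set \<times> 'f \<Rightarrow>\<^sub>0 int)"
  where "lmul u = frag_extend (\<lambda>(m, f). frag_of (u \<otimes>\<^bsub>G.U\<^esub> m, f))"

lemma lmul_simps: "lmul u (x + y) = lmul u x + lmul u y" "lmul u (x - y) = lmul u x - lmul u y"
  "lmul u 0 = 0" "lmul u (- x) = - lmul u x"
  "lmul (G.cls p) (frag_of (G.cls p', f)) = frag_of (G.cls (p * p'), f)" "lmul u (frag_of (m, f)) = frag_of (u \<otimes>\<^bsub>G.U\<^esub> m, f)"
  by (simp_all add: lmul_def frag_extend_add frag_extend_diff frag_extend_minus G.cls_hom G_carrier)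

lemma lmul_carrier: "u \<in> carrier G.U \<Longrightarrow> x \<in> carrier Gr \<Longrightarrow> lmul u x \<in> carrier Gr"
  using keys_frag_extend[of "\<lambda>(m, f). frag_of (u \<otimes>\<^bsub>G.U\<^esub> m, f)" x]
  unfolding carrier_Gr lmul_def by (fastforce simp: keys_frag_of)

text \<open>By associativity left multiplication commutes with \<open>rmul\<close>, so it maps
  generating relations to generating relations.\<close>

lemma lmul_TK:
  assumes u: "u \<in> carrier G.U" and "x \<in> TK" shows "lmul u x \<in> TK"
proof -
  have g: "lmul u h \<in> TK" if h: "h \<in> gens" for h
  proof -
    have "rmul (u \<otimes>\<^bsub>G.U\<^esub> m) r = u \<otimes>\<^bsub>G.U\<^esub> rmul m r" if m: "m \<in> carrier G.U" and r: "r \<in> carrier Q.U" for m r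
    proof -
      obtain x where "u = G.cls x" using u by (rule G_U_E)
      moreover obtain y where "m = G.cls y" using m by (rule G_U_E)
      moreover obtain z where "z \<in> carrier Q.A" "r = Q.cls z" using r by (rule Q.U_E)
      ultimately show ?thesis
        by (simp add: rmul_cls mult.assoc G.cls_hom(2)[OF G_carrier G_carrier, symmetric])
    qed
    then show ?thesis
      using h u gens_TK(1)[OF UR.m_closed[OF u] UR.m_closed[OF u]] gens_TK(2)[OF UR.m_closed[OF u]]
        gens_TK(3)[OF UR.m_closed[OF u]]
      unfolding gens_def by (auto simp: lmul_simps UR.r_distr)
  qed
  show ?thesis using assms(2) unfolding TK_eq
  proof (induction rule: generate.induct)
    case one show ?case using TK_simps(1) by (simp add: Gr_simps lmul_simps TK_eq)
  next
    case (incl h) then show ?case using g by (simp add: TK_eq)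
  next
    case (inv h)
    then have "inv\<^bsub>Gr\<^esub> h = - h" using gens_carrier by (auto simp: Gr_def)
    then show ?case using g[OF inv] TK_simps(3) by (simp add: lmul_simps TK_eq)
  next
    case (eng x y) then show ?case using TK_simps(2) by (simp add: Gr_simps lmul_simps TK_eq)
  qed
qed

lemma lmul_cg: "u \<in> carrier G.U \<Longrightarrow> cg x y \<Longrightarrow> cg (lmul u x) (lmul u y)"
  using lmul_TK[of u "x - y"] by (simp add: cg_def lmul_simps)

definition "D x = TK #>\<^bsub>Gr\<^esub> x"

lemma D_eq: "D x = (\<lambda>k. k + x) ` TK"
  by (auto simp: D_def r_coset_def Gr_simps)

lemma D_iff: "D x = D y \<longleftrightarrow> cg x y"
proof
  assume "D x = D y"
  then have "0 + x \<in> (\<lambda>k. k + y) ` TK" using TK_simps(1) unfolding D_eq by blast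
  then show "cg x y" by (auto simp: cg_def)
next
  assume *: "cg x y"
  have "h + x \<in> (\<lambda>k. k + y) ` TK" if "h \<in> TK" for h
    using TK_simps(2)[OF that *[unfolded cg_def]] by (intro image_eqI[of _ _ "h + (x - y)"]) auto
  moreover have "h + y \<in> (\<lambda>k. k + x) ` TK" if "h \<in> TK" for h
    using TK_simps(4)[OF that *[unfolded cg_def]] by (intro image_eqI[of _ _ "h - (x - y)"]) auto
  ultimately show "D x = D y" unfolding D_eq by (intro equalityI image_subsetI)
qed

lemma NN_simps: "carrier NN = D ` carrier Gr" "D x \<otimes>\<^bsub>NN\<^esub> D y = D (x + y)" "\<one>\<^bsub>NN\<^esub> = D 0"
  "u \<in> carrier G.U \<Longrightarrow> lact NN u (D x) = D (lmul u x)"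
proof -
  have def: "NN = \<lparr>carrier = carrier (Gr Mod TK), monoid.mult = monoid.mult (Gr Mod TK), one = one (Gr Mod TK),
         lact = (\<lambda>u C. the_elem ((\<lambda>x. TK #>\<^bsub>Gr\<^esub> frag_extend (\<lambda>(m, f). frag_of (u \<otimes>\<^bsub>G.U\<^esub> m, f)) x) ` C))\<rparr>"
    by (simp add: NN_def tensor_module_def Let_def TK_def Gr_def)
  show "carrier NN = D ` carrier Gr" by (auto simp: def FactGroup_def RCOSETS_def D_def)
  show "\<one>\<^bsub>NN\<^esub> = D 0" by (simp add: def FactGroup_def D_eq)
  have "D x <#>\<^bsub>Gr\<^esub> D y = D (x + y)"
  proof -
    have "\<exists>k\<in>TK. (h + x) + (h' + y) = k + (x + y)" if "h \<in> TK" "h' \<in> TK" for h h'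
      using TK_simps(2)[OF that] by (intro bexI[of _ "h + h'"]) (auto simp: algebra_simps)
    moreover have "\<exists>h\<in>TK. \<exists>h'\<in>TK. k + (x + y) = (h + x) + (h' + y)" if "k \<in> TK" for k
      using that TK_simps(1) by (intro bexI[of _ k] bexI[of _ 0]) (auto simp: algebra_simps)
    ultimately show ?thesis unfolding D_eq set_mult_def Gr_simps by (auto simp: image_iff)
  qed
  then show "D x \<otimes>\<^bsub>NN\<^esub> D y = D (x + y)" by (simp add: def FactGroup_def)
  assume u: "u \<in> carrier G.U"
  have "(\<lambda>x. D (lmul u x)) ` D x = {D (lmul u x)}"
  proof -
    have "D (lmul u (h + x)) = D (lmul u x)" if "h \<in> TK" for h
      using lmul_TK[OF u that] by (simp add: D_iff cg_def lmul_simps)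
    then show ?thesis using TK_simps(1) unfolding D_eq[of x] by auto
  qed
  then show "lact NN u (D x) = D (lmul u x)" by (simp add: def D_def lmul_def)
qed

lemma group_NN: "Group.group NN"
proof (rule groupI)
  fix x assume "x \<in> carrier NN"
  then obtain y where "y \<in> carrier Gr" "x = D y" by (auto simp: NN_simps)
  then show "\<exists>y\<in>carrier NN. y \<otimes>\<^bsub>NN\<^esub> x = \<one>\<^bsub>NN\<^esub>"
    by (intro bexI[of _ "D (- y)"]) (auto simp: NN_simps Gr_closed)
qed (auto simp: NN_simps Gr_closed add.assoc)

lemma lact_closed: "u \<in> carrier G.U \<Longrightarrow> x \<in> carrier NN \<Longrightarrow> lact NN u x \<in> carrier NN"
  by (auto simp: NN_simps lmul_carrier)

subsection \<open>A linear model of the induced module\<close>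

text \<open>In this free model \<open>sg w f\<close> stands for the tensor of the word
  \<open>w\<close> with \<open>f\<close>; scalars act on the coefficient in \<open>F\<close>, and
  Lie algebra elements prepend a letter.\<close>

definition smul :: "'k \<Rightarrow> ('v list \<Rightarrow>\<^sub>0 'f) \<Rightarrow> ('v list \<Rightarrow>\<^sub>0 'f)"
  where "smul c = pm_ext (\<lambda>w f. sg w (sF c f))"

definition lft :: "'v \<Rightarrow> ('v list \<Rightarrow>\<^sub>0 'f) \<Rightarrow> ('v list \<Rightarrow>\<^sub>0 'f)"
  where "lft X = pm_ext (\<lambda>w f. sg (X # w) f)"

lemma smul_simps: "smul c (sg w f) = sg w (sF c f)" "smul c (s + t) = smul c s + smul c t"
  unfolding smul_def by (simp_all add: pm_ext_single pm_ext_add Q.M.scale_right_distrib single_add)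

lemma lft_simps: "lft X (sg w f) = sg (X # w) f" "lft X (s + t) = lft X s + lft X t"
  unfolding lft_def by (simp_all add: pm_ext_single pm_ext_add single_add)

lemma vector_space_smul: "vector_space smul"
proof -
  have "lk (smul c t) w = sF c (lk t w)" for c t w
    by (induction t rule: pm_induct)
      (auto simp: smul_simps lookup_add lookup_single when_def Q.M.scale_right_distrib)
  then show ?thesis
    by unfold_locales (auto intro!: poly_mapping_eqI simp: lookup_add Q.M.scale_right_distrib Q.M.scale_left_distrib)
qed

lemma lft_smul: "lft X (smul c t) = smul c (lft X t)"
  by (induction t rule: pm_induct) (auto simp: smul_simps lft_simps)

text \<open>Additive only modulo \<open>TK\<close>, because \<open>(m, f + f')\<close> is a
  generator of its own in the free abelian group.\<close>

definition Th :: "('v list \<Rightarrow>\<^sub>0 'f) \<Rightarrow> (('v list \<Rightarrow>\<^sub>0 'k) set \<times> 'f \<Rightarrow>\<^sub>0 int)"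
  where "Th t = (\<Sum>w\<in>ks t. frag_of (G.cls (sg w 1), lk t w))"

lemma Th_carrier: "Th t \<in> carrier Gr"
proof -
  have "(\<Sum>w\<in>F. frag_of (G.cls (sg w 1), lk t w)) \<in> carrier Gr" if "finite F" for F
    using that by (induction F rule: finite_induct) (auto simp: Gr_closed G.cls_hom G_carrier)
  then show ?thesis by (simp add: Th_def)
qed

lemma Th_superset:
  assumes "finite F" "ks t \<subseteq> F"
  shows "cg (\<Sum>w\<in>F. frag_of (G.cls (sg w 1), lk t w)) (Th t)"
proof -
  have "(\<Sum>w\<in>F. frag_of (G.cls (sg w 1), lk t w)) - Th t = (\<Sum>w\<in>F - ks t. frag_of (G.cls (sg w 1), lk t w))"
    unfolding Th_def by (rule sum_diff[symmetric, OF assms])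
  moreover have "\<dots> \<in> TK" by (rule TK_sum) (use cg_zero(1) in \<open>auto simp: cg_def in_keys_iff\<close>)
  ultimately show ?thesis by (simp add: cg_def)
qed

lemma Th_add: "cg (Th (s + t)) (Th s + Th t)"
proof -
  let ?F = "ks s \<union> ks t" and ?g = "\<lambda>t w. frag_of (G.cls (sg w 1), lk t w)"
  have "cg (Th (s + t)) (\<Sum>w\<in>?F. ?g (s + t) w)"
    by (rule cg_sym[OF Th_superset]) (use Poly_Mapping.keys_add[of s t] in auto)
  also have "cg \<dots> (\<Sum>w\<in>?F. ?g s w + ?g t w)"
    unfolding cg_def sum_subtractf[symmetric]
    by (rule TK_sum) (use cg_gens(2) in \<open>simp add: cg_def lookup_add\<close>)
  also have "(\<Sum>w\<in>?F. ?g s w + ?g t w) = (\<Sum>w\<in>?F. ?g s w) + (\<Sum>w\<in>?F. ?g t w)" by (rule sum.distrib)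
  also have "cg \<dots> (Th s + Th t)" by (intro cg_add Th_superset) auto
  finally show ?thesis .
qed

lemma Th_zero: "Th 0 = 0" by (simp add: Th_def)

lemma Th_single: "cg (Th (sg w f)) (frag_of (G.cls (sg w 1), f))"
  by (cases "f = 0") (auto simp: Th_def cg_refl intro: cg_sym[OF cg_zero(1)])

lemma Th_diff: "cg (Th (s - t)) (Th s - Th t)"
  using cg_sym[OF Th_add[of "s - t" t]] by (simp add: cg_def algebra_simps)

lemma Th_lmul:
  assumes "\<And>s t. h (s + t) = h s + h t" "u \<in> carrier G.U" "\<And>w f. cg (Th (h (sg w f))) (lmul u (frag_of (G.cls (sg w 1), f)))"
  shows "cg (Th (h t)) (lmul u (Th t))"
proof (induction t rule: pm_induct)
  case (single w f)
  show ?case using cg_trans[OF assms(3) cg_sym[OF lmul_cg[OF assms(2) Th_single]]] .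
next
  case (add s t)
  have "cg (Th (h (s + t))) (Th (h s) + Th (h t))" unfolding assms(1) by (rule Th_add)
  also have "cg \<dots> (lmul u (Th s) + lmul u (Th t))" by (rule cg_add[OF add])
  also have "\<dots> = lmul u (Th s + Th t)" by (simp add: lmul_simps)
  also have "cg \<dots> (lmul u (Th (s + t)))" by (rule lmul_cg[OF assms(2) cg_sym[OF Th_add]])
  finally show ?case .
qed

lemma Th_lft: "cg (Th (lft X t)) (lmul (G.cls (sg [X] 1)) (Th t))"
  by (rule Th_lmul)
    (use Th_single in \<open>auto simp: lft_simps G.cls_hom G_carrier lmul_simps(5) single_mult_single\<close>)

lemma scalar_carrier: "sg [] c \<in> carrier Q.A" by (rule free_algebra_carrier) simp

text \<open>A scalar belongs to the enveloping algebra of \<open>q\<close>, so the tensor relation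
  moves it from one factor to the other.\<close>

lemma cg_scalar: "cg (frag_of (G.cls (sg w 1), sF c f)) (frag_of (G.cls (sg w c), f))"
  using cg_sym[OF cg_gens(3)[OF scalar_carrier, of "sg w 1" c f]]
  by (simp add: single_mult_single Q.word_act_simps)

lemma Th_smul: "cg (Th (smul c t)) (lmul (G.cls (sg [] c)) (Th t))"
proof (rule Th_lmul)
  show "cg (Th (smul c (sg w f))) (lmul (G.cls (sg [] c)) (frag_of (G.cls (sg w 1), f)))" for w f
    using cg_trans[OF Th_single cg_scalar] by (simp add: smul_simps lmul_simps(5) single_mult_single)
qed (simp_all add: smul_simps G.cls_hom G_carrier)

lemma Th_surj: "x \<in> carrier Gr \<Longrightarrow> \<exists>t. cg x (Th t)"
proof -
  have one': "\<exists>t. cg (frag_of (G.cls x, f)) (Th t)" for x f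
  proof (induction x rule: pm_induct)
    case (single w c)
    show ?case
      using cg_trans[OF cg_sym[OF cg_scalar] cg_sym[OF Th_single]] by blast
  next
    case (add x y)
    then obtain s t where st: "cg (frag_of (G.cls x, f)) (Th s)" "cg (frag_of (G.cls y, f)) (Th t)" by blast
    show ?case using cg_trans[OF cg_gens(1) cg_trans[OF cg_add[OF st] cg_sym[OF Th_add]]] by blast
  qed
  assume "x \<in> carrier Gr"
  then have "ks x \<subseteq> carrier G.U \<times> UNIV" by (simp add: carrier_Gr)
  then show ?thesis
  proof (induction x rule: frag_induction)
    case zero show ?case using cg_refl[of 0] Th_zero by metis
  next
    case (one a)
    then obtain u f where "a = (u, f)" "u \<in> carrier G.U" by auto
    moreover obtain x where "u = G.cls x" using \<open>u \<in> carrier G.U\<close> by (rule G_U_E)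
    ultimately show ?case by (simp add: one')
  next
    case (diff x y)
    then obtain s t where "cg x (Th s)" "cg y (Th t)" by blast
    then show ?case using cg_trans[OF cg_diff cg_sym[OF Th_diff]] by blast
  qed
qed

text \<open>The kernel of the surjection onto the induced module: submodules of the latter
  correspond to letter-stable subspaces containing \<open>Rel\<close>.\<close>

definition "Rel = {t. Th t \<in> TK}"

interpretation TS: vector_space smul by (rule vector_space_smul)

lemma D_Th: "D (Th (s + t)) = D (Th s) \<otimes>\<^bsub>NN\<^esub> D (Th t)"
  "D (Th (smul c t)) = lact NN (G.cls (sg [] c)) (D (Th t))"
  "D (Th (lft X t)) = lact NN (G.cls (sg [X] 1)) (D (Th t))"
  using Th_add[of s t] Th_smul[of c t] Th_lft[of X t]
  by (simp_all add: NN_simps D_iff G.cls_hom G_carrier)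

lemma D_Th_one: "D (Th t) = \<one>\<^bsub>NN\<^esub> \<longleftrightarrow> t \<in> Rel"
  by (simp add: NN_simps D_iff cg_def Rel_def)

lemma submodule_subspace:
  assumes "lsubmodule (carrier G.U) NN J"
  shows "TS.subspace {t. D (Th t) \<in> J}" "\<And>X t. D (Th t) \<in> J \<Longrightarrow> D (Th (lft X t)) \<in> J"
    "\<And>t. t \<in> Rel \<Longrightarrow> D (Th t) \<in> J"
proof -
  have J: "subgroup J NN" "\<And>u x. u \<in> carrier G.U \<Longrightarrow> x \<in> J \<Longrightarrow> lact NN u x \<in> J"
    using assms by (auto simp: lsubmodule_def)
  show r: "\<And>t. t \<in> Rel \<Longrightarrow> D (Th t) \<in> J" using subgroup.one_closed[OF J(1)] D_Th_one by metis
  show "\<And>X t. D (Th t) \<in> J \<Longrightarrow> D (Th (lft X t)) \<in> J"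
    unfolding D_Th by (rule J(2)) (auto simp: G.cls_hom G_carrier)
  show "TS.subspace {t. D (Th t) \<in> J}"
  proof (rule TS.subspaceI; unfold mem_Collect_eq)
    show "D (Th 0) \<in> J" using r[of 0] by (simp add: Rel_def Th_zero TK_simps)
    show "\<And>x y. D (Th x) \<in> J \<Longrightarrow> D (Th y) \<in> J \<Longrightarrow> D (Th (x + y)) \<in> J"
      unfolding D_Th by (rule subgroup.m_closed[OF J(1)])
    show "\<And>c x. D (Th x) \<in> J \<Longrightarrow> D (Th (smul c x)) \<in> J"
      unfolding D_Th by (rule J(2)) (auto simp: G.cls_hom G_carrier)
  qed
qed

lemma carrier_NN: "carrier NN = range (\<lambda>t. D (Th t))"
proof
  show "carrier NN \<subseteq> range (\<lambda>t. D (Th t))"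
    using Th_surj by (auto simp: NN_simps D_iff image_iff)
  show "range (\<lambda>t. D (Th t)) \<subseteq> carrier NN" using Th_carrier by (auto simp: NN_simps)
qed

lemma submodule_dichotomy:
  assumes "\<And>S. TS.subspace S \<Longrightarrow> (\<And>X t. t \<in> S \<Longrightarrow> lft X t \<in> S) \<Longrightarrow> Rel \<subseteq> S \<Longrightarrow> S \<subseteq> Rel \<or> S = UNIV"
    and J: "lsubmodule (carrier G.U) NN J"
  shows "J = {\<one>\<^bsub>NN\<^esub>} \<or> J = carrier NN"
proof -
  note s = submodule_subspace[OF J]
  have J': "subgroup J NN" using J by (auto simp: lsubmodule_def)
  have sub: "J \<subseteq> range (\<lambda>t. D (Th t))" using subgroup.subset[OF J'] carrier_NN by simp
  have "{t. D (Th t) \<in> J} \<subseteq> Rel \<or> {t. D (Th t) \<in> J} = UNIV"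
    using s by (intro assms(1)) auto
  then show ?thesis
  proof
    assume "{t. D (Th t) \<in> J} \<subseteq> Rel"
    then have "J \<subseteq> {\<one>\<^bsub>NN\<^esub>}" using sub D_Th_one by blast
    then show ?thesis using subgroup.one_closed[OF J'] by blast
  next
    assume "{t. D (Th t) \<in> J} = UNIV"
    then have "carrier NN \<subseteq> J" unfolding carrier_NN by blast
    then show ?thesis using subgroup.subset[OF J'] by blast
  qed
qed

lemma Rel_lft: "t \<in> Rel \<Longrightarrow> lft X t \<in> Rel"
  using cg_TK[OF Th_lft[of X t]] lmul_TK[of "G.cls (sg [X] 1)" "Th t"] by (simp add: Rel_def G.cls_hom G_carrier)

lemma Rel_subspace: "TS.subspace Rel"
proof (rule TS.subspaceI)
  show "0 \<in> Rel" by (simp add: Rel_def Th_zero TK_simps)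
  show "\<And>x y. x \<in> Rel \<Longrightarrow> y \<in> Rel \<Longrightarrow> x + y \<in> Rel"
    unfolding Rel_def mem_Collect_eq using cg_TK[OF Th_add] TK_simps(2) by blast
  show "\<And>c x. x \<in> Rel \<Longrightarrow> smul c x \<in> Rel"
    unfolding Rel_def mem_Collect_eq using cg_TK[OF Th_smul] lmul_TK G.cls_hom(1)[OF G_carrier G_carrier] by blast
qed

lemma word_relation:
  assumes "x - y - z \<in> G.I"
  shows "frag_of (G.cls (x * sg w 1), f) - frag_of (G.cls (y * sg w 1), f) - frag_of (G.cls (z * sg w 1), f) \<in> TK"
proof -
  have "x * sg w 1 - (y * sg w 1 + z * sg w 1) = (x - y - z) * sg w 1" by (simp add: algebra_simps)
  then have "G.cls (x * sg w 1) = G.cls (y * sg w 1 + z * sg w 1)"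
    using G.I_simps(5)[OF assms G_carrier] by (simp add: G.cls_eq_iff G_carrier)
  then show ?thesis using cg_gens(1)[of "y * sg w 1" "z * sg w 1" f] by (simp add: cg_def algebra_simps)
qed

lemma Rel_cg: "cg (Th s) (Th t) \<Longrightarrow> s - t \<in> Rel"
  using cg_TK[OF Th_diff[of s t]] by (simp add: Rel_def cg_def)

lemma Rel_induct:
  fixes h :: "('v list \<Rightarrow>\<^sub>0 'f) \<Rightarrow> ('v list \<Rightarrow>\<^sub>0 'f)"
  assumes "\<And>s t. h (s + t) = h s + h t" "\<And>w f. h (sg w f) \<in> Rel"
  shows "h t \<in> Rel"
  by (induction t rule: pm_induct) (use assms TS.subspace_add[OF Rel_subspace] in auto)

text \<open>By additivity it suffices to consider one word, where each claim is a defining relation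
  of the enveloping algebra multiplied by that word from the right.\<close>

lemma Rel_relations:
  "lft (X + Y) t - lft X t - lft Y t \<in> Rel"
  "lft (sc c X) t - smul c (lft X t) \<in> Rel"
  "lft X (lft Y t) - lft Y (lft X t) - lft (br X Y) t \<in> Rel"
proof -
  have three: "sg u f - sg v f - sg w f \<in> Rel"
    if "frag_of (G.cls (sg u 1), f) - frag_of (G.cls (sg v 1), f) - frag_of (G.cls (sg w 1), f) \<in> TK" for u v w f
  proof -
    have "cg (Th (sg u f - sg v f - sg w f)) (Th (sg u f) - Th (sg v f) - Th (sg w f))"
      using cg_trans[OF Th_diff cg_diff[OF Th_diff cg_refl]] .
    also have "cg \<dots> (frag_of (G.cls (sg u 1), f) - frag_of (G.cls (sg v 1), f) - frag_of (G.cls (sg w 1), f))"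
      by (intro cg_diff Th_single)
    finally show ?thesis using that cg_TK by (simp add: Rel_def)
  qed
  show "lft (X + Y) t - lft X t - lft Y t \<in> Rel"
  proof (rule Rel_induct[of "\<lambda>t. lft (X + Y) t - lft X t - lft Y t"])
    show "lft (X + Y) (sg w f) - lft X (sg w f) - lft Y (sg w f) \<in> Rel" for w f
      using word_relation[OF G.cls_relations(1)[of X Y], of w f] by (simp add: lft_simps three single_mult_single)
  qed (simp add: lft_simps)
  show "lft X (lft Y t) - lft Y (lft X t) - lft (br X Y) t \<in> Rel"
  proof (rule Rel_induct[of "\<lambda>t. lft X (lft Y t) - lft Y (lft X t) - lft (br X Y) t"])
    show "lft X (lft Y (sg w f)) - lft Y (lft X (sg w f)) - lft (br X Y) (sg w f) \<in> Rel" for w f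
      using word_relation[OF G.cls_relations(3)[of X Y], of w f] by (simp add: lft_simps three single_mult_single)
  qed (simp add: lft_simps)
  show "lft (sc c X) t - smul c (lft X t) \<in> Rel"
  proof (rule Rel_induct[of "\<lambda>t. lft (sc c X) t - smul c (lft X t)"])
    fix w f
    have "(sg [sc c X] 1 - sg [X] c) * sg w 1 \<in> G.I"
      using G.I_simps(5)[OF G.cls_relations(2) G_carrier] by simp
    then have "G.cls (sg (sc c X # w) 1) = G.cls (sg (X # w) c)"
      by (simp add: G.cls_eq_iff G_carrier left_diff_distrib single_mult_single)
    then have "cg (frag_of (G.cls (sg (sc c X # w) 1), f)) (frag_of (G.cls (sg (X # w) 1), sF c f))"
      using cg_sym[OF cg_scalar] by simp
    from Rel_cg[OF cg_trans[OF cg_trans[OF Th_single this] cg_sym[OF Th_single]]]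
    show "lft (sc c X) (sg w f) - smul c (lft X (sg w f)) \<in> Rel"
      by (simp add: lft_simps smul_simps)
  qed (simp add: lft_simps smul_simps)
qed

lemma Rel_act: "X \<in> q \<Longrightarrow> sg [X] f - sg [] (act X f) \<in> Rel"
proof -
  assume X: "X \<in> q"
  then have "sg [X] 1 \<in> carrier Q.A" by (intro free_algebra_carrier) simp
  from cg_gens(3)[OF this, of "sg [] 1" f]
  have "cg (frag_of (G.cls (sg [X] 1), f)) (frag_of (G.cls (sg [] 1), act X f))"
    by (simp add: single_mult_single Q.word_act_simps)
  from Rel_cg[OF cg_trans[OF cg_trans[OF Th_single this] cg_sym[OF Th_single]]]
  show ?thesis .
qed

subsection \<open>Nonvanishing\<close>

text \<open>A \<open>q\<close>-homomorphism \<open>j\<close> extends by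
  \<open>u \<otimes> f \<mapsto> u (j f)\<close>, which respects the tensor relations. So
  \<open>1 \<otimes> f0\<close> is nonzero as soon as \<open>j f0\<close> is.\<close>

lemma induced_module_nonzero:
  assumes "subalgebra_module sc br UNIV sM \<rho> V"
    and j: "\<And>f. j f \<in> V" "\<And>f f'. j (f + f') = j f + j f'" "\<And>c f. j (sF c f) = sM c (j f)"
      "\<And>X f. X \<in> q \<Longrightarrow> \<rho> X (j f) = j (act X f)" "j f0 \<noteq> 0"
  shows "carrier NN \<noteq> {\<one>\<^bsub>NN\<^esub>}"
proof
  interpret P: subalgebra_module sc br UNIV sM \<rho> V by fact
  define \<psi> where "\<psi> p = enveloping_action sM \<rho> (fst p) (j (snd p))" for p
  define \<Psi> where "\<Psi> x = pm_ext (\<lambda>p n. sM (of_int n) (\<psi> p)) x" for x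
  have \<psi>: "\<psi> (G.cls x, f) = P.word_act x (j f)" for x f
    by (simp add: \<psi>_def P.enveloping_action_cls G_carrier j(1))
  have \<Psi>: "\<Psi> (frag_of p) = \<psi> p" "\<Psi> (x + y) = \<Psi> x + \<Psi> y" for p x y
    unfolding \<Psi>_def by (simp_all add: pm_ext_single pm_ext_add P.M.scale_left_distrib)
  have \<Psi>d: "\<Psi> (x - y) = \<Psi> x - \<Psi> y" for x y
    using \<Psi>(2)[of "x - y" y] by (simp add: eq_diff_eq)
  have word: "P.word_act x (j f) = j (Q.word_act x f)" if "x \<in> carrier Q.A" for x f
    using that
  proof (induction x rule: Q.carrier_induct)
    case (single w c)
    have "foldr \<rho> w (j f) = j (foldr act w f)" using single by (induction w) (auto simp: j(4))
    then show ?case by (simp add: P.word_act_simps Q.word_act_simps j(3))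
  qed (simp add: P.word_act_simps Q.word_act_simps j(2))
  have gen: "\<Psi> h = 0" if "h \<in> gens" for h
  proof -
    have 1: "\<psi> (m \<oplus>\<^bsub>G.U\<^esub> m', f) = \<psi> (m, f) + \<psi> (m', f)" if m: "m \<in> carrier G.U" "m' \<in> carrier G.U" for m m' f
    proof -
      obtain x where "m = G.cls x" using m(1) by (rule G_U_E)
      moreover obtain y where "m' = G.cls y" using m(2) by (rule G_U_E)
      ultimately show ?thesis
        by (simp only: G.cls_hom(3)[OF G_carrier G_carrier, symmetric] \<psi> P.word_act_simps)
    qed
    have 2: "\<psi> (m, f + f') = \<psi> (m, f) + \<psi> (m, f')" if m: "m \<in> carrier G.U" for m f f'
    proof -
      obtain x where "m = G.cls x" using m by (rule G_U_E)
      then show ?thesis by (simp add: \<psi> j P.word_act_lin G_carrier)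
    qed
    have 3: "\<psi> (rmul m r, f) = \<psi> (m, enveloping_action sF act r f)"
      if m: "m \<in> carrier G.U" "r \<in> carrier Q.U" for m r f
    proof -
      obtain x where "m = G.cls x" using m(1) by (rule G_U_E)
      moreover obtain y where "y \<in> carrier Q.A" "r = Q.cls y" using m(2) by (rule Q.U_E)
      ultimately show ?thesis
        by (simp add: rmul_cls \<psi> Q.enveloping_action_cls P.word_act_mult G_carrier j(1) word)
    qed
    show ?thesis using that unfolding gens_def by (auto simp: \<Psi>d \<Psi> 1 2 3)
  qed
  have "\<Psi> x = 0" if "x \<in> TK" for x
    using that unfolding TK_eq
  proof (induction rule: generate.induct)
    case one show ?case using \<Psi>d[of 0 0] by (simp add: Gr_simps)
  next
    case (inv h)
    then have "inv\<^bsub>Gr\<^esub> h = 0 - h" using gens_carrier by (auto simp: Gr_def)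
    then show ?case using gen[OF inv] \<Psi>d[of 0 h] \<Psi>d[of 0 0] by simp
  qed (simp_all add: gen Gr_simps \<Psi>)
  moreover have "\<Psi> (frag_of (G.cls (sg [] 1), f0)) \<noteq> 0"
    using j(5) by (simp add: \<Psi> \<psi> P.word_act_simps)
  ultimately have n: "frag_of (G.cls (sg [] 1), f0) \<notin> TK" by blast
  assume "carrier NN = {\<one>\<^bsub>NN\<^esub>}"
  moreover have "D (frag_of (G.cls (sg [] 1), f0)) \<in> carrier NN"
    unfolding NN_simps(1) by (rule imageI[OF Gr_closed(5)[OF G.cls_hom(1)[OF G_carrier G_carrier]]])
  ultimately have "D (frag_of (G.cls (sg [] 1), f0)) = D 0" by (simp add: NN_simps(3))
  with n show False by (simp add: D_iff cg_def)
qed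

end

section \<open>The coinduced module\<close>

context weight_basis
begin

section \<open>Projections onto the graded parts\<close>

definition pr :: "complex \<Rightarrow> 'l \<Rightarrow> 'l"
  where "pr i x = (\<Sum>b\<in>{b \<in> BB. wt b Z = i}. sc (B (dl b) x) b)"

lemma grade_subspace: "subspace (grade i)"
  by (auto simp: subspace_def grade_def br_simps scale_right_distrib scale_left_commute)

lemma pr_grade: "pr i x \<in> grade i"
  unfolding pr_def by (intro subspace_sum[OF grade_subspace] subspace_scale[OF grade_subspace]) (auto intro: BB_grade)

lemma pr_add: "pr i (x + y) = pr i x + pr i y"
  and pr_scale: "pr i (sc c x) = sc c (pr i x)"
  by (simp_all add: pr_def form_simps scale_left_distrib sum.distrib scale_sum_right)

lemma pr_zero: "pr i 0 = 0" by (simp add: pr_def form_simps)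

lemma pr_same: "x \<in> grade i \<Longrightarrow> pr i x = x"
  using expand_grade by (simp add: pr_def)

lemma pr_other: "x \<in> grade j \<Longrightarrow> i \<noteq> j \<Longrightarrow> pr i x = 0"
  unfolding pr_def
proof (rule sum.neutral, rule ballI)
  fix b assume *: "x \<in> grade j" "i \<noteq> j" "b \<in> {b \<in> BB. wt b Z = i}"
  then have "B (dl b) x = 0" using coeff_weight[OF in_T(1), of b x j] by (auto simp: grade_def)
  then show "sc (B (dl b) x) b = 0" by simp
qed

lemma pr_sum: "x = pr 1 x + (pr 0 x + pr (-1) x)"
proof -
  have "BB = {b \<in> BB. wt b Z = 1} \<union> ({b \<in> BB. wt b Z = 0} \<union> {b \<in> BB. wt b Z = -1})" using grading by auto
  then have "(\<Sum>b\<in>BB. sc (B (dl b) x) b)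
      = (\<Sum>b\<in>{b \<in> BB. wt b Z = 1} \<union> ({b \<in> BB. wt b Z = 0} \<union> {b \<in> BB. wt b Z = -1}). sc (B (dl b) x) b)"
    by simp
  also have "\<dots> = pr 1 x + (pr 0 x + pr (-1) x)"
    unfolding pr_def using finite_BB by (subst sum.union_disjoint; (subst sum.union_disjoint)?) auto
  finally show ?thesis by (simp only: expand)
qed

lemma grade_2: assumes "x \<in> grade i" "i \<notin> {-1, 0, 1}" shows "x = 0"
proof -
  have e: "{b \<in> BB. wt b Z = i} = {}" using assms(2) grading by blast
  show ?thesis using expand_grade[OF assms(1)] unfolding e by simp
qed

lemma br_11: "x \<in> grade 1 \<Longrightarrow> y \<in> grade 1 \<Longrightarrow> br x y = 0"
  using br_grade[of x 1 y 1] grade_2[of "br x y" 2] by simp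

text \<open>Split off the parts of grade 1. On grades 0 and -1 together the projection to grade 0
  respects brackets, and \<open>br (pr 1 x) (pr 1 y)\<close>, which occurs in both mixed terms, is
  zero. This is the constant-term case of the bracket relation in the coinduced module.\<close>

lemma pr_br:
  "pr 0 (br x y) = br (pr 0 x) (pr 0 y) + (pr 0 (br (pr 1 x) y) + pr 0 (br x (pr 1 y)))"
  "pr 1 (br x y) = pr 1 (br (pr 1 x) y) + pr 1 (br x (pr 1 y))"
proof -
  let ?x = "pr 0 x + pr (-1) x" and ?y = "pr 0 y + pr (-1) y"
  have m: "pr 0 x \<in> grade 0" "pr 0 y \<in> grade 0" "pr (-1) x \<in> grade (-1)" "pr (-1) y \<in> grade (-1)"
    by (rule pr_grade)+
  have "br ?x ?y = br (pr 0 x) (pr 0 y) + (br (pr 0 x) (pr (-1) y) + br (pr (-1) x) (pr 0 y))"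
    using br_grade[OF m(3,4)] grade_2[of "br (pr (-1) x) (pr (-1) y)" "-2"] by (simp add: br_simps algebra_simps)
  moreover have "br (pr 0 x) (pr 0 y) \<in> grade 0" "br (pr 0 x) (pr (-1) y) \<in> grade (-1)" "br (pr (-1) x) (pr 0 y) \<in> grade (-1)"
    using br_grade[OF m(1,2)] br_grade[OF m(1,4)] br_grade[OF m(3,2)] by simp_all
  ultimately have q: "pr 0 (br ?x ?y) = br (pr 0 x) (pr 0 y)" "pr 1 (br ?x ?y) = 0"
    by (simp_all add: pr_add pr_same pr_other)
  have "br x y = br ?x ?y + (br (pr 1 x) y + br x (pr 1 y))"
  proof -
    have "br (pr 1 x) y + br x (pr 1 y) = br (pr 1 x) (pr 1 y + ?y) + br (pr 1 x + ?x) (pr 1 y)"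
      by (simp only: pr_sum[symmetric])
    moreover have "br x y = br (pr 1 x + ?x) (pr 1 y + ?y)" by (simp only: pr_sum[symmetric])
    ultimately show ?thesis
      using br_11[OF pr_grade pr_grade] by (simp only: br_simps(1,2)) (simp add: algebra_simps)
  qed
  then show "pr 0 (br x y) = br (pr 0 x) (pr 0 y) + (pr 0 (br (pr 1 x) y) + pr 0 (br x (pr 1 y)))"
    "pr 1 (br x y) = pr 1 (br (pr 1 x) y) + pr 1 (br x (pr 1 y))"
    by (simp_all only: pr_add q) simp
qed

end

text \<open>Functions on words in \<open>grade 1\<close> that are symmetric and linear in each letter are formal power
  series on \<open>grade 1\<close>: removing the first letter is differentiation, by which \<open>grade 1\<close> acts, and the
  action of the other elements is determined by their commutators with the differentiations and the
  constant term.\<close>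

locale coinduced = weight_basis sc br B T BB dl wt Z X + F: vector_space sF
  for sc :: "complex \<Rightarrow> 'l::ab_group_add \<Rightarrow> 'l" and br B T BB dl wt Z X
    and sF :: "complex \<Rightarrow> 'f::ab_group_add \<Rightarrow> 'f" +
  fixes act :: "'l \<Rightarrow> 'f \<Rightarrow> 'f"
  assumes act_lin: "x \<in> grade 0 \<Longrightarrow> act x (v + w) = act x v + act x w"
      "x \<in> grade 0 \<Longrightarrow> act x (sF c v) = sF c (act x v)"
      "x \<in> grade 0 \<Longrightarrow> y \<in> grade 0 \<Longrightarrow> act (x + y) v = act x v + act y v"
      "x \<in> grade 0 \<Longrightarrow> act (sc c x) v = sF c (act x v)"
    and act_br: "x \<in> grade 0 \<Longrightarrow> y \<in> grade 0 \<Longrightarrow> act (br x y) v = act x (act y v) - act y (act x v)"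
begin

abbreviation "p \<equiv> grade 1"

text \<open>The coefficient of \<open>A \<phi>\<close> at a word. As the first letter acts by
  differentiation, the recursion is \<open>x A = A x + [x, A]\<close>; at the empty word grade 0
  acts on the constant term, grade 1 takes a first derivative, and grade -1 contributes
  nothing.\<close>

primrec cact :: "'l list \<Rightarrow> 'l \<Rightarrow> ('l list \<Rightarrow> 'f) \<Rightarrow> 'f" where
  "cact [] A \<phi> = act (pr 0 A) (\<phi> []) + \<phi> [pr 1 A]"
| "cact (x # xs) A \<phi> = cact xs A (\<lambda>ys. \<phi> (x # ys)) + cact xs (br x A) \<phi>"

definition V :: "('l list \<Rightarrow> 'f) set"
  where "V = {\<phi>. (\<forall>xs. xs \<notin> lists p \<longrightarrow> \<phi> xs = 0) \<and>
    (\<forall>u v. \<forall>x\<in>p. \<forall>y\<in>p. u \<in> lists p \<longrightarrow> v \<in> lists p \<longrightarrow>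
       \<phi> (u @ x # y # v) = \<phi> (u @ y # x # v) \<and> \<phi> (u @ (x + y) # v) = \<phi> (u @ x # v) + \<phi> (u @ y # v) \<and>
       (\<forall>c. \<phi> (u @ sc c x # v) = sF c (\<phi> (u @ x # v))))}"

definition cscaleF :: "complex \<Rightarrow> ('l list \<Rightarrow> 'f) \<Rightarrow> ('l list \<Rightarrow> 'f)"
  where "cscaleF c \<phi> = (\<lambda>xs. sF c (\<phi> xs))"

definition cop :: "'l \<Rightarrow> ('l list \<Rightarrow> 'f) \<Rightarrow> ('l list \<Rightarrow> 'f)"
  where "cop A \<phi> = (\<lambda>xs. if xs \<in> lists p then cact xs A \<phi> else 0)"

lemma p_closed: "x \<in> p \<Longrightarrow> y \<in> p \<Longrightarrow> x + y \<in> p" "x \<in> p \<Longrightarrow> sc c x \<in> p" "0 \<in> p"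
  using grade_subspace by (auto simp: subspace_def)

lemma V_D:
  assumes "\<phi> \<in> V"
  shows "xs \<notin> lists p \<Longrightarrow> \<phi> xs = 0"
    "x \<in> p \<Longrightarrow> y \<in> p \<Longrightarrow> u \<in> lists p \<Longrightarrow> v \<in> lists p \<Longrightarrow> \<phi> (u @ x # y # v) = \<phi> (u @ y # x # v)"
    "x \<in> p \<Longrightarrow> y \<in> p \<Longrightarrow> u \<in> lists p \<Longrightarrow> v \<in> lists p \<Longrightarrow> \<phi> (u @ (x + y) # v) = \<phi> (u @ x # v) + \<phi> (u @ y # v)"
    "x \<in> p \<Longrightarrow> u \<in> lists p \<Longrightarrow> v \<in> lists p \<Longrightarrow> \<phi> (u @ sc c x # v) = sF c (\<phi> (u @ x # v))"
  using assms unfolding V_def by blast+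

lemma V_I:
  assumes "\<And>xs. xs \<notin> lists p \<Longrightarrow> \<phi> xs = 0"
    "\<And>x y u v. x \<in> p \<Longrightarrow> y \<in> p \<Longrightarrow> u \<in> lists p \<Longrightarrow> v \<in> lists p \<Longrightarrow> \<phi> (u @ x # y # v) = \<phi> (u @ y # x # v)"
    "\<And>x y u v. x \<in> p \<Longrightarrow> y \<in> p \<Longrightarrow> u \<in> lists p \<Longrightarrow> v \<in> lists p \<Longrightarrow> \<phi> (u @ (x + y) # v) = \<phi> (u @ x # v) + \<phi> (u @ y # v)"
    "\<And>x u v c. x \<in> p \<Longrightarrow> u \<in> lists p \<Longrightarrow> v \<in> lists p \<Longrightarrow> \<phi> (u @ sc c x # v) = sF c (\<phi> (u @ x # v))"
  shows "\<phi> \<in> V"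
  using assms unfolding V_def by simp

lemma deriv_V:
  assumes "\<phi> \<in> V" "x \<in> p" shows "(\<lambda>ys. \<phi> (x # ys)) \<in> V"
proof (rule V_I)
  show "\<phi> (x # xs) = 0" if "xs \<notin> lists p" for xs using V_D(1)[OF assms(1), of "x # xs"] that by simp
qed (use V_D(2-4)[OF assms(1), of _ _ "x # _"] V_D(4)[OF assms(1), of _ "x # _"] assms(2) in simp_all)

lemma cact_fun: "cact xs A (\<lambda>ys. \<phi> ys + \<psi> ys) = cact xs A \<phi> + cact xs A \<psi>"
  "cact xs A (\<lambda>ys. sF c (\<phi> ys)) = sF c (cact xs A \<phi>)"
  by (induction xs arbitrary: A \<phi> \<psi>)
    (simp_all add: act_lin pr_grade F.scale_right_distrib add_ac)

lemma cact_lin: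
  assumes "xs \<in> lists p" "\<phi> \<in> V"
  shows "cact xs (A + A') \<phi> = cact xs A \<phi> + cact xs A' \<phi>" "cact xs (sc c A) \<phi> = sF c (cact xs A \<phi>)"
  using assms
proof (induction xs arbitrary: A A' \<phi>)
  case Nil
  {
    case 1
    then show ?case using V_D(3)[OF 1 pr_grade pr_grade, of "[]" "[]"]
      by (simp add: pr_add act_lin pr_grade add_ac)
  next
    case 2
    then show ?case using V_D(4)[OF 2 pr_grade, of "[]" "[]"]
      by (simp add: pr_scale act_lin pr_grade F.scale_right_distrib)
  }
next
  case (Cons x xs)
  {
    case 1
    then show ?case using Cons.hyps Cons.IH(1) deriv_V by (simp add: br_simps)
  next
    case 2
    then show ?case using Cons.hyps Cons.IH(2) deriv_V by (simp add: br_simps F.scale_right_distrib)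
  }
qed

lemma cact_zero: "xs \<in> lists p \<Longrightarrow> \<phi> \<in> V \<Longrightarrow> cact xs 0 \<phi> = 0"
  using cact_lin(2)[of xs \<phi> 0 0] by simp

text \<open>Induction on the prefix \<open>u\<close> reduces each property to the first letters.
  Symmetry then rests on commutativity of \<open>p\<close>, by which the two iterated brackets with
  \<open>A\<close> agree.\<close>

lemma cop_V: assumes "\<phi> \<in> V" shows "cop A \<phi> \<in> V"
proof (rule V_I)
  show "cop A \<phi> xs = 0" if "xs \<notin> lists p" for xs using that by (simp add: cop_def)
next
  fix x y u v assume *: "x \<in> p" "y \<in> p" "u \<in> lists p" "v \<in> lists p"
  have "cact (u @ x # y # v) A \<phi> = cact (u @ y # x # v) A \<phi>"
    using *(3) assms
  proof (induction u arbitrary: A \<phi>)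
    case Nil
    have "(\<lambda>ys. \<phi> (x # y # ys)) = (\<lambda>ys. \<phi> (y # x # ys))"
    proof
      fix ys show "\<phi> (x # y # ys) = \<phi> (y # x # ys)"
        using V_D(2)[OF Nil(1) *(1,2), of "[]" ys] V_D(1)[OF Nil(1)] by (cases "ys \<in> lists p") auto
    qed
    moreover have "br y (br x A) = br x (br y A)"
      using br_derivation[of y x A] br_11[OF *(2,1)] by (simp add: br_simps)
    ultimately show ?case by (simp add: add_ac)
  next
    case (Cons z u)
    then show ?case using deriv_V by simp
  qed
  then show "cop A \<phi> (u @ x # y # v) = cop A \<phi> (u @ y # x # v)" using * by (simp add: cop_def)
next
  fix x y u v assume *: "x \<in> p" "y \<in> p" "u \<in> lists p" "v \<in> lists p"
  have "cact (u @ (x + y) # v) A \<phi> = cact (u @ x # v) A \<phi> + cact (u @ y # v) A \<phi>"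
    using *(3) assms
  proof (induction u arbitrary: A \<phi>)
    case Nil
    have "(\<lambda>ys. \<phi> ((x + y) # ys)) = (\<lambda>ys. \<phi> (x # ys) + \<phi> (y # ys))"
    proof
      fix ys show "\<phi> ((x + y) # ys) = \<phi> (x # ys) + \<phi> (y # ys)"
        using V_D(3)[OF Nil(1) *(1,2), of "[]" ys] V_D(1)[OF Nil(1)] by (cases "ys \<in> lists p") auto
    qed
    then show ?case using *(4) Nil(1) by (simp add: cact_fun br_simps cact_lin add_ac)
  next
    case (Cons z u)
    then show ?case using deriv_V by (simp add: add_ac)
  qed
  then show "cop A \<phi> (u @ (x + y) # v) = cop A \<phi> (u @ x # v) + cop A \<phi> (u @ y # v)"
    using * p_closed by (simp add: cop_def)
next
  fix x u v c assume *: "x \<in> p" "u \<in> lists p" "v \<in> lists p"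
  have "cact (u @ sc c x # v) A \<phi> = sF c (cact (u @ x # v) A \<phi>)"
    using *(2) assms
  proof (induction u arbitrary: A \<phi>)
    case Nil
    have "(\<lambda>ys. \<phi> (sc c x # ys)) = (\<lambda>ys. sF c (\<phi> (x # ys)))"
    proof
      fix ys show "\<phi> (sc c x # ys) = sF c (\<phi> (x # ys))"
        using V_D(4)[OF Nil(1) *(1), of "[]" ys] V_D(1)[OF Nil(1)] by (cases "ys \<in> lists p") auto
    qed
    then show ?case using *(3) Nil(1) by (simp add: cact_fun br_simps cact_lin F.scale_right_distrib)
  next
    case (Cons z u)
    then show ?case using deriv_V by (simp add: F.scale_right_distrib)
  qed
  then show "cop A \<phi> (u @ sc c x # v) = sF c (cop A \<phi> (u @ x # v))"
    using * p_closed by (simp add: cop_def)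
qed

lemma deriv_cop:
  assumes "x \<in> p"
  shows "(\<lambda>ys. cop A \<phi> (x # ys)) = (\<lambda>ys. cop A (\<lambda>zs. \<phi> (x # zs)) ys + cop (br x A) \<phi> ys)"
  using assms by (auto simp: cop_def fun_eq_iff)

text \<open>Differentiating by the first letter \<open>x\<close> turns the claim into the same claim
  for the derivative of \<phi> and for the pairs \<open>[x, A]\<close>, \<open>A'\<close> and
  \<open>A\<close>, \<open>[x, A']\<close>. The empty word is \<open>pr_br\<close> together with the
  bracket relation on \<open>F\<close>.\<close>

lemma cact_br:
  assumes "xs \<in> lists p" "\<phi> \<in> V"
  shows "cact xs (br A A') \<phi> = cact xs A (cop A' \<phi>) - cact xs A' (cop A \<phi>)"
  using assms
proof (induction xs arbitrary: A A' \<phi>)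
  case Nil
  have e: "cact [] A (cop A' \<phi>) = act (pr 0 A) (act (pr 0 A') (\<phi> [])) + act (pr 0 A) (\<phi> [pr 1 A'])
      + (act (pr 0 A') (\<phi> [pr 1 A]) + \<phi> [pr 1 A, pr 1 A']
      + (act (pr 0 (br (pr 1 A) A')) (\<phi> []) + \<phi> [pr 1 (br (pr 1 A) A')]))" for A A'
    by (simp add: cop_def pr_grade act_lin)
  have s: "\<phi> [pr 1 A, pr 1 A'] = \<phi> [pr 1 A', pr 1 A]"
    using V_D(2)[OF Nil(1) pr_grade pr_grade, of "[]" "[]"] by simp
  have skew: "br (pr 1 A') A = - br A (pr 1 A')" by (rule br_skew)
  have neg: "pr i (- x) = sc (-1) (pr i x)" for i x using pr_scale[of i "-1" x] by simp
  have a: "act (pr 0 (br (pr 1 A') A)) v = - act (pr 0 (br A (pr 1 A'))) v" for v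
    by (simp add: skew neg act_lin(4)[OF pr_grade] del: F.scale_minus_left scale_minus_left) simp
  have b: "\<phi> [pr 1 (br (pr 1 A') A)] = - \<phi> [pr 1 (br A (pr 1 A'))]"
    using V_D(4)[OF Nil(1) pr_grade, of "[]" "[]" "-1" "br A (pr 1 A')"]
    by (simp add: skew neg del: scale_minus_left)
  have g: "br (pr 0 A) (pr 0 A') \<in> grade 0" using br_grade[OF pr_grade pr_grade, of 0 A 0 A'] by simp
  have c: "act (pr 0 (br A A')) v = act (pr 0 A) (act (pr 0 A') v) - act (pr 0 A') (act (pr 0 A) v)
      + (act (pr 0 (br (pr 1 A) A')) v + act (pr 0 (br A (pr 1 A'))) v)" for v
    using g p_closed by (simp add: pr_br(1)[of A A'] act_lin(3) pr_grade subspace_add[OF grade_subspace] act_br)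
  have d: "\<phi> [pr 1 (br A A')] = \<phi> [pr 1 (br (pr 1 A) A')] + \<phi> [pr 1 (br A (pr 1 A'))]"
    using V_D(3)[OF Nil(1) pr_grade pr_grade, of "[]" "[]"] by (simp add: pr_br(2)[of A A'])
  show ?case unfolding e by (simp add: a b c d s)
next
  case (Cons x xs)
  then have x: "x \<in> p" and xs: "xs \<in> lists p" by auto
  note dV = deriv_V[OF Cons.prems x]
  have e: "cact (x # xs) A (cop A' \<phi>) = cact xs A (cop A' (\<lambda>ys. \<phi> (x # ys))) + cact xs A (cop (br x A') \<phi>)
      + cact xs (br x A) (cop A' \<phi>)" for A A'
    using x by (simp add: deriv_cop cact_fun)
  have "cact (x # xs) (br A A') \<phi> = cact xs (br A A') (\<lambda>ys. \<phi> (x # ys))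
      + (cact xs (br (br x A) A') \<phi> + cact xs (br A (br x A')) \<phi>)"
    using Cons.prems xs by (simp add: br_derivation[of x] cact_lin)
  then show ?case
    unfolding e Cons.IH[OF dV] Cons.IH[OF Cons.prems] by (simp add: algebra_simps)
qed

lemma vector_space_cscaleF: "vector_space cscaleF"
  by unfold_locales (auto simp: cscaleF_def fun_eq_iff F.scale_right_distrib F.scale_left_distrib)

lemma V_subspace: "Modules.module.subspace cscaleF V"
proof -
  interpret M: vector_space cscaleF by (rule vector_space_cscaleF)
  show ?thesis
  proof (rule M.subspaceI)
    show "0 \<in> V" by (rule V_I) simp_all
    show "x + y \<in> V" if "x \<in> V" "y \<in> V" for x y
      by (rule V_I) (use V_D[OF that(1)] V_D[OF that(2)] in \<open>simp_all add: F.scale_right_distrib\<close>)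
    show "cscaleF c x \<in> V" if "x \<in> V" for c x
      by (rule V_I) (use V_D[OF that] in \<open>simp_all add: cscaleF_def F.scale_right_distrib F.scale_left_commute mult.commute\<close>)
  qed
qed

lemma coinduced_module: "subalgebra_module sc br UNIV cscaleF cop V"
proof -
  interpret M: vector_space cscaleF by (rule vector_space_cscaleF)
  have "subalgebra sc br UNIV" by unfold_locales simp_all
  moreover have "subalgebra_module_axioms sc br UNIV cscaleF cop V"
  proof
    show "cop (br x y) v = cop x (cop y v) - cop y (cop x v)" if "v \<in> V" for x y v
      using cact_br[OF _ that] by (auto simp: fun_eq_iff cop_def[of _ "cop _ _"] cop_def[of "br x y"])
    show "cop (x + y) v = cop x v + cop y v" "cop (sc c x) v = cscaleF c (cop x v)" if "v \<in> V" for x y c v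
      using cact_lin[OF _ that] by (auto simp: fun_eq_iff cop_def cscaleF_def)
    show "cop x (v + w) = cop x v + cop x w" "cop x (cscaleF c v) = cscaleF c (cop x v)" for x v w c
      using cact_fun by (auto simp: fun_eq_iff cop_def cscaleF_def plus_fun_def)
  qed (use V_subspace cop_V in auto)
  ultimately show ?thesis
    using vector_space_cscaleF by (simp add: subalgebra_module_def)
qed

definition cst :: "'f \<Rightarrow> 'l list \<Rightarrow> 'f"
  where "cst f = (\<lambda>xs. if xs = [] then f else 0)"

lemma cst_simps: "cst f [] = f" "cst f (x # xs) = 0"
  by (simp_all add: cst_def)

lemma cst_V: "cst f \<in> V"
  by (rule V_I) (auto simp: cst_def)

text \<open>If \<open>A\<close> has no part of grade -1, its brackets with \<open>p\<close> stay in
  \<open>p\<close>, which differentiates the constant series to zero. So the constants form a copy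
  of \<open>F\<close> over the parabolic subalgebra.\<close>

lemma cst_cop:
  assumes A: "pr (-1) A = 0"
  shows "cop A (cst f) = cst (act (pr 0 A) f)"
proof -
  have c0: "cact xs C (\<lambda>ys. 0) = 0" for xs C using cact_fun(2)[of xs C 0 "\<lambda>_. 0"] by simp
  have d: "(\<lambda>ys. cst f (x # ys)) = (\<lambda>ys. 0)" for x by (simp add: cst_def)
  have act0: "act 0 f = 0" using act_lin(4)[of 0 0 f] p_closed grade_subspace[of 0] by (simp add: subspace_def)
  have 1: "cact xs Y (cst f) = 0" if Y: "Y \<in> p" "xs \<in> lists p" for xs Y
  proof (cases xs)
    case Nil
    then show ?thesis using pr_other[OF Y(1), of 0] act0 by (simp add: cst_def)
  next
    case (Cons x ys)
    then show ?thesis using Y br_11[of x Y] by (simp add: d c0 cact_zero[OF _ cst_V])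
  qed
  have "cact (x # xs) A (cst f) = 0" if "x \<in> p" "xs \<in> lists p" for x xs
  proof -
    have "br x A = br x (pr 0 A)"
      using pr_sum[of A] A br_11[OF that(1) pr_grade, of A] by (metis add.left_neutral add.right_neutral br_simps(2))
    moreover have "br x (pr 0 A) \<in> p" using br_grade[OF that(1) pr_grade, of 0 A] by simp
    ultimately show ?thesis using 1 that by (simp add: d c0)
  qed
  note 2 = this
  have 3: "cact [] A (cst f) = act (pr 0 A) f" by (simp add: cst_def)
  show ?thesis
  proof
    fix xs show "cop A (cst f) xs = cst (act (pr 0 A) f) xs"
      by (cases xs) (simp_all add: cop_def cst_simps 2 3 del: cact.simps)
  qed
qed

end

context weight_module
begin

text \<open>Split \<open>x\<close> into its graded parts, which move \<open>N d\<close> to itself or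
  to a neighbouring component, or kill it.\<close>

lemma span_N_stable:
  assumes "w \<in> V.span (\<Union>d. N d)" shows "\<rho> x w \<in> V.span (\<Union>d. N d)"
proof -
  let ?S = "V.span (\<Union>d. N d)"
  have NS: "v \<in> N d \<Longrightarrow> v \<in> ?S" for v d by (rule V.span_base) blast
  have "\<rho> x v \<in> ?S" if v: "v \<in> N d" for v d
  proof -
    have "\<rho> (pr 0 x) v \<in> ?S" using grade0_N[OF pr_grade v] by (rule NS)
    moreover have "\<rho> (pr (-1) x) v \<in> ?S" using N_SucI[OF pr_grade v] by (rule NS)
    moreover have "\<rho> (pr 1 x) v \<in> ?S"
    proof (cases d)
      case 0 then show ?thesis using grade1_N(1)[OF pr_grade] v by (simp add: V.span_zero)
    next
      case (Suc e) then show ?thesis using grade1_N(2)[OF pr_grade, of v e] v by (intro NS[of _ e]) simp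
    qed
    ultimately have "\<rho> (pr 1 x + (pr 0 x + pr (-1) x)) v \<in> ?S" by (simp add: rho_simps' V.span_add)
    then show ?thesis by (simp only: pr_sum[symmetric])
  qed
  then have "?S \<subseteq> {v. \<rho> x v \<in> ?S}"
    by (intro V.span_minimal rho_vimage_subspace) auto
  then show ?thesis using assms by blast
qed

end

section \<open>The theorem\<close>

context compactly_causal_data
begin

theorem regular_of_negative:
  fixes sF :: "complex \<Rightarrow> 'f::ab_group_add \<Rightarrow> 'f"
  assumes lam: "lam \<in> dual_space (*\<^sub>R) a"
    and irr: "irreducible_k_module br \<theta> sF act"
    and hw: "has_highest_weight br t (compact_part Z0 P) sF act (extend_functional \<tau> t a lam)"
    and neg: "\<forall>\<alpha> \<in> restricted_noncompact_positive Z0 a P.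
           a_inner br \<tau> t a (\<lambda>H. lam H + rho br \<tau> a P H) \<alpha> < 0"
  shows "regular_weight br \<theta> Z0 sF act"
proof -
  let ?k = "k_complex \<theta>" and ?q = "k_p_plus br \<theta> Z0" and ?act = "extend_action br \<theta> Z0 act"
  have km: "k_module br \<theta> sF act" and F_nz: "\<exists>v::'f. v \<noteq> 0"
    and F_irr: "\<And>W. Modules.module.subspace sF W \<Longrightarrow> (\<forall>X\<in>?k. act X ` W \<subseteq> W) \<Longrightarrow> W = {0} \<or> W = UNIV"
    using irr unfolding irreducible_k_module_def by blast+
  have "vector_space sF" using km unfolding k_module_def by blast
  then interpret F: vector_space sF .
  obtain AF where AF: "finite AF" "F.span AF = UNIV" using km unfolding k_module_def by blast
  have act_linear: "Vector_Spaces.linear sF sF (act X)" if "X \<in> ?k" for X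
    using km that unfolding k_module_def by blast
  have act: "act X (v + w) = act X v + act X w" "act X (sF c v) = sF c (act X v)"
    "Y \<in> ?k \<Longrightarrow> act (X + Y) v = act X v + act Y v" "act (cscale c X) v = sF c (act X v)"
    "Y \<in> ?k \<Longrightarrow> act (cb X Y) v = act X (act Y v) - act Y (act X v)" if "X \<in> ?k" for X Y v w c
    using km that F.linear_apply[OF act_linear[OF that]] unfolding k_module_def by blast+
  interpret co: coinduced cscale cb KC T BB dl wt Z0 Xe sF act
    by unfold_locales (simp_all only: grade_0 act)
  have q_iff: "X \<in> ?q \<longleftrightarrow> W.pr (-1) X = 0" for X
  proof
    assume "X \<in> ?q"
    then obtain Y Y' where Y: "X = Y + Y'" "Y \<in> W.grade 0" "Y' \<in> W.grade 1"
      by (auto simp: k_p_plus_def grade_0 grade_1)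
    show "W.pr (-1) X = 0" using W.pr_other[OF Y(2), of "-1"] W.pr_other[OF Y(3), of "-1"] by (simp add: Y(1) W.pr_add)
  next
    assume "W.pr (-1) X = 0"
    then have "X = W.pr 0 X + W.pr 1 X" using W.pr_sum[of X] by (metis add.commute add.right_neutral)
    then show "X \<in> ?q" using W.pr_grade[of 0 X] W.pr_grade[of 1 X]
      unfolding k_p_plus_def grade_0[symmetric] grade_1[symmetric] by blast
  qed
  have ext: "?act X = act (W.pr 0 X)" if "X \<in> ?q" for X
    unfolding extend_action_def
  proof (rule arg_cong[where f = act], rule the_equality)
    have "X = W.pr 1 X + W.pr 0 X" using that W.pr_sum[of X] by (simp add: q_iff)
    then have "X - W.pr 0 X = W.pr 1 X" by (metis add_diff_cancel_right')
    then show "W.pr 0 X \<in> ?k \<and> X - W.pr 0 X \<in> p_plus br Z0"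
      using W.pr_grade[of 0 X] W.pr_grade[of 1 X] by (simp add: grade_0 grade_1)
    fix Y assume Y: "Y \<in> ?k \<and> X - Y \<in> p_plus br Z0"
    then have "W.pr 0 Y = Y" "W.pr 0 (X - Y) = 0"
      using W.pr_other[of "X - Y" 1 0] by (simp_all add: W.pr_same grade_1 flip: grade_0)
    then show "Y = W.pr 0 X" using W.pr_add[of 0 Y "X - Y"] by simp
  qed
  have q_sub: "C.subspace ?q"
    by (rule C.subspaceI) (simp_all add: q_iff W.pr_zero W.pr_add W.pr_scale)
  have q_br: "cb X Y \<in> ?q" if "X \<in> ?q" "Y \<in> ?q" for X Y
  proof -
    have XY: "X = W.pr 1 X + W.pr 0 X" "Y = W.pr 1 Y + W.pr 0 Y"
      using that W.pr_sum[of X] W.pr_sum[of Y] by (simp_all add: q_iff)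
    have "cb X Y = cb (W.pr 1 X) (W.pr 0 Y) + cb (W.pr 0 X) (W.pr 1 Y) + cb (W.pr 0 X) (W.pr 0 Y)"
      by (subst XY(1), subst XY(2)) (simp add: L.br_simps(1,2) W.br_11[OF W.pr_grade W.pr_grade] add_ac)
    moreover have "cb (W.pr 1 X) (W.pr 0 Y) \<in> W.grade 1" "cb (W.pr 0 X) (W.pr 1 Y) \<in> W.grade 1"
      "cb (W.pr 0 X) (W.pr 0 Y) \<in> W.grade 0"
      using W.br_grade[OF W.pr_grade W.pr_grade, of 1 X 0 Y] W.br_grade[OF W.pr_grade W.pr_grade, of 0 X 1 Y]
        W.br_grade[OF W.pr_grade W.pr_grade, of 0 X 0 Y] by simp_all
    ultimately show ?thesis
      unfolding q_iff by (simp add: W.pr_add W.pr_other[of _ 1 "-1"] W.pr_other[of _ 0 "-1"])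
  qed
  \<comment> \<open>Grade 1 is an ideal of the parabolic subalgebra, so taking the grade 0 part is a
    homomorphism there.\<close>
  have pr_br_q: "W.pr 0 (cb X Y) = cb (W.pr 0 X) (W.pr 0 Y)" if "X \<in> ?q" "Y \<in> ?q" for X Y
  proof -
    have p0: "W.pr 0 V = 0" if "V \<in> W.grade 1" for V using W.pr_other[OF that, of 0] by simp
    have b: "W.pr 0 (cb U V) = 0" if U: "U \<in> W.grade 1" and V: "V \<in> ?q" for U V
    proof -
      have "V = W.pr 1 V + W.pr 0 V" using V W.pr_sum[of V] by (simp add: q_iff)
      then have "cb U V = cb U (W.pr 0 V)" using W.br_11[OF U W.pr_grade, of V] by (metis L.br_simps(2) add_0)
      moreover have "cb U (W.pr 0 V) \<in> W.grade 1" using W.br_grade[OF U W.pr_grade, of 0 V] by simp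
      ultimately show ?thesis using p0 by simp
    qed
    have "W.pr 0 (cb X (W.pr 1 Y)) = 0"
      using b[OF W.pr_grade that(1), of Y] L.br_skew[of X "W.pr 1 Y"] W.pr_scale[of 0 "-1" "cb (W.pr 1 Y) X"] by simp
    then show ?thesis using W.pr_br(1)[of X Y] b[OF W.pr_grade that(2), of X] by simp
  qed
  have pk: "W.pr 0 X \<in> ?k" for X using W.pr_grade[of 0 X] by (simp add: grade_0)
  interpret I: induced_module cscale cb ?q sF ?act
  proof (intro induced_module.intro subalgebra_module.intro subalgebra.intro L.lie_algebra_axioms
      subalgebra_axioms.intro subalgebra_module_axioms.intro F.vector_space_axioms)
    show "C.subspace ?q" by (rule q_sub)
    show "F.subspace UNIV" by simp
    note e = q_br C.subspace_add[OF q_sub] C.subspace_scale[OF q_sub]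
    show "?act (cb x y) v = ?act x (?act y v) - ?act y (?act x v)" if "x \<in> ?q" "y \<in> ?q" for x y v
      using that by (simp add: ext e pr_br_q act pk)
    show "?act (x + y) v = ?act x v + ?act y v" if "x \<in> ?q" "y \<in> ?q" for x y v
      using that by (simp add: ext e W.pr_add act pk)
    show "?act (cscale c x) v = sF c (?act x v)" if "x \<in> ?q" for x c v
      using that by (simp add: ext e W.pr_scale act pk)
  qed (simp_all add: ext act pk q_br)
  have NN: "N_module br \<theta> Z0 sF act = I.NN"
    unfolding N_module_def I.NN_def I.rmul_def[abs_def] ..
  interpret TS: vector_space I.smul by (rule I.vector_space_smul)
  have nonzero: "carrier I.NN \<noteq> {\<one>\<^bsub>I.NN\<^esub>}"
  proof -
    obtain f0 :: 'f where "f0 \<noteq> 0" using F_nz by blast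
    show ?thesis
    proof (rule I.induced_module_nonzero[OF co.coinduced_module, where j = co.cst])
      show "co.cop X (co.cst f) = co.cst (?act X f)" if "X \<in> ?q" for X f
        using co.cst_cop[of X f] that by (simp add: q_iff ext)
      show "co.cst f0 \<noteq> 0" using \<open>f0 \<noteq> 0\<close> by (auto simp: co.cst_def fun_eq_iff)
    qed (auto simp: co.cst_V, auto simp: co.cst_def co.cscaleF_def fun_eq_iff)
  qed
  interpret TT: vector_space_pair I.smul I.smul by unfold_locales
  \<comment> \<open>A linear left inverse of the inclusion of \<open>Rel\<close> projects onto
    \<open>Rel\<close>; the complementary projection \<pi> has kernel \<open>Rel\<close>, so its
    range is a linear copy of the induced module.\<close>
  have "\<exists>\<eta>. range \<eta> \<subseteq> I.Rel \<and> Vector_Spaces.linear I.smul I.smul \<eta> \<and> (\<forall>v\<in>I.Rel. \<eta> (id v) = v)"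
    using TT.linear_exists_left_inverse_on[OF TS.linear_id I.Rel_subspace] by auto
  then obtain \<eta> where \<eta>: "\<And>v. \<eta> v \<in> I.Rel" "Vector_Spaces.linear I.smul I.smul \<eta>" "\<And>v. v \<in> I.Rel \<Longrightarrow> \<eta> v = v"
    by auto
  define \<pi> where "\<pi> v = v - \<eta> v" for v
  note eta_lin = TS.linear_apply[OF \<eta>(2)]
  have pi_lin: "\<pi> (v + w) = \<pi> v + \<pi> w" "\<pi> (v - w) = \<pi> v - \<pi> w" "\<pi> (I.smul c v) = I.smul c (\<pi> v)" for v w c
    by (simp_all add: \<pi>_def eta_lin TS.scale_right_diff_distrib)
  have pi_Rel: "\<pi> v = 0" if "v \<in> I.Rel" for v using \<eta>(3)[OF that] by (simp add: \<pi>_def)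
  have pi_eq: "\<pi> v = \<pi> w" if "v - w \<in> I.Rel" for v w using pi_Rel[OF that] by (simp add: pi_lin)
  have pi_sub: "v - \<pi> v \<in> I.Rel" for v using \<eta>(1) by (simp add: \<pi>_def)
  have lft_diff: "I.lft X (v - w) = I.lft X v - I.lft X w" for X v w
    using I.lft_simps(2)[of X "v - w" w] by (simp add: eq_diff_eq)
  have pi_lft: "\<pi> (I.lft X (\<pi> v)) = \<pi> (I.lft X v)" for X v
    using I.Rel_lft[OF pi_sub[of v], of X] by (intro pi_eq[symmetric]) (simp add: lft_diff)
  define \<rho> where "\<rho> X v = \<pi> (I.lft X v)" for X v
  define j where "j f = \<pi> (sg [] f)" for f
  have rho_pi: "\<rho> X (\<pi> v) = \<pi> (I.lft X v)" for X v by (simp add: \<rho>_def pi_lft)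
  let ?\<Lambda> = "extend_functional \<tau> t a lam"
  obtain v0 where v0: "v0 \<noteq> 0" "\<And>H. H \<in> T \<Longrightarrow> act H v0 = sF (?\<Lambda> H) v0"
    "\<And>\<beta> X. \<beta> \<in> compact_part Z0 P \<Longrightarrow> X \<in> root_space br t \<beta> \<Longrightarrow> act X v0 = 0"
    using hw unfolding has_highest_weight_def by blast
  have zero_k: "0 \<in> ?k" using W.grade_subspace[of 0] C.subspace_0 by (simp add: grade_0)
  have act0: "act 0 v = 0" for v using act(4)[OF zero_k, of 0 v] by simp
  have q0: "X \<in> ?q" "?act X = act X" if "X \<in> W.grade 0" for X
  proof -
    show "X \<in> ?q" using W.pr_other[OF that, of "-1"] by (simp add: q_iff)
    then show "?act X = act X" using W.pr_same[OF that] by (simp add: ext)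
  qed
  have q1: "X \<in> ?q" "?act X f = 0" if "X \<in> W.grade 1" for X f
  proof -
    show "X \<in> ?q" using W.pr_other[OF that, of "-1"] by (simp add: q_iff)
    then show "?act X f = 0" using W.pr_other[OF that, of 0] by (simp add: ext act0)
  qed
  have rho_j: "\<rho> X (j f) = j (?act X f)" if "X \<in> ?q" for X f
    using I.Rel_act[OF that, of f] by (simp add: j_def rho_pi I.lft_simps pi_eq)
  interpret M: weight_module cscale cb KC T BB dl wt Z0 Xe I.smul sF \<rho> act j v0 ?\<Lambda> AF
  proof (intro weight_module.intro W.weight_basis_axioms TS.vector_space_axioms F.vector_space_axioms
      weight_module_axioms.intro)
    show "Vector_Spaces.linear I.smul I.smul (\<rho> x)" for x
      by (rule TS.linear_endoI) (simp_all add: \<rho>_def I.lft_simps I.lft_smul pi_lin)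
    show "\<rho> (x + y) v = \<rho> x v + \<rho> y v" for x y v
      using pi_Rel[OF I.Rel_relations(1)[of x y v]] by (simp add: \<rho>_def pi_lin algebra_simps)
    show "\<rho> (cscale c x) v = I.smul c (\<rho> x v)" for c x v
      using pi_Rel[OF I.Rel_relations(2)[of c x v]] by (simp add: \<rho>_def pi_lin)
    show "\<rho> (cb x y) v = \<rho> x (\<rho> y v) - \<rho> y (\<rho> x v)" for x y v
    proof -
      have "\<rho> x (\<rho> y v) = \<pi> (I.lft x (I.lft y v))" for x y by (simp add: \<rho>_def pi_lft)
      then show ?thesis using pi_Rel[OF I.Rel_relations(3)[of x y v]] by (simp add: \<rho>_def pi_lin algebra_simps)
    qed
    show "j (f + g) = j f + j g" "j (sF c f) = I.smul c (j f)" for f g c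
      by (simp_all add: j_def single_add pi_lin flip: I.smul_simps(1))
    show "\<rho> x (j f) = j (act x f)" if "x \<in> W.grade 0" for x f using rho_j[OF q0(1)[OF that]] q0(2)[OF that] by simp
    show "\<rho> x (j f) = 0" if "x \<in> W.grade 1" for x f
      using rho_j[OF q1(1)[OF that]] q1(2)[OF that] pi_lin(2)[of 0 0] by (simp add: j_def)
    show "finite AF" "F.span AF = UNIV" by (fact AF)+
    show "W = UNIV" if "F.subspace W" "\<And>x w. x \<in> W.grade 0 \<Longrightarrow> w \<in> W \<Longrightarrow> act x w \<in> W" "W \<noteq> {0}" for W
    proof -
      have "\<forall>X\<in>?k. act X ` W \<subseteq> W" using that(2) unfolding grade_0 by blast
      then show ?thesis using F_irr[OF that(1)] that(3) by blast
    qed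
    show "v0 \<noteq> 0" by (fact v0)
    show "act H v0 = sF (?\<Lambda> H) v0" if "H \<in> T" for H using that by (rule v0)
    show "act e v0 = 0" if e: "\<And>H. H \<in> T \<Longrightarrow> cb H e = cscale (\<gamma> H) e" "\<gamma> Z0 = 0" "0 < Re (\<gamma> Xe)" for e \<gamma>
    proof (cases "e = 0")
      case False
      \<comment> \<open>\<gamma> is controlled on \<open>T\<close> only; cutting it off elsewhere
        gives a functional in the sense of \<open>dual_space\<close>, which can be recognized as a
        root.\<close>
      define \<beta> where "\<beta> H = (if H \<in> T then \<gamma> H else 0)" for H
      have \<beta>: "\<beta> H = \<gamma> H" if "H \<in> T" for H using that unfolding \<beta>_def by (rule if_P)
      have \<beta>0: "\<beta> H = 0" if "H \<notin> T" for H using that unfolding \<beta>_def by (rule if_not_P)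
      have "\<beta> (x + y) = \<beta> x + \<beta> y" if "x \<in> T" "y \<in> T" for x y
      proof -
        have "cscale (\<gamma> (x + y)) e = cscale (\<gamma> x + \<gamma> y) e"
          using e(1)[OF C.subspace_add[OF T_subspace that]] e(1)[OF that(1)] e(1)[OF that(2)]
          by (simp add: L.br_simps C.scale_left_distrib)
        then show ?thesis using False that C.subspace_add[OF T_subspace that] by (simp only: \<beta> C.scale_cancel_right) simp
      qed
      moreover have "\<beta> (cscale c x) = c * \<beta> x" if "x \<in> T" for c x
      proof -
        have "cscale (\<gamma> (cscale c x)) e = cscale (c * \<gamma> x) e"
          using e(1)[OF C.subspace_scale[OF T_subspace that]] e(1)[OF that] by (metis L.br_simps(3) C.scale_scale)
        then show ?thesis using False that C.subspace_scale[OF T_subspace that] by (simp only: \<beta> C.scale_cancel_right) simp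
      qed
      ultimately have "\<beta> \<in> dual_space cscale T" using \<beta>0 unfolding dual_space_def by blast
      moreover have ez: "\<beta> Z0 = 0" "Re (\<beta> Xe) > 0" using e(2,3) Z0_T Xe(1) by (simp_all only: \<beta>)
      moreover have "\<beta> \<noteq> (\<lambda>_. 0)" using ez(2) by (metis less_irrefl zero_complex.sel(1))
      moreover have eb: "cb H e = cscale (\<beta> H) e" if "H \<in> T" for H using e(1)[OF that] that by (simp only: \<beta>)
      ultimately have "\<beta> \<in> lie_roots br t" using lie_rootI[OF _ _ False] by blast
      then have "\<beta> \<in> compact_part Z0 P" using ez by (simp add: compact_part_def Xe(4))
      moreover have "e \<in> root_space br t \<beta>" unfolding root_space_def using eb by blast
      ultimately show ?thesis by (rule v0(3))
    qed (simp add: act0)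
  qed
  have pi_N: "\<pi> v \<in> TS.span (\<Union>d. M.N d)" for v
  proof (induction v rule: pm_induct)
    case (single w f)
    show ?case
    proof (induction w)
      case Nil
      have "j f \<in> M.N 0" by simp
      then show ?case unfolding j_def by (intro TS.span_base) blast
    next
      case (Cons x w)
      have "\<pi> (sg (x # w) f) = \<rho> x (\<pi> (sg w f))" by (simp add: rho_pi I.lft_simps)
      then show ?case using M.span_N_stable[OF Cons] by simp
    qed
  qed (simp add: pi_lin TS.span_add)
  have dich: "S \<subseteq> I.Rel \<or> S = UNIV"
    if S: "TS.subspace S" "\<And>X v. v \<in> S \<Longrightarrow> I.lft X v \<in> S" "I.Rel \<subseteq> S" for S
  proof (rule disjCI)
    assume "S \<noteq> UNIV"
    show "S \<subseteq> I.Rel"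
    proof (rule ccontr)
      assume "\<not> S \<subseteq> I.Rel"
      then obtain v where v: "v \<in> S" "v \<notin> I.Rel" by blast
      \<comment> \<open>As \<open>S\<close> contains \<open>Rel\<close>, membership in
        \<open>S\<close> does not change under \<pi>, and \<open>S\<close> can be used as a stable
        subspace for \<rho>.\<close>
      have pi_S: "\<pi> v \<in> S \<longleftrightarrow> v \<in> S" for v
        using TS.subspace_diff[OF S(1), of v "\<eta> v"] TS.subspace_add[OF S(1), of "\<pi> v" "\<eta> v"] \<eta>(1)[of v] S(3)
        by (auto simp: \<pi>_def)
      have "\<pi> v \<noteq> 0" using v(2) pi_sub[of v] by auto
      \<comment> \<open>A submodule containing all \<open>1 \<otimes> f\<close> contains every word
        applied to them, hence is everything.\<close>
      moreover have "\<not> range j \<subseteq> S"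
      proof
        assume "range j \<subseteq> S"
        have "w \<in> S" for w
        proof (induction w rule: pm_induct)
          case (single w f)
          show ?case
          proof (induction w)
            case Nil
            show ?case using \<open>range j \<subseteq> S\<close> pi_S by (auto simp: j_def)
          next
            case (Cons x w)
            then show ?case using S(2)[OF Cons, of x] by (simp add: I.lft_simps)
          qed
        qed (rule TS.subspace_add[OF S(1)])
        then show False using \<open>S \<noteq> UNIV\<close> by blast
      qed
      moreover have "\<rho> x w \<in> S" if "w \<in> S" for x w using S(2)[OF that] by (simp add: \<rho>_def pi_S)
      ultimately have "\<exists>ys. ys \<noteq> [] \<and> set ys \<subseteq> {b \<in> BB. wt b Z0 = -1} \<and> M.cas (M.nu ys) = M.cas ?\<Lambda> \<and>
        (\<forall>b\<in>BB. wt b Z0 = 0 \<and> Re (wt b Xe) > 0 \<longrightarrow>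
          (\<exists>n::nat. 2 * M.nu ys (cb b (dl b)) = of_nat n * wt b (cb b (dl b))))"
        using M.singular_weight_exists[OF S(1) _ _ pi_N[of v]] v(1) pi_S by blast
      then obtain ys where ys: "ys \<noteq> []" "set ys \<subseteq> {b \<in> BB. wt b Z0 = -1}" "M.cas (M.nu ys) = M.cas ?\<Lambda>"
        "\<And>b. b \<in> BB \<Longrightarrow> wt b Z0 = 0 \<Longrightarrow> Re (wt b Xe) > 0 \<Longrightarrow>
          \<exists>n::nat. 2 * M.nu ys (cb b (dl b)) = of_nat n * wt b (cb b (dl b))" by blast
      have nu: "M.nu ys = (\<lambda>H. ?\<Lambda> H + (\<Sum>y\<leftarrow>ys. wt y H))" by (rule HOL.ext) (simp add: M.nu_def)
      have cas: "M.cas \<mu> = casimir \<mu>" for \<mu> by (simp add: M.cas_def casimir_def)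
      show False
        by (rule no_singular_weight[OF lam neg ys(1,2)]) (use ys(3,4) in \<open>simp_all only: nu cas\<close>)
    qed
  qed
  have sub: "J = {\<one>\<^bsub>I.NN\<^esub>} \<or> J = carrier I.NN" if "lsubmodule (carrier I.G.U) I.NN J" for J
    by (rule I.submodule_dichotomy[OF dich that])
  have one: "lact I.NN u \<one>\<^bsub>I.NN\<^esub> = \<one>\<^bsub>I.NN\<^esub>" if "u \<in> carrier I.G.U" for u
    using that by (simp add: I.NN_simps I.lmul_simps)
  have "L_kernel br \<theta> Z0 sF act = {\<one>\<^bsub>I.NN\<^esub>}"
    unfolding L_kernel_def NN by (rule the_maximal_lsubmodule_trivial[OF I.group_NN nonzero one sub])
  then show ?thesis
    unfolding regular_weight_def L_module_def NN
    using trivial_quotient_iso[OF I.group_NN I.lact_closed] by simp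
qed

end

theorem theoremA1:
  fixes br :: "'g::real_vector \<Rightarrow> 'g \<Rightarrow> 'g"
    and \<theta> \<tau> :: "'g \<Rightarrow> 'g"
    and Z0 :: "'g cplx"
    and a :: "'g cplx set"
    and t :: "'g set"
    and P :: "('g cplx \<Rightarrow> complex) set"
    and lam :: "'g cplx \<Rightarrow> real"
    and sF :: "complex \<Rightarrow> 'f::ab_group_add \<Rightarrow> 'f"
    and act :: "'g cplx \<Rightarrow> 'f \<Rightarrow> 'f"
  assumes "compactly_causal br \<theta> \<tau>"
    and "normalized_central_element br \<theta> Z0"
    and "maximal_abelian_in (cbr br) ({0} \<times> (minus_space \<tau> \<inter> plus_space \<theta>)) a"
    and "cartan_subalgebra br t" and "t \<subseteq> plus_space \<theta>"
    and "t \<times> {0} = {x + cscale \<i> y | x y. x \<in> (t \<inter> plus_space \<tau>) \<times> {0} \<and> y \<in> a}"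
    and "positive_system br t P"
    and "{\<beta> \<in> P. \<beta> Z0 \<noteq> 0} = {\<beta> \<in> lie_roots br t. \<beta> Z0 = 1}"
    and "\<forall>\<beta>\<in>P. (\<lambda>H. - \<beta> (cmap \<tau> H)) \<in> P \<union> {\<mu>. \<forall>H\<in>a. \<mu> H = 0}"
    and "lam \<in> dual_space (*\<^sub>R) a"
    and "dominant_integral br t (compact_part Z0 P) (extend_functional \<tau> t a lam)"
    and "irreducible_k_module br \<theta> sF act"
    and "has_highest_weight br t (compact_part Z0 P) sF act (extend_functional \<tau> t a lam)"
    and "\<forall>\<alpha> \<in> restricted_noncompact_positive Z0 a P.
           a_inner br \<tau> t a (\<lambda>H. lam H + rho br \<tau> a P H) \<alpha> < 0"
  shows "regular_weight br \<theta> Z0 sF act"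
proof -
  interpret compactly_causal_data br \<theta> \<tau> Z0 a t P
    using assms(1-9) by (rule compactly_causal_data.intro)
  show ?thesis using assms(10,12,13,14) by (rule regular_of_negative)
qed

end
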